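(* Let $\{h_\theta:|\theta|<1\}$ be a family of joint densities satisfying the model assumptions of the context, with score function $\dot\ell_0$ at $\theta=0$, and suppose that $$E_0\big(\dot\ell_0(X,Y)\mid X\big)=E_0\big(\dot\ell_0(X,Y)\mid Y\big)=0 \quad\text{a.s.}$$ Then Chatterjee's statistic $\hat C_n$ has no power asymptotically: for every $\alpha\in(0,1)$, every sequence $(t_n)$ with $\lim_n P_{n,0}[\sqrt n\,\hat C_n\ge t_n]=\alpha$, all $0<\epsilon\le M<\infty$, and every sequence $(\theta_n)$ with $\epsilon/\sqrt n\le|\theta_n|\le M/\sqrt n$ (and $|\theta_n|<1$), $$\liminf_{n\to\infty}P_{n,\theta_n}[\sqrt n\,\hat C_n\ge t_n]=\alpha .$$
   Context: Model assumptions. $\{h_\theta(x,y):|\theta|<1\}$ is a family of joint probability densities with respect to Lebesgue measure on $\mathbb R^2$, and $h_0(x,y)=f_0(x)g_0(y)$ with $f_0,g_0$ probability densities (so $X,Y$ are independent under $\theta=0$). The score function $\dot\ell_0(x,y)=\frac{\partial}{\partial\theta}\log h_\theta(x,y)\big|_{\theta=0}$ exists and the family is quadratic mean differentiable at $0$: $$\iint\Big(\sqrt{h_\theta}-\sqrt{h_0}-\tfrac12\theta\,\dot\ell_0\sqrt{h_0}\Big)^2dx\,dy=o(\theta^2)\quad(\theta\to0),$$ and $E_0[\dot\ell_0(X,Y)^2]>0$. (Quadratic mean differentiability implies $E_0\dot\ell_0^2<\infty$ and $E_0\dot\ell_0=0$.) $E_0$ denotes expectation when $(X,Y)$ has density $h_0$;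 $P_{n,\theta}$ denotes the joint law of an i.i.d. sample $(X_1,Y_1),\dots,(X_n,Y_n)$ from $h_\theta$. Chatterjee's statistic. Let $X_{(1)}<\cdots<X_{(n)}$ be the ordered $X_i$'s, let $Y_{[i]}$ be the $Y$-value paired with $X_{(i)}$, and let $r_i$ be the rank of $Y_{[i]}$, i.e. the number of $j$ with $Y_j\le Y_{[i]}$ (there are a.s. no ties). Then $$\hat C_n=1-\frac{3\sum_{i=1}^{n-1}|r_{i+1}-r_i|}{n^2-1}.$$ *)

theory Defs
  imports "HOL-Probability.Probability" "HOL-Library.Landau_Symbols"
begin

definition prob_density :: "('a::euclidean_space \<Rightarrow> real) \<Rightarrow> bool" where
  "prob_density f \<longleftrightarrow>
     f \<in> borel_measurable borel \<and> (\<forall>z. 0 \<le> f z) \<and> (\<integral>\<^sup>+ z. ennreal (f z) \<partial>lborel) = 1"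

definition law :: "(real \<times> real \<Rightarrow> real) \<Rightarrow> (real \<times> real) measure" where
  "law f = density lborel (\<lambda>z. ennreal (f z))"

definition sample_law :: "nat \<Rightarrow> (real \<times> real \<Rightarrow> real) \<Rightarrow> (nat \<Rightarrow> real \<times> real) measure" where
  "sample_law n f = PiM {..<n} (\<lambda>_. law f)"

(* The score is only determined almost everywhere under h 0 (where h 0 vanishes the logarithm is
   undefined), so it is specified up to the choice of a Borel version.  Positivity of h \<theta> z for
   \<theta> near 0 is part of the existence of the logarithmic derivative; it has to be stated because
   ln is total. *)
definition is_score :: "(real \<Rightarrow> real \<times> real \<Rightarrow> real) \<Rightarrow> (real \<times> real \<Rightarrow> real) \<Rightarrow> bool" where
  "is_score h l \<longleftrightarrow>
     l \<in> borel_measurable borel \<and>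
     (AE z in law (h 0).
        (\<forall>\<^sub>F \<theta> in nhds 0. 0 < h \<theta> z) \<and>
        ((\<lambda>\<theta>. ln (h \<theta> z)) has_real_derivative l z) (at 0))"

(* Integrability is stated separately because the Bochner integral of a non-integrable function
   is 0. *)
definition qmd_at_0 :: "(real \<Rightarrow> real \<times> real \<Rightarrow> real) \<Rightarrow> (real \<times> real \<Rightarrow> real) \<Rightarrow> bool" where
  "qmd_at_0 h l \<longleftrightarrow>
     (let R = (\<lambda>\<theta> z. (sqrt (h \<theta> z) - sqrt (h 0 z) - 1 / 2 * \<theta> * l z * sqrt (h 0 z))\<^sup>2)
      in (\<forall>\<^sub>F \<theta> in at 0. integrable lborel (R \<theta>)) \<and>
         (\<lambda>\<theta>. \<integral>z. R \<theta> z \<partial>lborel) \<in> o[at 0](\<lambda>\<theta>. \<theta>\<^sup>2))"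

definition model_assumptions ::
  "(real \<Rightarrow> real \<times> real \<Rightarrow> real) \<Rightarrow> (real \<Rightarrow> real) \<Rightarrow> (real \<Rightarrow> real) \<Rightarrow> (real \<times> real \<Rightarrow> real) \<Rightarrow> bool"
where
  "model_assumptions h f0 g0 l \<longleftrightarrow>
     (\<forall>\<theta>. \<bar>\<theta>\<bar> < 1 \<longrightarrow> prob_density (h \<theta>)) \<and>
     prob_density f0 \<and> prob_density g0 \<and>
     (\<forall>x y. h 0 (x, y) = f0 x * g0 y) \<and>
     is_score h l \<and> qmd_at_0 h l \<and>
     0 < (\<integral>z. (l z)\<^sup>2 \<partial>law (h 0))"

definition cond_exp_given ::
  "(real \<times> real) measure \<Rightarrow> (real \<times> real \<Rightarrow> real) \<Rightarrow> (real \<times> real \<Rightarrow> real) \<Rightarrow> real \<times> real \<Rightarrow> real"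
where
  "cond_exp_given P T l = real_cond_exp P (vimage_algebra (space P) T borel) l"

(* Indices run over 0, ..., n - 1.  sort_key is stable, so ties among the X-values (a null event)
   are broken by the index. *)
definition x_order :: "nat \<Rightarrow> (nat \<Rightarrow> real \<times> real) \<Rightarrow> nat list" where
  "x_order n s = sort_key (\<lambda>i. fst (s i)) [0..<n]"

definition y_rank :: "nat \<Rightarrow> (nat \<Rightarrow> real \<times> real) \<Rightarrow> nat \<Rightarrow> nat" where
  "y_rank n s i = card {j \<in> {..<n}. snd (s j) \<le> snd (s (x_order n s ! i))}"

definition chatterjee :: "nat \<Rightarrow> (nat \<Rightarrow> real \<times> real) \<Rightarrow> real" where
  "chatterjee n s =
     1 - 3 * (\<Sum>i<n - 1. \<bar>real (y_rank n s (Suc i)) - real (y_rank n s i)\<bar>) / ((real n)\<^sup>2 - 1)"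

definition upper_tail_prob :: "nat \<Rightarrow> (real \<times> real \<Rightarrow> real) \<Rightarrow> real \<Rightarrow> real" where
  "upper_tail_prob n f t =
     measure (sample_law n f) {s \<in> space (sample_law n f). sqrt (real n) * chatterjee n s \<ge> t}"

end

(* For a bounded b with E(b(X,Y) | X) = 0 put q_n = h_0 (1 + theta_n b).  Approximating the score in
   L2 by such b, quadratic mean differentiability makes n times the squared Hellinger distance between
   h_{theta_n} and q_n small, so the sample laws are close in total variation and q_n can replace
   h_{theta_n}.  Under q_n, given the X-values in increasing order, the Y-values are independent;
   after the quantile transform they have densities 1 + theta_n b_i on (0,1).  The statistic is within
   O(n^(-1/2)) in L2 of -3/sqrt n times the sum of kappa(U_i, U_{i+1}), where kappa is degenerate.
   Expanding the characteristic function one factor at a time, the tilts contribute to each step only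
   a term of order n^(-3/2), because their interaction with kappa has mean zero.  Hence the limit law
   is the same centred normal law as under independence. *)
theory Submission
  imports Defs
begin

section \<open>Bounded functions of uniform samples\<close>

text \<open>Quadratic mean differentiability gives no moment control of the likelihood ratio, while
  the projection error of the statistic is known only in L2 under independence. Passing to bounded
  tilts of size \<open>D / sqrt n\<close> removes this obstacle: their likelihood has second moment
  at most \<open>exp (D\<^sup>2)\<close>, so an L2 error of order n^(-1/2) under the null stays
  negligible under the tilt. After sorting by X, the tilt at position i depends on \<open>n\<close>
  and on the X-values in an uncontrolled way. The limit theorem is therefore proved for arbitrary
  triangular arrays of centred tilts subject to the size bound alone, and its validity along every
  sequence of X-vectors yields uniformity in them. The kernel arises because |r_{i+1} - r_i| counts
  the values separating U_i from U_{i+1}: the count is projected on the pair and on the single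
  values, and the remainder is a sum of mostly orthogonal terms. Finally, the critical values
  \<open>t n\<close> need not converge; the null level traps them between two quantiles of the
  continuous limit law, and this moves the level to the alternative.\<close>

definition bounded_measurable :: "'a measure \<Rightarrow> ('a \<Rightarrow> 'b::{banach,second_countable_topology}) \<Rightarrow> bool" where
  "bounded_measurable M f \<longleftrightarrow> f \<in> borel_measurable M \<and> (\<exists>C. \<forall>x\<in>space M. norm (f x) \<le> C)"

lemma bounded_measurableI:
  "f \<in> borel_measurable M \<Longrightarrow> (\<And>x. x \<in> space M \<Longrightarrow> norm (f x) \<le> C) \<Longrightarrow> bounded_measurable M f"
  by (auto simp: bounded_measurable_def)

lemma bounded_measurableD: "bounded_measurable M f \<Longrightarrow> f \<in> borel_measurable M"
  by (simp add: bounded_measurable_def)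

lemma bounded_measurable_const [intro]: "bounded_measurable M (\<lambda>_. c)"
  by (auto simp: bounded_measurable_def)

lemma bounded_measurable_add [intro]:
  assumes "bounded_measurable M f" "bounded_measurable M g"
  shows "bounded_measurable M (\<lambda>x. f x + g x)"
proof -
  obtain C D where "\<And>x. x \<in> space M \<Longrightarrow> norm (f x) \<le> C" "\<And>x. x \<in> space M \<Longrightarrow> norm (g x) \<le> D"
    using assms by (auto simp: bounded_measurable_def)
  then show ?thesis
    using assms by (intro bounded_measurableI[where C="C + D"])
      (auto simp: bounded_measurable_def intro!: norm_triangle_mono)
qed

lemma bounded_measurable_mult [intro]:
  fixes f g :: "'a \<Rightarrow> 'b::{real_normed_field,banach,second_countable_topology}"
  assumes "bounded_measurable M f" "bounded_measurable M g"
  shows "bounded_measurable M (\<lambda>x. f x * g x)"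
proof -
  obtain C D where CD: "\<And>x. x \<in> space M \<Longrightarrow> norm (f x) \<le> C" "\<And>x. x \<in> space M \<Longrightarrow> norm (g x) \<le> D"
    using assms by (auto simp: bounded_measurable_def)
  show ?thesis
  proof (intro bounded_measurableI[where C="C * D"])
    fix x assume "x \<in> space M"
    then show "norm (f x * g x) \<le> C * D"
      using CD[of x] by (auto simp: norm_mult intro!: mult_mono order_trans[OF norm_ge_zero])
  qed (use assms in \<open>auto simp: bounded_measurable_def\<close>)
qed

lemma bounded_measurable_diff [intro]:
  fixes f g :: "'a \<Rightarrow> 'b::{real_normed_field,banach,second_countable_topology}"
  assumes "bounded_measurable M f" "bounded_measurable M g"
  shows "bounded_measurable M (\<lambda>x. f x - g x)"
  using bounded_measurable_add[OF assms(1) bounded_measurable_mult[OF bounded_measurable_const[of M "-1"] assms(2)]]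
  by simp

lemma bounded_measurable_power [intro]:
  fixes f :: "'a \<Rightarrow> 'b::{real_normed_field,banach,second_countable_topology}"
  assumes "bounded_measurable M f"
  shows "bounded_measurable M (\<lambda>x. f x ^ k)"
  by (induction k) (use assms in auto)

lemma bounded_measurable_divide [intro]:
  fixes f :: "'a \<Rightarrow> 'b::{real_normed_field,banach,second_countable_topology}"
  assumes "bounded_measurable M f"
  shows "bounded_measurable M (\<lambda>x. f x / c)"
  using bounded_measurable_mult[OF assms bounded_measurable_const[of M "1/c"]] by simp

lemma bounded_measurable_of_real [intro]:
  fixes f :: "'a \<Rightarrow> real"
  assumes "bounded_measurable M f"
  shows "bounded_measurable M (\<lambda>x. complex_of_real (f x))"
  using assms by (auto simp: bounded_measurable_def)

lemma bounded_measurable_sum [intro]: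
  "(\<And>i. i \<in> A \<Longrightarrow> bounded_measurable M (f i)) \<Longrightarrow> bounded_measurable M (\<lambda>x. \<Sum>i\<in>A. f i x)"
  by (induction A rule: infinite_finite_induct) auto

lemma bounded_measurable_prod [intro]:
  fixes f :: "'i \<Rightarrow> 'a \<Rightarrow> 'b::{real_normed_field,banach,second_countable_topology}"
  shows "(\<And>i. i \<in> A \<Longrightarrow> bounded_measurable M (f i)) \<Longrightarrow> bounded_measurable M (\<lambda>x. \<Prod>i\<in>A. f i x)"
  by (induction A rule: infinite_finite_induct) auto

lemma bounded_measurable_iexp [intro]:
  assumes [measurable]: "f \<in> borel_measurable M"
  shows "bounded_measurable M (\<lambda>x. iexp (f x))"
  by (intro bounded_measurableI[where C=1]) auto

lemma bounded_measurable_abs [intro]: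
  "bounded_measurable M f \<Longrightarrow> bounded_measurable M (\<lambda>x. \<bar>f x :: real\<bar>)"
  by (auto simp: bounded_measurable_def)

lemma bounded_measurable_norm [intro]:
  "bounded_measurable M f \<Longrightarrow> bounded_measurable M (\<lambda>x. norm (f x))"
  by (auto simp: bounded_measurable_def)

lemmas bounded_measurable_intros =
  bounded_measurable_const bounded_measurable_add bounded_measurable_mult bounded_measurable_diff
  bounded_measurable_power bounded_measurable_divide bounded_measurable_of_real
  bounded_measurable_sum bounded_measurable_prod bounded_measurable_abs bounded_measurable_norm

text \<open>Tilts, phases and kernels are bounded on a probability space, so integrability of their
  products reduces to the closure rules above. The bound is asked on \<open>space M\<close> only,
  because \<open>kappa\<close> is unbounded off the unit square.\<close>

lemma (in finite_measure) integrable_bounded_measurable: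
  "bounded_measurable M f \<Longrightarrow> integrable M f"
  by (auto simp: bounded_measurable_def intro!: integrable_const_bound)

section \<open>Resampling one coordinate of a product law\<close>

lemma distr_PiM_resample:
  assumes M: "prob_space M" and I: "finite I" "j \<in> I"
  shows "distr (PiM I (\<lambda>_. M) \<Otimes>\<^sub>M M) (PiM I (\<lambda>_. M)) (\<lambda>(w, y). w(j := y)) = PiM I (\<lambda>_. M)"
proof -
  interpret M: prob_space M by fact
  interpret product_prob_space "\<lambda>_. M" I by standard
  interpret P: prob_space "PiM I (\<lambda>_. M)" by (intro prob_space_PiM M)
  have [measurable]: "(\<lambda>(w, y). w(j := y)) \<in> PiM I (\<lambda>_. M) \<Otimes>\<^sub>M M \<rightarrow>\<^sub>M PiM I (\<lambda>_. M)"
    using measurable_add_dim[of j I "\<lambda>_. M"] I by (simp add: insert_absorb)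
  show ?thesis
  proof (rule PiM_eqI[OF I(1)])
    fix A assume A: "\<And>i. i \<in> I \<Longrightarrow> A i \<in> sets M"
    have box: "Pi\<^sub>E I A \<in> sets (PiM I (\<lambda>_. M))"
      using A I by (intro sets_PiM_I_finite) auto
    let ?A = "A(j := space M)"
    \<comment> \<open>The old value of coordinate \<open>j\<close> is forgotten, so its constraint
      becomes \<open>space M\<close>, and the condition \<open>A j\<close> moves to the fresh
      coordinate.\<close>
    have *: "(\<lambda>(w, y). w(j := y)) -` Pi\<^sub>E I A \<inter> space (PiM I (\<lambda>_. M) \<Otimes>\<^sub>M M) = Pi\<^sub>E I ?A \<times> A j"
      using A[THEN sets.sets_into_space] I
      by (auto simp: space_pair_measure space_PiM PiE_iff extensional_def split: if_splits; blast)
    have "emeasure (distr (PiM I (\<lambda>_. M) \<Otimes>\<^sub>M M) (PiM I (\<lambda>_. M)) (\<lambda>(w, y). w(j := y))) (Pi\<^sub>E I A)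
        = emeasure (PiM I (\<lambda>_. M)) (Pi\<^sub>E I ?A) * emeasure M (A j)"
      using box A I by (subst emeasure_distr) (auto simp: * intro!: M.emeasure_pair_measure_Times sets_PiM_I_finite)
    also have "emeasure (PiM I (\<lambda>_. M)) (Pi\<^sub>E I ?A) = (\<Prod>i\<in>I. emeasure M (?A i))"
      using A I by (subst emeasure_PiM) auto
    also have "\<dots> = (\<Prod>i\<in>I - {j}. emeasure M (A i))"
      using I by (subst prod.remove[of _ j]) (auto simp: M.emeasure_space_1 intro!: prod.cong)
    also have "\<dots> * emeasure M (A j) = (\<Prod>i\<in>I. emeasure M (A i))"
      using I by (subst (2) prod.remove[of _ j]) (auto simp: mult.commute)
    finally show "emeasure (distr (PiM I (\<lambda>_. M) \<Otimes>\<^sub>M M) (PiM I (\<lambda>_. M)) (\<lambda>(w, y). w(j := y))) (Pi\<^sub>E I A)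
        = (\<Prod>i\<in>I. emeasure M (A i))" .
  qed auto
qed

text \<open>Fubini for one coordinate, kept as a function of the whole vector. Integrating out
  \<open>w j\<close> with the others frozen plays the role of conditioning, and it can be repeated
  with other coordinates without splitting the index set.\<close>

lemma integral_PiM_resample:
  fixes f :: "('i \<Rightarrow> 'a) \<Rightarrow> 'b::{banach,second_countable_topology}"
  assumes M: "prob_space M" and I: "finite I" "j \<in> I" and f: "integrable (PiM I (\<lambda>_. M)) f"
  shows "(\<integral>w. f w \<partial>PiM I (\<lambda>_. M)) = (\<integral>w. (\<integral>y. f (w(j := y)) \<partial>M) \<partial>PiM I (\<lambda>_. M))"
proof -
  interpret M: prob_space M by fact
  interpret P: prob_space "PiM I (\<lambda>_. M)" by (intro prob_space_PiM M)
  interpret pair_sigma_finite "PiM I (\<lambda>_. M)" M ..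
  have m [measurable]: "(\<lambda>(w, y). w(j := y)) \<in> PiM I (\<lambda>_. M) \<Otimes>\<^sub>M M \<rightarrow>\<^sub>M PiM I (\<lambda>_. M)"
    using measurable_add_dim[of j I "\<lambda>_. M"] I by (simp add: insert_absorb)
  note [measurable] = borel_measurable_integrable[OF f]
  have *: "integrable (PiM I (\<lambda>_. M) \<Otimes>\<^sub>M M) (\<lambda>(w, y). f (w(j := y)))"
  proof -
    have "integrable (distr (PiM I (\<lambda>_. M) \<Otimes>\<^sub>M M) (PiM I (\<lambda>_. M)) (\<lambda>(w, y). w(j := y))) f"
      using f by (simp only: distr_PiM_resample[OF M I])
    from integrable_distr[OF m this] show ?thesis by (simp add: case_prod_unfold)
  qed
  have "(\<integral>w. f w \<partial>PiM I (\<lambda>_. M)) = (\<integral>z. f ((\<lambda>(w, y). w(j := y)) z) \<partial>(PiM I (\<lambda>_. M) \<Otimes>\<^sub>M M))"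
    by (subst (1) distr_PiM_resample[OF M I, symmetric], subst integral_distr) auto
  also have "\<dots> = (\<integral>w. (\<integral>y. f (w(j := y)) \<partial>M) \<partial>PiM I (\<lambda>_. M))"
    using integral_fst'[OF *[unfolded case_prod_unfold]] by (simp add: case_prod_unfold)
  finally show ?thesis .
qed

section \<open>The uniform law on the open unit interval and its samples\<close>

definition unif01 :: "real measure" where
  "unif01 = restrict_space lborel {0<..<1}"

definition unif_sample :: "nat \<Rightarrow> (nat \<Rightarrow> real) measure" where
  "unif_sample n = PiM {..<n} (\<lambda>_. unif01)"

lemma space_unif01 [simp]: "space unif01 = {0<..<1}"
  by (simp add: unif01_def space_restrict_space)

lemma prob_space_unif01: "prob_space unif01"
  unfolding unif01_def
  by (auto simp: space_restrict_space emeasure_restrict_space intro!: prob_spaceI)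

interpretation unif01: prob_space unif01
  by (rule prob_space_unif01)

lemma prob_unif01 [simp]: "measure unif01 {0<..<1} = 1"
  using unif01.prob_space by simp

lemma prob_space_unif_sample: "prob_space (unif_sample n)"
  unfolding unif_sample_def by (intro prob_space_PiM prob_space_unif01)

interpretation unif_sample: prob_space "unif_sample n" for n
  by (rule prob_space_unif_sample)

lemma borel_measurable_unif01: "f \<in> borel_measurable borel \<Longrightarrow> f \<in> borel_measurable unif01"
  by (simp add: unif01_def measurable_restrict_space1)

lemma borel_measurable_unif01_id [measurable]: "(\<lambda>x. x) \<in> borel_measurable unif01"
  by (rule borel_measurable_unif01) simp

lemma borel_measurable_unif01D: "f \<in> M \<rightarrow>\<^sub>M unif01 \<Longrightarrow> f \<in> borel_measurable M"
  using measurable_compose[OF _ borel_measurable_unif01_id] by auto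

lemma measurable_unif_sample_coord [measurable]:
  "i < n \<Longrightarrow> (\<lambda>w. w i) \<in> unif_sample n \<rightarrow>\<^sub>M unif01"
  unfolding unif_sample_def by (rule measurable_component_singleton) auto

lemma borel_measurable_unif_sample_coord [measurable]:
  "i < n \<Longrightarrow> (\<lambda>w. w i) \<in> borel_measurable (unif_sample n)"
  by (rule borel_measurable_unif01D[OF measurable_unif_sample_coord])

lemma space_unif_sampleD: "w \<in> space (unif_sample n) \<Longrightarrow> i < n \<Longrightarrow> 0 < w i \<and> w i < 1"
  by (auto simp: unif_sample_def space_PiM PiE_iff)

lemma unif_sample_resample:
  fixes f :: "(nat \<Rightarrow> real) \<Rightarrow> 'b::{banach,second_countable_topology}"
  assumes "j < n" "bounded_measurable (unif_sample n) f"
  shows "(\<integral>w. f w \<partial>unif_sample n) = (\<integral>w. (\<integral>y. f (w(j := y)) \<partial>unif01) \<partial>unif_sample n)"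
  using assms unif_sample.integrable_bounded_measurable[OF assms(2)] unfolding unif_sample_def
  by (intro integral_PiM_resample prob_space_unif01) auto

text \<open>The explicit integrals come from the fundamental theorem of calculus on the closed
  interval; the endpoints form a null set.\<close>

lemma unif01_integral_eq:
  assumes "(f has_integral I) {0..1}" "bounded_measurable unif01 f"
  shows "(\<integral>x. f x \<partial>unif01) = (I::real)"
proof -
  have "integrable (restrict_space lborel {0<..<1}) f"
    using unif01.integrable_bounded_measurable[OF assms(2)] by (simp add: unif01_def)
  then have s: "set_integrable lborel {0<..<1} f"
    by (simp add: integrable_restrict_space set_integrable_def)
  have "(\<integral>x. f x \<partial>unif01) = (LINT x:{0<..<1}|lborel. f x)"
    by (simp add: unif01_def integral_restrict_space set_lebesgue_integral_def)
  also have "\<dots> = integral {0<..<1} f"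
    using s by (rule set_borel_integral_eq_integral)
  also have "\<dots> = integral {0..1} f"
    by (rule integral_open_interval_real[symmetric])
  also have "\<dots> = I"
    using assms(1) by (rule integral_unique)
  finally show ?thesis .
qed

section \<open>The degenerate kernel and its variance\<close>

text \<open>Up to the factor \<open>- 3 / sqrt n\<close>, this is the Hajek projection kernel of Chatterjee's
  statistic. The parabolas make it degenerate: integrating out either argument gives 0.\<close>

definition kappa :: "real \<Rightarrow> real \<Rightarrow> real" where
  "kappa u v = \<bar>u - v\<bar> + u * (1 - u) + v * (1 - v) - 2 / 3"

lemma kappa_commute: "kappa u v = kappa v u"
  by (simp add: kappa_def abs_minus_commute)

lemma measurable_kappa [measurable (raw)]:
  assumes [measurable]: "f \<in> borel_measurable M" "g \<in> borel_measurable M"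
  shows "(\<lambda>x. kappa (f x) (g x)) \<in> borel_measurable M"
  unfolding kappa_def by measurable

lemma unit_parabola_bounds:
  assumes "0 < u" "u < (1::real)"
  shows "0 \<le> u * (1 - u)" "u * (1 - u) \<le> 1 / 4"
  using assms zero_le_power2[of "u - 1/2"] by (auto simp: power2_eq_square algebra_simps)

lemma abs_kappa_le_1:
  assumes "0 < u" "u < 1" "0 < v" "v < 1"
  shows "\<bar>kappa u v\<bar> \<le> 1"
proof -
  have "\<bar>u - v\<bar> \<le> 1" using assms by linarith
  then show ?thesis
    using unit_parabola_bounds[OF assms(1,2)] unit_parabola_bounds[OF assms(3,4)]
    unfolding kappa_def by linarith
qed

lemma has_integral_abs_diff:
  assumes "0 \<le> u" "u \<le> (1::real)"
  shows "((\<lambda>v. \<bar>u - v\<bar>) has_integral (1 / 2 - u + u\<^sup>2)) {0..1}"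
proof -
  have 1: "((\<lambda>v. \<bar>u - v\<bar>) has_integral ((u * u - u\<^sup>2 / 2) - (u * 0 - 0\<^sup>2 / 2))) {0..u}"
    by (rule fundamental_theorem_of_calculus[OF assms(1)])
      (auto intro!: derivative_eq_intros simp: has_real_derivative_iff_has_vector_derivative[symmetric])
  have 2: "((\<lambda>v. \<bar>u - v\<bar>) has_integral ((1\<^sup>2 / 2 - u * 1) - (u\<^sup>2 / 2 - u * u))) {u..1}"
    by (rule fundamental_theorem_of_calculus[OF assms(2)])
      (auto intro!: derivative_eq_intros simp: has_real_derivative_iff_has_vector_derivative[symmetric])
  show ?thesis
    using has_integral_combine[OF assms 1 2] by (simp add: power2_eq_square algebra_simps)
qed

lemma has_integral_parabola: "((\<lambda>v::real. v * (1 - v)) has_integral (1 / 6)) {0..1}"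
proof -
  have "((\<lambda>v::real. v * (1 - v)) has_integral ((1\<^sup>2 / 2 - 1 ^ 3 / 3) - (0\<^sup>2 / 2 - 0 ^ 3 / 3))) {0..1}"
    by (rule fundamental_theorem_of_calculus)
      (auto intro!: derivative_eq_intros
        simp: has_real_derivative_iff_has_vector_derivative[symmetric] power2_eq_square algebra_simps)
  then show ?thesis by simp
qed

lemma bounded_measurable_kappa [intro]:
  assumes "f \<in> borel_measurable M" "g \<in> borel_measurable M"
    "\<And>x. x \<in> space M \<Longrightarrow> f x \<in> {0<..<1}" "\<And>x. x \<in> space M \<Longrightarrow> g x \<in> {0<..<1}"
  shows "bounded_measurable M (\<lambda>x. kappa (f x) (g x))"
  using assms by (intro bounded_measurableI[where C=1]) (auto intro!: abs_kappa_le_1)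

text \<open>Averaging |u - v| over v gives 1/2 - u(1 - u). The parabola in u cancels the variable
  part, the parabola in v has mean 1/6, and 1/2 + 1/6 is the constant 2/3 in
  \<open>kappa\<close>.\<close>

lemma integral_kappa:
  assumes u: "0 < u" "u < 1"
  shows "(\<integral>v. kappa u v \<partial>unif01) = 0"
proof (rule unif01_integral_eq)
  have "((\<lambda>v. \<bar>u - v\<bar> + v * (1 - v) + (u * (1 - u) - 2 / 3)) has_integral
      ((1 / 2 - u + u\<^sup>2) + 1 / 6 + (u * (1 - u) - 2 / 3))) {0..1}"
    using u has_integral_const_real[of "u * (1 - u) - 2 / 3" 0 1]
    by (intro has_integral_add has_integral_abs_diff has_integral_parabola) auto
  then show "(kappa u has_integral 0) {0..1}"
    by (simp add: kappa_def[abs_def] algebra_simps power2_eq_square)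
qed (use u in auto)

text \<open>The variance of the kernel at two independent uniforms. Its value is 2/45, so the limit
  law of the statistic has variance 9 tau = 2/5.\<close>

definition tau :: real where
  "tau = (\<integral>u. (\<integral>v. (kappa u v)\<^sup>2 \<partial>unif01) \<partial>unif01)"

lemma integral_kappa_sq_bounds:
  assumes "0 < u" "u < 1"
  shows "0 \<le> (\<integral>v. (kappa u v)\<^sup>2 \<partial>unif01)" "(\<integral>v. (kappa u v)\<^sup>2 \<partial>unif01) \<le> 1"
proof -
  show "0 \<le> (\<integral>v. (kappa u v)\<^sup>2 \<partial>unif01)" by simp
  have "(\<integral>v. (kappa u v)\<^sup>2 \<partial>unif01) \<le> (\<integral>v. 1 \<partial>unif01)"
    using assms abs_kappa_le_1
    by (intro integral_mono unif01.integrable_bounded_measurable bounded_measurable_power)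
      (auto simp: abs_square_le_1)
  then show "(\<integral>v. (kappa u v)\<^sup>2 \<partial>unif01) \<le> 1" by simp
qed

lemma bounded_measurable_integral_kappa_sq:
  "bounded_measurable unif01 (\<lambda>u. \<integral>v. (kappa u v)\<^sup>2 \<partial>unif01)"
proof (rule bounded_measurableI[where C=1])
  have [measurable]: "fst \<in> borel_measurable (unif01 \<Otimes>\<^sub>M unif01)" "snd \<in> borel_measurable (unif01 \<Otimes>\<^sub>M unif01)"
    by (auto intro!: borel_measurable_unif01D)
  show "(\<lambda>u. \<integral>v. (kappa u v)\<^sup>2 \<partial>unif01) \<in> borel_measurable unif01"
    by measurable
qed (use integral_kappa_sq_bounds in auto)

text \<open>Positivity makes the division by \<open>sqrt tau\<close> legitimate. It comes from the
  corner (0, 1/10)^2: there \<open>kappa\<close> is at most 3/10 - 2/3 < -1/10, so its square is at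
  least 1/100 on a set of probability 1/100.\<close>

lemma tau_bounds: "0 < tau" "tau \<le> 1"
proof -
  have "tau \<le> (\<integral>v. 1 \<partial>unif01)"
    unfolding tau_def
    by (intro integral_mono unif01.integrable_bounded_measurable bounded_measurable_integral_kappa_sq)
      (auto simp: integral_kappa_sq_bounds)
  then show "tau \<le> 1" by simp
  let ?I = "indicator {0<..<1/10} :: real \<Rightarrow> real"
  have I: "bounded_measurable unif01 ?I"
    by (rule bounded_measurableI[where C=1]) (auto simp: indicator_def)
  have "(\<integral>v. ?I v \<partial>unif01) = (\<integral>v. indicator {0<..<1/10::real} v \<partial>lborel)"
  proof -
    have *: "(\<lambda>v. indicator {0<..<1} v *\<^sub>R ?I v) = ?I"
      by (auto simp: fun_eq_iff split: split_indicator)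
    show ?thesis
      unfolding unif01_def by (subst integral_restrict_space) (auto simp: * simp del: real_scaleR_def)
  qed
  then have prob_I: "measure unif01 {0<..<1/10} = 1 / 10" by simp
  have small: "?I u * ?I v / 100 \<le> (kappa u v)\<^sup>2" if "0 < u" "0 < v" for u v
  proof (cases "u < 1/10 \<and> v < 1/10")
    case True
    have "u * (1 - u) \<le> 1/10" "v * (1 - v) \<le> 1/10" "\<bar>u - v\<bar> \<le> 1/10"
      using True that mult_left_le[of "1 - u" u] mult_left_le[of "1 - v" v] by linarith+
    then have "kappa u v \<le> - (1 / 10)"
      unfolding kappa_def by linarith
    then have "(1/10)\<^sup>2 \<le> (- kappa u v)\<^sup>2"
      by (intro power_mono) auto
    then show ?thesis by (auto simp: indicator_def power2_eq_square)
  qed (auto simp: indicator_def)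
  have inner: "?I u / 1000 \<le> (\<integral>v. (kappa u v)\<^sup>2 \<partial>unif01)" if "0 < u" "u < 1" for u
  proof -
    have "(\<integral>v. ?I u * ?I v / 100 \<partial>unif01) \<le> (\<integral>v. (kappa u v)\<^sup>2 \<partial>unif01)"
      using that small I
      by (intro integral_mono unif01.integrable_bounded_measurable bounded_measurable_power
          bounded_measurable_divide bounded_measurable_mult) auto
    then show ?thesis by (simp add: prob_I)
  qed
  have "(\<integral>u. ?I u / 1000 \<partial>unif01) \<le> tau"
    unfolding tau_def using inner I
    by (intro integral_mono unif01.integrable_bounded_measurable bounded_measurable_integral_kappa_sq) auto
  then have "1 / 10000 \<le> tau" using prob_I by simp
  then show "0 < tau" by linarith
qed

section \<open>A central limit theorem under tilting\<close>

lemma iexp_approx_quadratic: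
  "cmod (iexp x - 1 - \<i> * x + x\<^sup>2 / 2) \<le> \<bar>x\<bar> ^ 3 / 6"
  "cmod (iexp x - 1 - \<i> * x) \<le> \<bar>x\<bar>\<^sup>2 / 2"
  "cmod (iexp x - 1) \<le> \<bar>x\<bar>"
  using iexp_approx1[of x 2] iexp_approx1[of x 1] iexp_approx1[of x 0]
  by (auto simp: eval_nat_numeral algebra_simps)

text \<open>\<beta> j is the excess density at position \<open>j\<close>, and \<open>s\<close> will
  be -3 / sqrt n times a fixed argument of the characteristic function. A single \<eta>, of order
  n^(-1/2), bounds both, so every remainder becomes a power of \<eta>.\<close>

locale tilted_array =
  fixes n :: nat and \<beta> :: "nat \<Rightarrow> real \<Rightarrow> real" and s \<eta> :: real
  assumes measurable_beta [measurable]: "\<And>j. \<beta> j \<in> borel_measurable unif01"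
    and abs_beta_le: "\<And>j u. 0 < u \<Longrightarrow> u < 1 \<Longrightarrow> \<bar>\<beta> j u\<bar> \<le> \<eta>"
    and integral_beta: "\<And>j. (\<integral>u. \<beta> j u \<partial>unif01) = 0"
    and abs_s_le: "\<bar>s\<bar> \<le> \<eta>"
    and eta_le_1: "\<eta> \<le> 1"
begin

lemma eta_nonneg: "0 \<le> \<eta>"
  using abs_s_le by linarith

text \<open>The likelihood of coordinate \<open>j\<close> times the phase of the pair ending at
  \<open>j\<close>. Coordinate 0 ends no pair, so a product of n factors carries only n - 1
  phases.\<close>

fun factor :: "nat \<Rightarrow> (nat \<Rightarrow> real) \<Rightarrow> complex" where
  "factor 0 w = 1 + \<beta> 0 (w 0)"
| "factor (Suc j) w = (1 + \<beta> (Suc j) (w (Suc j))) * iexp (s * kappa (w j) (w (Suc j)))"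

text \<open>All values of \<open>m\<close> are integrated over the same \<open>n\<close>
  coordinates, which makes consecutive values directly comparable. At \<open>m = n\<close> this is
  the characteristic function at \<open>s\<close> of the kernel sum under the tilted law.\<close>

definition partial_charfun :: "nat \<Rightarrow> complex" where
  "partial_charfun m = (\<integral>w. (\<Prod>j<m. factor j w) \<partial>unif_sample n)"

lemma bounded_measurable_beta: "j < n \<Longrightarrow> bounded_measurable (unif_sample n) (\<lambda>w. \<beta> j (w j))"
  by (rule bounded_measurableI[where C=\<eta>])
    (auto intro!: measurable_compose[OF measurable_unif_sample_coord measurable_beta]
      abs_beta_le dest: space_unif_sampleD)

lemma bounded_measurable_beta1: "bounded_measurable unif01 (\<beta> j)"
  by (rule bounded_measurableI[where C=\<eta>]) (auto intro: abs_beta_le)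

lemma bounded_measurable_kappa_coord:
  "i < n \<Longrightarrow> j < n \<Longrightarrow> bounded_measurable (unif_sample n) (\<lambda>w. kappa (w i) (w j))"
  by (rule bounded_measurable_kappa) (auto dest: space_unif_sampleD)

lemma bounded_measurable_factor:
  assumes "j < n"
  shows "bounded_measurable (unif_sample n) (factor j)"
proof (cases j)
  case 0
  have "bounded_measurable (unif_sample n) (\<lambda>w. 1 + complex_of_real (\<beta> 0 (w 0)))"
    using assms 0 by (intro bounded_measurable_add bounded_measurable_const
      bounded_measurable_of_real bounded_measurable_beta) auto
  moreover have "factor 0 = (\<lambda>w. 1 + complex_of_real (\<beta> 0 (w 0)))"
    by auto
  ultimately show ?thesis
    using 0 by simp
next
  case (Suc i)
  have "bounded_measurable (unif_sample n)
     (\<lambda>w. of_real (1 + \<beta> (Suc i) (w (Suc i))) * iexp (s * kappa (w i) (w (Suc i))))"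
    using assms Suc by (intro bounded_measurable_mult bounded_measurable_of_real
      bounded_measurable_add bounded_measurable_beta bounded_measurable_iexp
      bounded_measurable_const borel_measurable_times bounded_measurableD[OF bounded_measurable_kappa_coord]) auto
  moreover have "factor (Suc i) =
      (\<lambda>w. of_real (1 + \<beta> (Suc i) (w (Suc i))) * iexp (s * kappa (w i) (w (Suc i))))"
    by auto
  ultimately show ?thesis
    using Suc by simp
qed

lemma factor_upd: "j < i \<Longrightarrow> factor j (w(i := y)) = factor j w"
  by (cases j) auto

lemma prod_factor_upd: "m \<le> i \<Longrightarrow> (\<Prod>j<m. factor j (w(i := y))) = (\<Prod>j<m. factor j w)"
  by (intro prod.cong) (auto simp: factor_upd)

lemma one_plus_beta_nonneg: "w \<in> space (unif_sample n) \<Longrightarrow> j < n \<Longrightarrow> 0 \<le> 1 + \<beta> j (w j)"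
  using abs_beta_le[of "w j" j] space_unif_sampleD[of w n j] eta_le_1 by linarith

lemma norm_factor:
  assumes "w \<in> space (unif_sample n)" "j < n"
  shows "cmod (factor j w) = 1 + \<beta> j (w j)"
proof -
  have "cmod (1 + complex_of_real (\<beta> j (w j))) = 1 + \<beta> j (w j)"
    using one_plus_beta_nonneg[OF assms] by (metis norm_of_real of_real_1 of_real_add abs_of_nonneg)
  then show ?thesis by (cases j) (auto simp: norm_mult)
qed

text \<open>The tilt contributes \<eta>, the phase at most \<eta> times 1 + \<beta> \<le> 2. This is
  the price of dropping one factor from a product.\<close>

lemma norm_factor_minus_1:
  assumes w: "w \<in> space (unif_sample n)" and j: "j < n"
  shows "cmod (factor j w - 1) \<le> 3 * \<eta>"
proof -
  have b: "\<bar>\<beta> j (w j)\<bar> \<le> \<eta>"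
    using abs_beta_le space_unif_sampleD[OF w] j by auto
  show ?thesis
  proof (cases j)
    case 0
    then show ?thesis using b eta_nonneg by simp
  next
    case (Suc i)
    let ?x = "s * kappa (w i) (w (Suc i))"
    have "\<bar>?x\<bar> \<le> \<eta> * 1"
      unfolding abs_mult using abs_s_le j Suc space_unif_sampleD[OF w]
      by (intro mult_mono abs_kappa_le_1) auto
    then have x: "cmod (iexp ?x - 1) \<le> \<eta>"
      using iexp_approx_quadratic(3)[of ?x] by linarith
    have "factor j w - 1 = of_real (\<beta> j (w j)) + of_real (1 + \<beta> j (w j)) * (iexp ?x - 1)"
      using Suc by (simp add: algebra_simps)
    also have "cmod \<dots> \<le> \<eta> + 2 * \<eta>"
      using b x eta_le_1 eta_nonneg one_plus_beta_nonneg[OF w j]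
      by (intro norm_triangle_mono, simp, unfold norm_mult norm_of_real, intro mult_mono) auto
    finally show ?thesis by simp
  qed
qed

text \<open>Phases have modulus 1, so the modulus is the likelihood of the first \<open>m\<close>
  coordinates, a probability density. Errors multiplied by such a product can thus be estimated by
  their supremum, without growth in \<open>m\<close>.\<close>

lemma integral_norm_prod_factor:
  assumes "m \<le> n"
  shows "(\<integral>w. cmod (\<Prod>j<m. factor j w) \<partial>unif_sample n) = 1"
proof -
  interpret product_sigma_finite "\<lambda>_::nat. unif01" by standard
  note bm = bounded_measurable_beta1
  let ?g = "\<lambda>j u. if j < m then 1 + \<beta> j u else 1"
  have g: "integrable unif01 (?g j)" for j
    using bounded_measurable_add[OF bounded_measurable_const[of unif01 1] bm[of j]]
    by (cases "j < m") (simp_all add: unif01.integrable_bounded_measurable)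
  have "(\<integral>w. cmod (\<Prod>j<m. factor j w) \<partial>unif_sample n) = (\<integral>w. (\<Prod>j<n. ?g j (w j)) \<partial>unif_sample n)"
  proof (intro Bochner_Integration.integral_cong refl)
    fix w assume w: "w \<in> space (unif_sample n)"
    have "(\<Prod>j<n. ?g j (w j)) = (\<Prod>j<m. 1 + \<beta> j (w j))"
      using assms by (intro prod.mono_neutral_cong_right) auto
    then show "cmod (\<Prod>j<m. factor j w) = (\<Prod>j<n. ?g j (w j))"
      using assms by (auto simp: prod_norm[symmetric] norm_factor[OF w] intro!: prod.cong)
  qed
  also have "\<dots> = (\<Prod>j<n. \<integral>u. ?g j u \<partial>unif01)"
    unfolding unif_sample_def by (intro product_integral_prod g) auto
  also have "\<dots> = 1"
  proof (intro prod.neutral ballI)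
    fix j
    show "(\<integral>u. ?g j u \<partial>unif01) = 1"
      using bm integral_beta by (cases "j < m") (simp_all add: unif01.integrable_bounded_measurable)
  qed
  finally show ?thesis .
qed

text \<open>Given the past, the first order terms of the last factor integrate to 0; the second order
  terms involve only the last two coordinates, hence decouple from the factors before them once the
  next to last factor is replaced by 1, at a cost of order \<open>\<eta> ^ 3\<close>.\<close>

lemma partial_charfun_step:
  assumes m: "Suc (Suc m) \<le> n"
  shows "cmod (partial_charfun (Suc (Suc m)) - partial_charfun (Suc m) * (1 - s\<^sup>2 * tau / 2)) \<le> 9 * \<eta> ^ 3"
proof -
  let ?U = "unif_sample n"
  define F where "F w = (\<Prod>j<m. factor j w)" for w
  define A where "A = factor m"
  define b where "b w = \<beta> (Suc m) (w (Suc m))" for w :: "nat \<Rightarrow> real"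
  define k where "k w = kappa (w m) (w (Suc m))" for w :: "nat \<Rightarrow> real"
  \<comment> \<open>The last factor is written as 1 + b + i s k + \<open>B2\<close> +
    \<open>B3\<close>: \<open>B2\<close> collects the second order terms, and \<open>B3\<close> is a
    remainder of third order.\<close>
  define B2 where "B2 w = \<i> * s * (k w * b w) - s\<^sup>2 * (k w)\<^sup>2 / 2" for w
  define B3 where "B3 w = (1 + b w) * iexp (s * k w) - 1 - b w - \<i> * s * k w - B2 w" for w
  have F: "bounded_measurable ?U F"
    unfolding F_def using m by (intro bounded_measurable_prod bounded_measurable_factor) auto
  have A: "bounded_measurable ?U A"
    unfolding A_def using m by (intro bounded_measurable_factor) auto
  have b: "bounded_measurable ?U b"
    unfolding b_def using m by (intro bounded_measurable_beta) auto
  have k: "bounded_measurable ?U k"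
    unfolding k_def using m by (intro bounded_measurable_kappa_coord) auto
  have B2: "bounded_measurable ?U B2"
    unfolding B2_def using b k by (intro bounded_measurable_diff bounded_measurable_mult
      bounded_measurable_divide bounded_measurable_of_real bounded_measurable_power bounded_measurable_const) auto
  have fac: "factor (Suc m) w = (1 + b w) * iexp (s * k w)" for w
    by (simp add: b_def k_def)
  have "bounded_measurable ?U (factor (Suc m))"
    using m by (intro bounded_measurable_factor) auto
  then have B3: "bounded_measurable ?U B3"
    unfolding B3_def fac[symmetric] using b k by (intro bounded_measurable_diff bounded_measurable_mult
      bounded_measurable_of_real bounded_measurable_const B2)
  note bmi = F A b k B2 B3 bounded_measurable_intros
  note int = unif_sample.integrable_bounded_measurable
  have upd: "F (w(i := y)) = F w" if "m \<le> i" for w i y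
    using that by (simp add: F_def prod_factor_upd)
  have updA: "A (w(Suc m := y)) = A w" for w y
    by (simp add: A_def factor_upd)
  have E1: "(\<integral>w. F w * A w * complex_of_real (b w) \<partial>?U) = 0"
    using m by (subst unif_sample_resample[of "Suc m"], simp, intro bmi)
      (simp add: upd updA b_def[of "_(_ := _)"] integral_beta)
  have E2: "(\<integral>w. F w * A w * complex_of_real (k w) \<partial>?U) = 0"
  proof -
    have "(\<integral>w. F w * A w * complex_of_real (k w) \<partial>?U)
        = (\<integral>w. (\<integral>y. F w * A w * complex_of_real (kappa (w m) y) \<partial>unif01) \<partial>?U)"
      using m by (subst unif_sample_resample[of "Suc m"], simp, intro bmi)
        (simp add: upd updA k_def[of "_(_ := _)"])
    also have "\<dots> = (\<integral>w. 0 \<partial>?U)"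
      using m by (intro Bochner_Integration.integral_cong) (auto dest!: space_unif_sampleD[of _ _ m] simp: integral_kappa)
    finally show ?thesis by simp
  qed
  \<comment> \<open>Here coordinate \<open>m\<close> is integrated out instead of
    \<open>Suc m\<close>. This requires \<open>A\<close>, the only earlier factor containing
    \<open>w m\<close>, to be absent; then degeneracy of \<open>kappa\<close> in its first argument
    cancels the interaction of kernel and tilt.\<close>
  have E3: "(\<integral>w. F w * complex_of_real (k w * b w) \<partial>?U) = 0"
  proof -
    have "(\<integral>w. F w * complex_of_real (k w * b w) \<partial>?U)
        = (\<integral>w. (\<integral>y. F w * complex_of_real (kappa (w (Suc m)) y * b w) \<partial>unif01) \<partial>?U)"
      using m by (subst unif_sample_resample[of m], simp, intro bmi)
        (simp add: upd k_def[of "_(_ := _)"] b_def kappa_commute)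
    also have "\<dots> = (\<integral>w. 0 \<partial>?U)"
      using m by (intro Bochner_Integration.integral_cong refl)
        (auto dest!: space_unif_sampleD[of _ _ "Suc m"] simp: integral_kappa simp del: of_real_mult)
    finally show ?thesis by simp
  qed
  \<comment> \<open>Integrating out both coordinates decouples the squared kernel from the past and
    leaves \<open>tau\<close>.\<close>
  have E4: "(\<integral>w. F w * complex_of_real ((k w)\<^sup>2) \<partial>?U) = tau * partial_charfun m"
  proof -
    let ?v = "\<lambda>u. \<integral>y. (kappa u y)\<^sup>2 \<partial>unif01"
    have "(\<integral>w. F w * complex_of_real ((k w)\<^sup>2) \<partial>?U)
        = (\<integral>w. (\<integral>y. F w * complex_of_real ((kappa (w m) y)\<^sup>2) \<partial>unif01) \<partial>?U)"
      using m by (subst unif_sample_resample[of "Suc m"], simp, intro bmi)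
        (simp add: upd k_def[of "_(_ := _)"] del: of_real_power)
    also have "\<dots> = (\<integral>w. F w * complex_of_real (?v (w m)) \<partial>?U)"
      by (simp del: of_real_power)
    also have "\<dots> = (\<integral>w. (\<integral>y. F w * complex_of_real (?v y) \<partial>unif01) \<partial>?U)"
    proof (subst unif_sample_resample[of m])
      have "bounded_measurable ?U (\<lambda>w. ?v (w m))"
        using m bounded_measurable_integral_kappa_sq space_unif_sampleD integral_kappa_sq_bounds
        by (intro bounded_measurableI[where C=1])
          (auto intro!: measurable_compose[OF measurable_unif_sample_coord] dest: bounded_measurableD)
      then show "bounded_measurable ?U (\<lambda>w. F w * complex_of_real (?v (w m)))"
        by (intro bmi)
    qed (use m in \<open>auto simp: upd\<close>)
    also have "\<dots> = tau * partial_charfun m"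
      by (simp add: tau_def partial_charfun_def F_def)
    finally show ?thesis .
  qed
  have EB2: "(\<integral>w. F w * B2 w \<partial>?U) = - (s\<^sup>2 * tau / 2) * partial_charfun m"
  proof -
    have "(\<integral>w. F w * B2 w \<partial>?U) = (\<integral>w. \<i> * s * (F w * complex_of_real (k w * b w))
        - s\<^sup>2 / 2 * (F w * complex_of_real ((k w)\<^sup>2)) \<partial>?U)"
      by (intro Bochner_Integration.integral_cong) (auto simp: B2_def algebra_simps)
    also have "\<dots> = (\<integral>w. \<i> * s * (F w * complex_of_real (k w * b w)) \<partial>?U)
        - (\<integral>w. s\<^sup>2 / 2 * (F w * complex_of_real ((k w)\<^sup>2)) \<partial>?U)"
      by (intro Bochner_Integration.integral_diff int bmi)
    also have "\<dots> = - (s\<^sup>2 * tau / 2) * partial_charfun m"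
      using E3 E4 by simp
    finally show ?thesis .
  qed
  have bk: "\<bar>b w\<bar> \<le> \<eta>" "\<bar>k w\<bar> \<le> 1" if "w \<in> space ?U" for w
    using that m abs_kappa_le_1 abs_beta_le space_unif_sampleD[OF that] by (auto simp: b_def k_def)
  have sk: "\<bar>s * k w\<bar> \<le> \<eta>" if "w \<in> space ?U" for w
    using mult_mono[OF abs_s_le bk(2)[OF that]] eta_nonneg by (simp add: abs_mult)
  have nB2: "cmod (B2 w) \<le> 2 * \<eta>\<^sup>2" if w: "w \<in> space ?U" for w
  proof -
    have "B2 w = \<i> * complex_of_real ((s * k w) * b w) - complex_of_real ((s * k w)\<^sup>2 / 2)"
      by (simp add: B2_def power_mult_distrib)
    also have "cmod \<dots> \<le> \<bar>s * k w\<bar> * \<bar>b w\<bar> + \<bar>s * k w\<bar>\<^sup>2 / 2"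
      by (rule order_trans[OF norm_triangle_ineq4]) (auto simp: norm_mult norm_power abs_mult)
    also have "\<dots> \<le> \<eta> * \<eta> + \<eta>\<^sup>2 / 2"
      using sk[OF w] bk(1)[OF w] eta_nonneg by (intro add_mono mult_mono divide_right_mono power_mono) auto
    finally show ?thesis
      using zero_le_power2[of \<eta>] unfolding power2_eq_square by linarith
  qed
  have nB3: "cmod (B3 w) \<le> \<eta> ^ 3" if w: "w \<in> space ?U" for w
  proof -
    let ?x = "s * k w"
    have "B3 w = (iexp ?x - 1 - \<i> * ?x + ?x\<^sup>2 / 2) + b w * (iexp ?x - 1 - \<i> * ?x)"
      by (simp add: B3_def B2_def power_mult_distrib algebra_simps)
    also have "cmod \<dots> \<le> \<bar>?x\<bar> ^ 3 / 6 + \<bar>b w\<bar> * (\<bar>?x\<bar>\<^sup>2 / 2)"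
      unfolding norm_mult norm_of_real
      by (intro norm_triangle_mono iexp_approx_quadratic, unfold norm_mult norm_of_real,
          intro mult_left_mono iexp_approx_quadratic) auto
    also have "\<dots> \<le> \<eta> ^ 3 / 6 + \<eta> * (\<eta>\<^sup>2 / 2)"
      using sk[OF w] bk(1)[OF w] eta_nonneg by (intro add_mono mult_mono divide_right_mono power_mono) auto
    also have "\<dots> \<le> \<eta> ^ 3"
      using eta_nonneg by (simp add: eval_nat_numeral)
    finally show ?thesis .
  qed
  have nA: "cmod (A w - 1) \<le> 3 * \<eta>" if "w \<in> space ?U" for w
    using norm_factor_minus_1[OF that] m by (simp add: A_def)
  have bound: "cmod (\<integral>w. G w * H w \<partial>?U) \<le> c"
    if G: "bounded_measurable ?U G" "(\<integral>w. cmod (G w) \<partial>?U) = 1"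
      and H: "bounded_measurable ?U H" "\<And>w. w \<in> space ?U \<Longrightarrow> cmod (H w) \<le> c" for G H c
  proof -
    have "cmod (\<integral>w. G w * H w \<partial>?U) \<le> (\<integral>w. cmod (G w * H w) \<partial>?U)"
      by (rule integral_norm_bound)
    also have "\<dots> \<le> (\<integral>w. cmod (G w) * c \<partial>?U)"
      using G H by (intro integral_mono int bounded_measurable_norm bounded_measurable_mult bounded_measurable_const)
        (auto simp: norm_mult intro!: mult_left_mono)
    also have "\<dots> = c" using G by simp
    finally show ?thesis .
  qed
  have FA: "F w * A w = (\<Prod>j<Suc m. factor j w)" for w
    by (simp add: F_def A_def)
  have nFA: "(\<integral>w. cmod (F w * A w) \<partial>?U) = 1" and nF: "(\<integral>w. cmod (F w) \<partial>?U) = 1"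
    using m integral_norm_prod_factor[of "Suc m"] integral_norm_prod_factor[of m] by (simp_all add: F_def A_def)
  \<comment> \<open>The squared kernel produces \<open>partial_charfun m\<close>, one index behind
    the value in the claim. The shift costs a further factor \<eta> on top of s^2.\<close>
  have d1: "cmod (partial_charfun (Suc m) - partial_charfun m) \<le> 3 * \<eta>"
  proof -
    have "partial_charfun (Suc m) - partial_charfun m = (\<integral>w. F w * A w \<partial>?U) - (\<integral>w. F w \<partial>?U)"
      by (simp add: partial_charfun_def F_def A_def)
    also have "\<dots> = (\<integral>w. F w * (A w - 1) \<partial>?U)"
      by (subst Bochner_Integration.integral_diff[symmetric], (intro int bmi)+) (simp add: algebra_simps)
    also have "cmod \<dots> \<le> 3 * \<eta>"
      by (rule bound[OF F nF _ nA]) (intro bmi)+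
    finally show ?thesis .
  qed
  have alg: "x = p1 + 0 + c * 0 + of_real (- q) * p0 + i2 + i3 \<Longrightarrow>
      x - p1 * of_real (1 - q) = of_real q * (p1 - p0) + i2 + i3"
    for x p1 c p0 i2 i3 :: complex and q :: real
    by (simp add: algebra_simps)
  have "partial_charfun (Suc (Suc m)) = (\<integral>w. F w * A w * factor (Suc m) w \<partial>?U)"
    by (simp add: partial_charfun_def F_def A_def)
  also have "\<dots> = (\<integral>w. F w * A w + F w * A w * of_real (b w) + \<i> * s * (F w * A w * of_real (k w))
      + F w * B2 w + F w * ((A w - 1) * B2 w) + F w * A w * B3 w \<partial>?U)"
    unfolding fac by (intro Bochner_Integration.integral_cong) (auto simp: B3_def algebra_simps)
  also have "\<dots> = partial_charfun (Suc m) + 0 + \<i> * s * 0 + (\<integral>w. F w * B2 w \<partial>?U)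
     + (\<integral>w. F w * ((A w - 1) * B2 w) \<partial>?U) + (\<integral>w. F w * A w * B3 w \<partial>?U)"
  proof -
    have i: "integrable ?U (\<lambda>w. F w * A w)" "integrable ?U (\<lambda>w. F w * A w * of_real (b w))"
      "integrable ?U (\<lambda>w. \<i> * s * (F w * A w * of_real (k w)))" "integrable ?U (\<lambda>w. F w * B2 w)"
      "integrable ?U (\<lambda>w. F w * ((A w - 1) * B2 w))" "integrable ?U (\<lambda>w. F w * A w * B3 w)"
      by (intro int bmi)+
    show ?thesis
      unfolding Bochner_Integration.integral_add[OF i(1,2)]
        Bochner_Integration.integral_add[OF Bochner_Integration.integrable_add[OF i(1,2)] i(3)]
        Bochner_Integration.integral_add[OF Bochner_Integration.integrable_add[OF
          Bochner_Integration.integrable_add[OF i(1,2)] i(3)] i(4)]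
        Bochner_Integration.integral_add[OF Bochner_Integration.integrable_add[OF
          Bochner_Integration.integrable_add[OF Bochner_Integration.integrable_add[OF i(1,2)] i(3)] i(4)] i(5)]
        Bochner_Integration.integral_add[OF Bochner_Integration.integrable_add[OF Bochner_Integration.integrable_add[OF
          Bochner_Integration.integrable_add[OF Bochner_Integration.integrable_add[OF i(1,2)] i(3)] i(4)] i(5)] i(6)]
      using E1 E2 by (simp add: partial_charfun_def FA[symmetric] F_def A_def)
  qed
  finally have eq: "partial_charfun (Suc (Suc m)) - partial_charfun (Suc m) * (1 - s\<^sup>2 * tau / 2) =
     (s\<^sup>2 * tau / 2) * (partial_charfun (Suc m) - partial_charfun m)
     + (\<integral>w. F w * ((A w - 1) * B2 w) \<partial>?U) + (\<integral>w. F w * A w * B3 w \<partial>?U)"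
    unfolding EB2 by (rule alg)
  have n1: "cmod ((s\<^sup>2 * tau / 2) * (partial_charfun (Suc m) - partial_charfun m)) \<le> (\<eta>\<^sup>2 * 1 / 2) * (3 * \<eta>)"
  proof -
    have "s\<^sup>2 \<le> \<eta>\<^sup>2" using abs_s_le eta_nonneg by (simp add: abs_le_square_iff[symmetric])
    then have "s\<^sup>2 * tau / 2 \<le> \<eta>\<^sup>2 * 1 / 2"
      using tau_bounds by (intro divide_right_mono mult_mono) auto
    then have "\<bar>s\<^sup>2 * tau / 2\<bar> \<le> \<eta>\<^sup>2 * 1 / 2" using tau_bounds by simp
    then show ?thesis
      using d1 eta_nonneg unfolding norm_mult norm_of_real by (intro mult_mono) auto
  qed
  have n2: "cmod (\<integral>w. F w * ((A w - 1) * B2 w) \<partial>?U) \<le> (3 * \<eta>) * (2 * \<eta>\<^sup>2)"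
  proof (rule bound[OF F nF])
    show "bounded_measurable ?U (\<lambda>w. (A w - 1) * B2 w)" by (intro bmi)
    show "cmod ((A w - 1) * B2 w) \<le> 3 * \<eta> * (2 * \<eta>\<^sup>2)" if "w \<in> space ?U" for w
      unfolding norm_mult using nA[OF that] nB2[OF that] eta_nonneg by (intro mult_mono) auto
  qed
  have n3: "cmod (\<integral>w. F w * A w * B3 w \<partial>?U) \<le> \<eta> ^ 3"
    using nFA nB3 by (intro bound bmi) auto
  \<comment> \<open>The three errors add up to (3/2 + 6 + 1) \<eta>^3.\<close>
  have "cmod (partial_charfun (Suc (Suc m)) - partial_charfun (Suc m) * (1 - s\<^sup>2 * tau / 2))
      \<le> (\<eta>\<^sup>2 * 1 / 2) * (3 * \<eta>) + (3 * \<eta>) * (2 * \<eta>\<^sup>2) + \<eta> ^ 3"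
    unfolding eq by (intro norm_triangle_mono n1 n2 n3)
  also have "\<dots> \<le> 9 * \<eta> ^ 3"
    using eta_nonneg by (simp add: eval_nat_numeral)
  finally show ?thesis .
qed

lemma partial_charfun_1: "1 \<le> n \<Longrightarrow> partial_charfun (Suc 0) = 1"
  unfolding partial_charfun_def
  using bounded_measurable_beta[of 0] bounded_measurable_beta1[of 0]
  by (subst unif_sample_resample[of 0])
    (auto simp: integral_beta unif01.integrable_bounded_measurable bounded_measurable_of_real
      unif_sample.prob_space intro!: bounded_measurable_add bounded_measurable_of_real)

text \<open>The multiplier 1 - s^2 tau / 2 has modulus at most 1, so one-step errors merely add up.
  With \<eta> of order n^(-1/2), about n errors of size 9 \<eta>^3 amount to O(n^(-1/2)).\<close>

lemma partial_charfun_approx: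
  assumes "Suc m \<le> n"
  shows "cmod (partial_charfun (Suc m) - (1 - s\<^sup>2 * tau / 2) ^ m) \<le> m * (9 * \<eta> ^ 3)"
  using assms
proof (induction m)
  case 0
  then show ?case by (simp add: partial_charfun_1)
next
  case (Suc m)
  let ?q = "1 - s\<^sup>2 * tau / 2"
  have "s\<^sup>2 \<le> 1" using abs_s_le eta_le_1 by (simp add: abs_square_le_1)
  then have q: "\<bar>?q\<bar> \<le> 1"
    using tau_bounds mult_mono[of "s\<^sup>2" 1 tau 1] by auto
  have "cmod (partial_charfun (Suc (Suc m)) - ?q ^ Suc m)
      = cmod ((partial_charfun (Suc (Suc m)) - partial_charfun (Suc m) * ?q) + (partial_charfun (Suc m) - ?q ^ m) * ?q)"
    by (simp add: algebra_simps)
  also have "\<dots> \<le> 9 * \<eta> ^ 3 + (m * (9 * \<eta> ^ 3)) * 1"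
  proof (intro norm_triangle_mono partial_charfun_step)
    show "cmod ((partial_charfun (Suc m) - ?q ^ m) * ?q) \<le> m * (9 * \<eta> ^ 3) * 1"
      unfolding norm_mult norm_of_real using q Suc eta_nonneg by (intro mult_mono) auto
  qed (use Suc in auto)
  finally show ?case by (simp add: algebra_simps)
qed

end

section \<open>Projection of the rank statistic\<close>

text \<open>Chatterjee's formula for responses that are already listed in the order of X.\<close>

definition rank_stat :: "nat \<Rightarrow> (nat \<Rightarrow> real) \<Rightarrow> real" where
  "rank_stat n w = 1 - 3 * (\<Sum>i<n - 1. \<bar>real (card {j\<in>{..<n}. w j \<le> w (Suc i)}) -
     real (card {j\<in>{..<n}. w j \<le> w i})\<bar>) / ((real n)\<^sup>2 - 1)"

text \<open>Indicator that \<open>x\<close> separates \<open>u\<close> from \<open>v\<close>. The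
  half-open intervals match ranks that count values \<le>, so a rank difference is a sum of
  crossings even in the presence of ties.\<close>

definition crossing :: "real \<Rightarrow> real \<Rightarrow> real \<Rightarrow> real" where
  "crossing u v x = (if u < x \<and> x \<le> v then 1 else 0) + (if v < x \<and> x \<le> u then 1 else 0)"

text \<open>The crossing indicator minus its projections on the pair \<open>(u, v)\<close> and on \<open>x\<close>.\<close>

definition crossing_residual :: "real \<Rightarrow> real \<Rightarrow> real \<Rightarrow> real" where
  "crossing_residual u v x = crossing u v x - \<bar>u - v\<bar> - 2 * (x * (1 - x)) + 1 / 3"

lemma rank_diff_eq_sum_crossing:
  fixes w :: "nat \<Rightarrow> real"
  shows "\<bar>real (card {j\<in>{..<n}. w j \<le> b}) - real (card {j\<in>{..<n}. w j \<le> a})\<bar> = (\<Sum>j<n. crossing a b (w j))"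
proof -
  have card_eq: "real (card {j\<in>{..<n}. w j \<le> c}) = (\<Sum>j<n. if w j \<le> c then 1 else 0)" for c
    unfolding real_of_card by (rule sum.inter_filter) simp
  have *: "real (card {j\<in>{..<n}. w j \<le> d}) - real (card {j\<in>{..<n}. w j \<le> c}) = (\<Sum>j<n. crossing c d (w j))"
    if "c \<le> d" for c d
    unfolding card_eq sum_subtractf[symmetric] using that
    by (intro sum.cong) (auto simp: crossing_def)
  have comm: "crossing a b x = crossing b a x" for x
    by (simp add: crossing_def)
  have nonneg: "0 \<le> (\<Sum>j<n. crossing a b (w j))"
    by (intro sum_nonneg) (auto simp: crossing_def)
  show ?thesis
  proof (cases "a \<le> b")
    case True
    then show ?thesis using * nonneg by simp
  next
    case False
    then show ?thesis using *[of b a] nonneg by (simp add: comm)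
  qed
qed

lemma measurable_crossing_residual [measurable (raw)]:
  assumes [measurable]: "f \<in> borel_measurable M" "g \<in> borel_measurable M" "h \<in> borel_measurable M"
  shows "(\<lambda>x. crossing_residual (f x) (g x) (h x)) \<in> borel_measurable M"
  unfolding crossing_residual_def crossing_def by measurable

lemma abs_crossing_residual_le_2:
  assumes "0 < u" "u < 1" "0 < v" "v < 1" "0 < x" "x < 1"
  shows "\<bar>crossing_residual u v x\<bar> \<le> 2"
proof -
  have "0 \<le> crossing u v x" "crossing u v x \<le> 1" by (auto simp: crossing_def)
  moreover have "\<bar>u - v\<bar> \<le> 1" "0 \<le> \<bar>u - v\<bar>" using assms by linarith+
  ultimately show ?thesis
    unfolding crossing_residual_def using unit_parabola_bounds[OF assms(5,6)] by linarith
qed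

lemma bounded_measurable_crossing_residual [intro]:
  assumes "f \<in> borel_measurable M" "g \<in> borel_measurable M" "h \<in> borel_measurable M"
    "\<And>x. x \<in> space M \<Longrightarrow> f x \<in> {0<..<1}" "\<And>x. x \<in> space M \<Longrightarrow> g x \<in> {0<..<1}"
    "\<And>x. x \<in> space M \<Longrightarrow> h x \<in> {0<..<1}"
  shows "bounded_measurable M (\<lambda>x. crossing_residual (f x) (g x) (h x))"
  using assms by (intro bounded_measurableI[where C=2]) (auto intro!: abs_crossing_residual_le_2)

lemma unif01_integral_indicator:
  assumes "A \<in> sets borel"
  shows "(\<integral>x. indicator A x \<partial>unif01) = measure lborel (A \<inter> {0<..<1})"
proof -
  have *: "(\<lambda>v. indicator {0<..<1} v *\<^sub>R indicator A v) = (indicator (A \<inter> {0<..<1}) :: real \<Rightarrow> real)"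
    by (auto simp: fun_eq_iff split: split_indicator)
  show ?thesis
    unfolding unif01_def using assms by (subst integral_restrict_space) (auto simp: * simp del: real_scaleR_def)
qed

lemma integral_unit_parabola: "(\<integral>x. x * (1 - x) \<partial>unif01) = 1 / 6"
  using unit_parabola_bounds
  by (intro unif01_integral_eq has_integral_parabola bounded_measurableI[where C=1])
    (auto, force)

lemma integral_abs_diff:
  assumes "0 < u" "u < 1"
  shows "(\<integral>v. \<bar>u - v\<bar> \<partial>unif01) = 1 / 2 - u * (1 - u)"
proof -
  have "(\<integral>v. \<bar>u - v\<bar> \<partial>unif01) = 1 / 2 - u + u\<^sup>2"
    using assms by (intro unif01_integral_eq has_integral_abs_diff bounded_measurableI[where C=1]) auto
  then show ?thesis by (simp add: power2_eq_square algebra_simps)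
qed

lemma bounded_measurable_unif01_basic:
  "bounded_measurable unif01 (\<lambda>x. x * (1 - x))"
  "0 < u \<Longrightarrow> u < 1 \<Longrightarrow> bounded_measurable unif01 (\<lambda>v. \<bar>u - v\<bar>)"
  "A \<in> sets borel \<Longrightarrow> bounded_measurable unif01 (indicator A :: real \<Rightarrow> real)"
proof -
  have id: "bounded_measurable unif01 (\<lambda>x. x)"
    by (rule bounded_measurableI[where C=1]) auto
  show "bounded_measurable unif01 (\<lambda>x. x * (1 - x))" "bounded_measurable unif01 (\<lambda>v. \<bar>u - v\<bar>)"
    by (intro bounded_measurable_intros id)+
  show "A \<in> sets borel \<Longrightarrow> bounded_measurable unif01 (indicator A :: real \<Rightarrow> real)"
    by (rule bounded_measurableI[where C=1]) (auto intro!: borel_measurable_unif01 split: split_indicator)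
qed

text \<open>A uniform point separates u from v with probability |u - v|, and 2x(1 - x) has mean 1/3,
  the constant that is added back.\<close>

lemma integral_crossing_residual_3:
  assumes "0 < u" "u < 1" "0 < v" "v < 1"
  shows "(\<integral>x. crossing_residual u v x \<partial>unif01) = 0"
proof -
  let ?A = "{min u v<..max u v}"
  have "(\<integral>x. indicator ?A x \<partial>unif01) = measure lborel (?A \<inter> {0<..<1})"
    by (rule unif01_integral_indicator) simp
  also have "?A \<inter> {0<..<1} = ?A" using assms by auto
  finally have ind: "(\<integral>x. indicator ?A x \<partial>unif01) = \<bar>u - v\<bar>" by (simp add: max_def min_def)
  have "(\<integral>x. crossing_residual u v x \<partial>unif01) = (\<integral>x. indicator ?A x + (1 / 3 - \<bar>u - v\<bar>) - 2 * (x * (1 - x)) \<partial>unif01)"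
    by (intro Bochner_Integration.integral_cong)
      (auto simp: crossing_residual_def crossing_def min_def max_def split: split_indicator)
  also have "\<dots> = (\<integral>x. indicator ?A x + (1 / 3 - \<bar>u - v\<bar>) \<partial>unif01) - (\<integral>x. 2 * (x * (1 - x)) \<partial>unif01)"
    by (intro Bochner_Integration.integral_diff unif01.integrable_bounded_measurable
        bounded_measurable_intros bounded_measurable_unif01_basic) auto
  also have "(\<integral>x. indicator ?A x + (1 / 3 - \<bar>u - v\<bar>) \<partial>unif01) = \<bar>u - v\<bar> + (1 / 3 - \<bar>u - v\<bar>)"
    unfolding ind[symmetric]
    by (subst Bochner_Integration.integral_add)
      (auto intro!: unif01.integrable_bounded_measurable bounded_measurable_unif01_basic)
  also have "(\<integral>x. 2 * (x * (1 - x)) \<partial>unif01) = 2 * (1 / 6)"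
    by (simp only: integral_mult_right_zero integral_unit_parabola)
  finally show ?thesis by simp
qed

text \<open>A fixed x separates two independent uniforms with probability 2x(1 - x), and |u - v| has
  mean 1/3, so the corrections cancel once more.\<close>

lemma integral_crossing_residual_12:
  assumes x: "0 < x" "x < 1"
  shows "(\<integral>u. (\<integral>v. crossing_residual u v x \<partial>unif01) \<partial>unif01) = 0"
proof -
  have A1: "(\<integral>v. indicator {x..} v \<partial>unif01) = 1 - x"
  proof -
    have "{x..} \<inter> {0<..<1} = {x..<1}" using x by auto
    then show ?thesis using x by (subst unif01_integral_indicator) auto
  qed
  have A2: "(\<integral>v. indicator {..<x} v \<partial>unif01) = x"
  proof -
    have "{..<x} \<inter> {0<..<1} = {0<..<x}" using x by auto
    then show ?thesis using x by (subst unif01_integral_indicator) auto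
  qed
  note bmi = bounded_measurable_intros bounded_measurable_unif01_basic
  let ?c = "1 / 3 - 2 * (x * (1 - x))"
  have inner: "(\<integral>v. crossing_residual u v x \<partial>unif01) =
      indicator {..<x} u * (1 - x) + indicator {x..} u * x + u * (1 - u) + (?c - 1 / 2)"
    if u: "0 < u" "u < 1" for u
  proof -
    have "(\<integral>v. crossing_residual u v x \<partial>unif01) =
        (\<integral>v. indicator {..<x} u * indicator {x..} v + indicator {x..} u * indicator {..<x} v + ?c - \<bar>u - v\<bar> \<partial>unif01)"
      by (intro Bochner_Integration.integral_cong)
        (auto simp: crossing_residual_def crossing_def split: split_indicator)
    also have "\<dots> = indicator {..<x} u * (1 - x) + indicator {x..} u * x + ?c - (1 / 2 - u * (1 - u))"
    proof -
      have i: "integrable unif01 (\<lambda>v. indicator {..<x} u * indicator {x..} v :: real)"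
        "integrable unif01 (\<lambda>v. indicator {x..} u * indicator {..<x} v :: real)"
        "integrable unif01 (\<lambda>v. ?c)" "integrable unif01 (\<lambda>v. \<bar>u - v\<bar>)"
        using u by (intro unif01.integrable_bounded_measurable bmi; simp)+
      show ?thesis
        unfolding integral_abs_diff[OF u, symmetric]
        using i A1 A2 by (simp add: Bochner_Integration.integral_add Bochner_Integration.integral_diff)
    qed
    finally show ?thesis by simp
  qed
  have "(\<integral>u. (\<integral>v. crossing_residual u v x \<partial>unif01) \<partial>unif01) =
      (\<integral>u. indicator {..<x} u * (1 - x) + indicator {x..} u * x + u * (1 - u) + (?c - 1 / 2) \<partial>unif01)"
    by (intro Bochner_Integration.integral_cong) (auto simp: inner)
  also have "\<dots> = x * (1 - x) + (1 - x) * x + 1 / 6 + (?c - 1 / 2)"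
  proof -
    have i: "integrable unif01 (\<lambda>u. indicator {..<x} u * (1 - x))"
      "integrable unif01 (\<lambda>u. indicator {x..} u * x)"
      "integrable unif01 (\<lambda>u. u * (1 - u))" "integrable unif01 (\<lambda>u. ?c - 1 / 2)"
      by (intro unif01.integrable_bounded_measurable bmi; simp)+
    note [simp] = integral_unit_parabola
    show ?thesis
      using i A1 A2 by (simp add: Bochner_Integration.integral_add)
  qed
  finally show ?thesis by simp
qed

text \<open>After expanding the square, pairs that are not \<open>near\<close> contribute nothing
  and every other pair at most C^2. Orthogonality thus turns a moment bound into a counting
  problem.\<close>

lemma second_moment_sum_le:
  fixes f :: "'i \<Rightarrow> 'a \<Rightarrow> real"
  assumes M: "prob_space M" and S: "finite S"
    and f: "\<And>p. p \<in> S \<Longrightarrow> f p \<in> borel_measurable M"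
    and bound: "\<And>p x. p \<in> S \<Longrightarrow> x \<in> space M \<Longrightarrow> \<bar>f p x\<bar> \<le> C"
    and orth: "\<And>p q. p \<in> S \<Longrightarrow> q \<in> S \<Longrightarrow> \<not> near p q \<Longrightarrow> (\<integral>x. f p x * f q x \<partial>M) = 0"
  shows "(\<integral>x. (\<Sum>p\<in>S. f p x)\<^sup>2 \<partial>M) \<le> C\<^sup>2 * card {(p, q). p \<in> S \<and> q \<in> S \<and> near p q}"
proof -
  interpret prob_space M by fact
  have bm: "p \<in> S \<Longrightarrow> bounded_measurable M (f p)" for p
    using f bound by (intro bounded_measurableI[where C=C]) auto
  have int: "p \<in> S \<Longrightarrow> q \<in> S \<Longrightarrow> integrable M (\<lambda>x. f p x * f q x)" for p q
    by (intro integrable_bounded_measurable bounded_measurable_intros bm)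
  have "(\<integral>x. (\<Sum>p\<in>S. f p x)\<^sup>2 \<partial>M) = (\<integral>x. (\<Sum>p\<in>S. \<Sum>q\<in>S. f p x * f q x) \<partial>M)"
    by (simp add: power2_eq_square sum_product)
  also have "\<dots> = (\<Sum>p\<in>S. \<Sum>q\<in>S. \<integral>x. f p x * f q x \<partial>M)"
    using int by (subst Bochner_Integration.integral_sum) (auto intro!: sum.cong Bochner_Integration.integral_sum)
  also have "\<dots> \<le> (\<Sum>p\<in>S. \<Sum>q\<in>S. if near p q then C\<^sup>2 else 0)"
  proof (intro sum_mono)
    fix p q assume pq: "p \<in> S" "q \<in> S"
    have "(\<integral>x. f p x * f q x \<partial>M) \<le> (\<integral>x. C\<^sup>2 \<partial>M)"
    proof (intro integral_mono int pq)
      fix x assume x: "x \<in> space M"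
      have "f p x * f q x \<le> \<bar>f p x\<bar> * \<bar>f q x\<bar>" by (metis abs_ge_self abs_mult)
      also have "\<dots> \<le> C * C"
        using bound[OF pq(1) x] bound[OF pq(2) x] by (intro mult_mono) auto
      finally show "f p x * f q x \<le> C\<^sup>2" by (simp add: power2_eq_square)
    qed auto
    then show "(\<integral>x. f p x * f q x \<partial>M) \<le> (if near p q then C\<^sup>2 else 0)"
      using orth[OF pq] by (auto simp: prob_space)
  qed
  also have "\<dots> = (\<Sum>r\<in>S \<times> S. if near (fst r) (snd r) then C\<^sup>2 else 0)"
    by (simp add: sum.cartesian_product case_prod_unfold)
  also have "\<dots> = C\<^sup>2 * card {r \<in> S \<times> S. near (fst r) (snd r)}"
    using S by (simp add: sum.If_cases Int_def)
  also have "{r \<in> S \<times> S. near (fst r) (snd r)} = {(p, q). p \<in> S \<and> q \<in> S \<and> near p q}"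
    by auto
  finally show ?thesis .
qed

section \<open>Second moment of the off-diagonal residual sum\<close>

definition off_diagonal :: "nat \<Rightarrow> (nat \<times> nat) set" where
  "off_diagonal n = {(i, j). Suc i < n \<and> j < n \<and> j \<noteq> i \<and> j \<noteq> Suc i}"

text \<open>Only triples of distinct coordinates enter, because the centring needs
  \<open>w j\<close> independent of the pair. The omitted terms are O(n) in number and are bounded
  directly.\<close>

definition residual_sum :: "nat \<Rightarrow> (nat \<Rightarrow> real) \<Rightarrow> real" where
  "residual_sum n w = (\<Sum>(i, j)\<in>off_diagonal n. crossing_residual (w i) (w (Suc i)) (w j))"

lemma finite_off_diagonal: "finite (off_diagonal n)"
  by (rule finite_subset[of _ "{..<n} \<times> {..<n}"]) (auto simp: off_diagonal_def)

lemma bounded_measurable_crossing_residual_coord: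
  "i < n \<Longrightarrow> i' < n \<Longrightarrow> j < n \<Longrightarrow>
    bounded_measurable (unif_sample n) (\<lambda>w. crossing_residual (w i) (w i') (w j))"
  by (rule bounded_measurable_crossing_residual) (auto dest: space_unif_sampleD)

text \<open>The index \<open>j\<close> occurs in one of the two factors only, so integrating out
  \<open>w j\<close> already gives 0.\<close>

lemma residual_orthogonal:
  assumes p: "(i, j) \<in> off_diagonal n" and q: "(i', j') \<in> off_diagonal n"
    and free: "j \<noteq> j'" "j \<noteq> i'" "j \<noteq> Suc i'"
  shows "(\<integral>w. crossing_residual (w i) (w (Suc i)) (w j) * crossing_residual (w i') (w (Suc i')) (w j')
    \<partial>unif_sample n) = 0"
proof -
  have "(\<integral>w. crossing_residual (w i) (w (Suc i)) (w j) * crossing_residual (w i') (w (Suc i')) (w j') \<partial>unif_sample n)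
    = (\<integral>w. (\<integral>y. crossing_residual (w i) (w (Suc i)) y * crossing_residual (w i') (w (Suc i')) (w j') \<partial>unif01) \<partial>unif_sample n)"
    using p q free by (subst unif_sample_resample[of j])
      (auto simp: off_diagonal_def intro!: bounded_measurable_mult bounded_measurable_crossing_residual_coord)
  also have "\<dots> = (\<integral>w. 0 \<partial>unif_sample n)"
  proof (intro Bochner_Integration.integral_cong refl)
    fix w assume "w \<in> space (unif_sample n)"
    from space_unif_sampleD[OF this]
    have "(\<integral>y. crossing_residual (w i) (w (Suc i)) y \<partial>unif01) = 0"
      using p by (intro integral_crossing_residual_3) (auto simp: off_diagonal_def)
    then show "(\<integral>y. crossing_residual (w i) (w (Suc i)) y * crossing_residual (w i') (w (Suc i')) (w j') \<partial>unif01) = 0"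
      by simp
  qed
  finally show ?thesis by simp
qed

text \<open>With a common third index but disjoint pairs, the coordinates \<open>i\<close> and
  \<open>Suc i\<close> both occur in one factor only. Averaging over this pair with
  \<open>w j\<close> fixed gives 0.\<close>

lemma residual_orthogonal_same:
  assumes p: "(i, j) \<in> off_diagonal n" and q: "(i', j) \<in> off_diagonal n"
    and far: "i' \<noteq> i" "i' \<noteq> Suc i" "i \<noteq> Suc i'"
  shows "(\<integral>w. crossing_residual (w i) (w (Suc i)) (w j) * crossing_residual (w i') (w (Suc i')) (w j)
    \<partial>unif_sample n) = 0"
proof -
  let ?r = "\<lambda>w. crossing_residual (w i') (w (Suc i')) (w j)"
  let ?I = "\<lambda>u x. \<integral>v. crossing_residual u v x \<partial>unif01"
  \<comment> \<open>The partially averaged residual is again bounded and measurable, as the second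
    resampling requires.\<close>
  have bm: "bounded_measurable (unif_sample n) (\<lambda>w. ?I (w i) (w j))"
  proof (rule bounded_measurableI[where C=2])
    have [measurable]: "(\<lambda>z. fst z a) \<in> borel_measurable (unif_sample n \<Otimes>\<^sub>M unif01)" if "a < n" for a
      using that by (intro measurable_compose[OF measurable_fst]) auto
    have [measurable]: "snd \<in> borel_measurable (unif_sample n \<Otimes>\<^sub>M unif01)"
      by (intro borel_measurable_unif01D) auto
    show "(\<lambda>w. ?I (w i) (w j)) \<in> borel_measurable (unif_sample n)"
      using p by (auto simp: off_diagonal_def)
    fix w assume "w \<in> space (unif_sample n)"
    note w = space_unif_sampleD[OF this]
    have "norm (?I (w i) (w j)) \<le> (\<integral>v. norm (crossing_residual (w i) v (w j)) \<partial>unif01)"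
      by (rule integral_norm_bound)
    also have "\<dots> \<le> (\<integral>v. 2 \<partial>unif01)"
      using w[of i] w[of j] p
      by (intro integral_mono unif01.integrable_bounded_measurable bounded_measurable_norm
          bounded_measurable_crossing_residual bounded_measurable_const)
        (auto intro!: abs_crossing_residual_le_2 simp: off_diagonal_def)
    finally show "norm (?I (w i) (w j)) \<le> 2" by simp
  qed
  have "(\<integral>w. crossing_residual (w i) (w (Suc i)) (w j) * ?r w \<partial>unif_sample n)
    = (\<integral>w. (\<integral>y. crossing_residual (w i) y (w j) * ?r w \<partial>unif01) \<partial>unif_sample n)"
    using p q far by (subst unif_sample_resample[of "Suc i"])
      (auto simp: off_diagonal_def intro!: bounded_measurable_mult bounded_measurable_crossing_residual_coord)
  also have "\<dots> = (\<integral>w. ?I (w i) (w j) * ?r w \<partial>unif_sample n)"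
    by simp
  also have "\<dots> = (\<integral>w. (\<integral>y. ?I y (w j) * ?r w \<partial>unif01) \<partial>unif_sample n)"
    using p q far by (subst unif_sample_resample[of i])
      (auto simp: off_diagonal_def intro!: bounded_measurable_mult bm bounded_measurable_crossing_residual_coord)
  also have "\<dots> = (\<integral>w. 0 \<partial>unif_sample n)"
  proof (intro Bochner_Integration.integral_cong refl)
    fix w assume "w \<in> space (unif_sample n)"
    then have "0 < w j" "w j < 1"
      using p space_unif_sampleD[of w n j] by (auto simp: off_diagonal_def)
    then show "(\<integral>y. ?I y (w j) * ?r w \<partial>unif01) = 0"
      by (simp add: integral_crossing_residual_12)
  qed
  finally show ?thesis by simp
qed

text \<open>Two terms can be correlated only if they share the third index and have overlapping
  pairs, at most 3 n^2 cases, or if each third index lies in the other pair, at most 4 n^2 cases.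
  Residuals are bounded by 2, which gives 4 * 7 = 28.\<close>

lemma second_moment_residual_sum:
  "(\<integral>w. (residual_sum n w)\<^sup>2 \<partial>unif_sample n) \<le> 28 * (real n)\<^sup>2"
proof -
  define near :: "nat \<times> nat \<Rightarrow> nat \<times> nat \<Rightarrow> bool" where
    "near p q \<longleftrightarrow> (snd p = snd q \<and> (fst q = fst p \<or> fst q = Suc (fst p) \<or> fst p = Suc (fst q))) \<or>
      ((snd p = fst q \<or> snd p = Suc (fst q)) \<and> (snd q = fst p \<or> snd q = Suc (fst p)))" for p q
  let ?S = "off_diagonal n"
  let ?N = "{(p, q). p \<in> ?S \<and> q \<in> ?S \<and> near p q}"
  let ?f = "\<lambda>p w. crossing_residual (w (fst p)) (w (Suc (fst p))) (w (snd p))"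
  have "(\<integral>w. (\<Sum>p\<in>?S. ?f p w)\<^sup>2 \<partial>unif_sample n) \<le> 2\<^sup>2 * real (card ?N)"
  proof (rule second_moment_sum_le[OF prob_space_unif_sample finite_off_diagonal])
    fix p assume p: "p \<in> ?S"
    then show "?f p \<in> borel_measurable (unif_sample n)"
      by (intro bounded_measurableD bounded_measurable_crossing_residual_coord) (auto simp: off_diagonal_def)
    show "\<bar>?f p w\<bar> \<le> 2" if "w \<in> space (unif_sample n)" for w
      using p space_unif_sampleD[OF that] by (intro abs_crossing_residual_le_2) (auto simp: off_diagonal_def)
  next
    fix p q assume pq: "p \<in> ?S" "q \<in> ?S" "\<not> near p q"
    obtain i j i' j' where eq: "p = (i, j)" "q = (i', j')" by (metis surj_pair)
    consider "j = j'" | "j \<noteq> j'" "j \<noteq> i'" "j \<noteq> Suc i'" | "j' \<noteq> j" "j' \<noteq> i" "j' \<noteq> Suc i"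
      using pq(3) unfolding near_def eq by auto
    then show "(\<integral>w. ?f p w * ?f q w \<partial>unif_sample n) = 0"
    proof cases
      case 1
      then show ?thesis
        using pq residual_orthogonal_same[of i j n i'] unfolding near_def eq by auto
    next
      case 2
      then show ?thesis
        using pq residual_orthogonal[of i j n i' j'] unfolding eq by auto
    next
      case 3
      then show ?thesis
        using pq residual_orthogonal[of i' j' n i j] unfolding eq by (auto simp: mult.commute)
    qed
  qed
  also have "2\<^sup>2 * real (card ?N) \<le> 2\<^sup>2 * real (7 * n\<^sup>2)"
  proof (intro mult_left_mono of_nat_mono)
    \<comment> \<open>\<open>g1\<close> encodes the offsets -1, 0, 1 between the pairs as
      \<open>d - 1\<close>. For \<open>i = 0\<close> and \<open>d = 0\<close> natural subtraction
      truncates, which is harmless because only a covering is claimed.\<close>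
    define g1 where "g1 = (\<lambda>(i, j, d). ((i, j), (i + d - 1, j)) :: (nat \<times> nat) \<times> (nat \<times> nat))"
    define g2 where "g2 = (\<lambda>(i, i', d, e). ((i, i' + d), (i', i + e)) :: (nat \<times> nat) \<times> (nat \<times> nat))"
    let ?A = "{..<n} \<times> {..<n} \<times> {0, 1, 2::nat}" and ?B = "{..<n} \<times> {..<n} \<times> {0, 1::nat} \<times> {0, 1::nat}"
    have "?N \<subseteq> g1 ` ?A \<union> g2 ` ?B"
    proof
      fix r assume r: "r \<in> ?N"
      obtain i j i' j' where eq: "r = ((i, j), (i', j'))" by (metis surj_pair)
      have lt: "i < n" "j < n" "i' < n" "j' < n" using r by (auto simp: eq off_diagonal_def)
      have "near (i, j) (i', j')" using r by (auto simp: eq)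
      then consider "j = j'" "i' = i" | "j = j'" "i' = Suc i" | "j = j'" "i = Suc i'"
        | d e where "d \<in> {0, 1}" "e \<in> {0, 1}" "j = i' + d" "j' = i + e"
        unfolding near_def by fastforce
      then show "r \<in> g1 ` ?A \<union> g2 ` ?B"
      proof cases
        case 1
        then have "r = g1 (i, j, 1)" by (simp add: eq g1_def)
        then show ?thesis using lt by blast
      next
        case 2
        then have "r = g1 (i, j, 2)" by (simp add: eq g1_def)
        then show ?thesis using lt by blast
      next
        case 3
        then have "r = g1 (i, j, 0)" by (simp add: eq g1_def)
        then show ?thesis using lt by blast
      next
        case 4
        then have "r = g2 (i, i', d, e)" by (simp add: eq g2_def)
        then show ?thesis using lt 4 by blast
      qed
    qed
    then have "card ?N \<le> card (g1 ` ?A \<union> g2 ` ?B)"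
      by (intro card_mono) auto
    also have "\<dots> \<le> card ?A + card ?B"
      by (rule order_trans[OF card_Un_le]) (intro add_mono card_image_le; simp)
    also have "\<dots> = 7 * n\<^sup>2"
      by (simp add: card_cartesian_product power2_eq_square algebra_simps)
    finally show "card ?N \<le> 7 * n\<^sup>2" .
  qed simp
  finally show ?thesis
    by (simp add: residual_sum_def case_prod_unfold)
qed

section \<open>Linearisation of the rank statistic\<close>

definition kappa_sum :: "nat \<Rightarrow> (nat \<Rightarrow> real) \<Rightarrow> real" where
  "kappa_sum n w = (\<Sum>i<n - 1. kappa (w i) (w (Suc i)))"

lemma sum_adjacent:
  fixes q :: "nat \<Rightarrow> real"
  shows "(\<Sum>i<m. q i + q (Suc i)) = 2 * (\<Sum>j<Suc m. q j) - q 0 - q m"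
  by (induction m) auto

text \<open>The decomposition of \<open>crossing\<close> is summed over i and j. Its parabolas carry
  weight 2(n - 1), whereas n times \<open>kappa_sum\<close> gives them weight 2n except at the two
  ends; this mismatch is at most n/2. The omitted terms j = i and j = i + 1 add at most 4n.\<close>

lemma crossing_sum_decomposition:
  fixes w :: "nat \<Rightarrow> real"
  assumes w: "\<And>i. i < n \<Longrightarrow> 0 < w i \<and> w i < 1" and n: "2 \<le> n"
  shows "\<bar>(\<Sum>i<n - 1. \<Sum>j<n. crossing (w i) (w (Suc i)) (w j)) - real n * kappa_sum n w - real n * (real n - 1) / 3\<bar>
    \<le> \<bar>residual_sum n w\<bar> + 5 * real n"
proof -
  obtain m where m: "n = Suc m" "1 \<le> m" using n by (cases n) auto
  let ?r = "\<lambda>i j. crossing_residual (w i) (w (Suc i)) (w j)"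
  let ?q = "\<lambda>j. w j * (1 - w j)"
  let ?E = "\<Sum>i<m. ?r i i + ?r i (Suc i)"
  have q: "0 \<le> ?q j" "?q j \<le> 1 / 4" if "j < n" for j
    using w[OF that] unit_parabola_bounds by auto
  have res: "(\<Sum>i<m. \<Sum>j<n. ?r i j) = residual_sum n w + ?E"
  proof -
    have "(\<Sum>j<n. ?r i j) = (\<Sum>j | j < n \<and> j \<noteq> i \<and> j \<noteq> Suc i. ?r i j) + (?r i i + ?r i (Suc i))" if "i < m" for i
    proof -
      have "{..<n} = insert i (insert (Suc i) {j. j < n \<and> j \<noteq> i \<and> j \<noteq> Suc i})"
        using that m by auto
      then show ?thesis by (simp add: algebra_simps)
    qed
    then have "(\<Sum>i<m. \<Sum>j<n. ?r i j) = (\<Sum>i<m. \<Sum>j | j < n \<and> j \<noteq> i \<and> j \<noteq> Suc i. ?r i j) + ?E"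
      by (simp add: sum.distrib)
    also have "(\<Sum>i<m. \<Sum>j | j < n \<and> j \<noteq> i \<and> j \<noteq> Suc i. ?r i j) =
        (\<Sum>(i, j)\<in>(SIGMA i:{..<m}. {j. j < n \<and> j \<noteq> i \<and> j \<noteq> Suc i}). ?r i j)"
      by (subst sum.Sigma) auto
    also have "(SIGMA i:{..<m}. {j. j < n \<and> j \<noteq> i \<and> j \<noteq> Suc i}) = off_diagonal n"
      using m by (auto simp: off_diagonal_def)
    finally show ?thesis by (simp add: residual_sum_def)
  qed
  have "(\<Sum>i<m. \<Sum>j<n. crossing (w i) (w (Suc i)) (w j))
      = (\<Sum>i<m. \<Sum>j<n. ?r i j + \<bar>w i - w (Suc i)\<bar> + 2 * ?q j - 1 / 3)"
    by (intro sum.cong) (auto simp: crossing_residual_def)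
  also have "\<dots> = (\<Sum>i<m. \<Sum>j<n. ?r i j) + n * (\<Sum>i<m. \<bar>w i - w (Suc i)\<bar>)
      + 2 * m * (\<Sum>j<n. ?q j) - m * n / 3"
    by (simp add: sum.distrib sum_subtractf sum_distrib_left mult_ac del: sum.lessThan_Suc)
  finally have J: "(\<Sum>i<m. \<Sum>j<n. crossing (w i) (w (Suc i)) (w j)) =
      residual_sum n w + ?E + n * (\<Sum>i<m. \<bar>w i - w (Suc i)\<bar>) + 2 * m * (\<Sum>j<n. ?q j) - m * n / 3"
    by (simp only: res)
  have "kappa_sum n w = (\<Sum>i<m. \<bar>w i - w (Suc i)\<bar> + (?q i + ?q (Suc i)) - 2 / 3)"
    unfolding kappa_sum_def by (intro sum.cong) (auto simp: m kappa_def)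
  also have "\<dots> = (\<Sum>i<m. \<bar>w i - w (Suc i)\<bar>) + (\<Sum>i<m. ?q i + ?q (Suc i)) - m * (2 / 3)"
    by (simp only: sum.distrib sum_subtractf) simp
  also have "(\<Sum>i<m. ?q i + ?q (Suc i)) = 2 * (\<Sum>j<n. ?q j) - ?q 0 - ?q m"
    unfolding m by (rule sum_adjacent)
  finally have K: "kappa_sum n w = (\<Sum>i<m. \<bar>w i - w (Suc i)\<bar>) + (2 * (\<Sum>j<n. ?q j) - ?q 0 - ?q m) - m * (2 / 3)" .
  have "(\<Sum>i<n - 1. \<Sum>j<n. crossing (w i) (w (Suc i)) (w j)) - real n * kappa_sum n w - real n * (real n - 1) / 3
      = residual_sum n w + ?E - 2 * (\<Sum>j<n. ?q j) + n * (?q 0 + ?q m)"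
    unfolding K using J m by (simp add: field_simps del: sum.lessThan_Suc)
  moreover have "\<bar>?E\<bar> \<le> 4 * n"
  proof -
    have "\<bar>?E\<bar> \<le> (\<Sum>i<m. 4)"
    proof (intro order_trans[OF sum_abs] sum_mono)
      fix i assume "i \<in> {..<m}"
      then have "0 < w i \<and> w i < 1" "0 < w (Suc i) \<and> w (Suc i) < 1" using w m by auto
      then have "\<bar>?r i i\<bar> \<le> 2" "\<bar>?r i (Suc i)\<bar> \<le> 2" by (auto intro!: abs_crossing_residual_le_2)
      then show "\<bar>?r i i + ?r i (Suc i)\<bar> \<le> 4" by linarith
    qed
    then show ?thesis using m by simp
  qed
  moreover have "0 \<le> (\<Sum>j<n. ?q j)"
    by (rule sum_nonneg) (use q in auto)
  moreover have "(\<Sum>j<n. ?q j) \<le> (\<Sum>j<n. 1 / 4)"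
    by (rule sum_mono) (use q in auto)
  moreover have "0 \<le> n * (?q 0 + ?q m)" "n * (?q 0 + ?q m) \<le> n * (1 / 2)"
    using q[of 0] q[of m] m by (auto intro!: mult_left_mono)
  ultimately show ?thesis
    unfolding sum_constant card_lessThan by linarith
qed

text \<open>The leading part n(n - 1)/3 of the crossing count cancels the 1 in the statistic up to
  1/(n + 1). The rest is divided by n^2 - 1, which is at least 3/4 n^2 for n \<ge> 2; this turns the
  factor 3 into 4.\<close>

lemma rank_stat_approx:
  assumes w: "\<And>i. i < n \<Longrightarrow> 0 < w i \<and> w i < 1" and n: "2 \<le> n"
  shows "(sqrt n * rank_stat n w - (- 3 / sqrt n) * kappa_sum n w)\<^sup>2 \<le>
    (1250 * (real n)\<^sup>2 + 32 * (residual_sum n w)\<^sup>2) / real n ^ 3"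
proof -
  let ?J = "\<Sum>i<n - 1. \<Sum>j<n. crossing (w i) (w (Suc i)) (w j)"
  let ?K = "kappa_sum n w" and ?D = "residual_sum n w"
  define R where "R = ?J - real n * ?K - real n * (real n - 1) / 3"
  have R: "\<bar>R\<bar> \<le> \<bar>?D\<bar> + 5 * real n"
    unfolding R_def by (rule crossing_sum_decomposition[OF w n])
  have K: "\<bar>?K\<bar> \<le> n"
  proof -
    have "\<bar>?K\<bar> \<le> (\<Sum>i<n - 1. 1)"
      unfolding kappa_sum_def using w by (intro order_trans[OF sum_abs] sum_mono abs_kappa_le_1) auto
    then show ?thesis using n by simp
  qed
  have n2: "2 \<le> real n" using n by simp
  then have sq: "3 / 4 * (real n)\<^sup>2 \<le> (real n)\<^sup>2 - 1"
    using power_mono[OF n2, of 2] by simp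
  have pos: "0 < (real n)\<^sup>2 - 1" proof -
    have "0 < (real n)\<^sup>2" using n2 by simp
    then show ?thesis using sq by linarith
  qed
  have rs: "rank_stat n w = 1 - 3 * ?J / ((real n)\<^sup>2 - 1)"
    unfolding rank_stat_def by (simp only: rank_diff_eq_sum_crossing)
  have alg: "1 - 3 * (N * K + N * (N - 1) / 3 + R) / ((N - 1) * (N + 1)) + 3 * K / N =
      1 / (N + 1) - 3 * (R + K / N) / ((N - 1) * (N + 1))" if "2 \<le> N" for N K R :: real
  proof -
    have "N \<noteq> 0" "N - 1 \<noteq> 0" "N + 1 \<noteq> 0" using that by auto
    moreover have "3 * (N * K + N * (N - 1) / 3 + R) / ((N - 1) * (N + 1)) =
        3 * N * K / ((N - 1) * (N + 1)) + N / (N + 1) + 3 * R / ((N - 1) * (N + 1))"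
    proof -
      have e: "3 * (N * K + N * (N - 1) / 3 + R) = 3 * N * K + N * (N - 1) + 3 * R"
        by (simp add: distrib_left)
      have "N * (N - 1) / ((N - 1) * (N + 1)) = N / (N + 1)"
        using that by (simp add: mult.commute[of N])
      then show ?thesis unfolding e add_divide_distrib by simp
    qed
    moreover have "3 * N * K / ((N - 1) * (N + 1)) = 3 * K / N + 3 * (K / N) / ((N - 1) * (N + 1))"
      using calculation(1-3) by (simp add: divide_simps) (simp add: algebra_simps)
    moreover have "1 - N / (N + 1) = 1 / (N + 1)"
      using calculation(3) by (simp add: divide_simps)
    ultimately show ?thesis by (simp add: distrib_left add_divide_distrib)
  qed
  have "sqrt n * rank_stat n w - (- 3 / sqrt n) * ?K = sqrt n * (rank_stat n w + 3 * ?K / n)"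
    using n2 by (simp add: field_simps)
  moreover have "rank_stat n w + 3 * ?K / n = 1 / (real n + 1) - 3 * (R + ?K / n) / ((real n)\<^sup>2 - 1)"
  proof -
    have J: "?J = real n * ?K + real n * (real n - 1) / 3 + R" by (simp add: R_def)
    have f: "(real n)\<^sup>2 - 1 = (real n - 1) * (real n + 1)" by (simp add: power2_eq_square algebra_simps)
    show ?thesis
      unfolding rs J f by (rule alg[OF n2])
  qed
  ultimately have eq: "(sqrt n * rank_stat n w - (- 3 / sqrt n) * ?K)\<^sup>2 =
      n * (1 / (real n + 1) - 3 * (R + ?K / n) / ((real n)\<^sup>2 - 1))\<^sup>2"
    by (simp add: power_mult_distrib)
  have "\<bar>1 / (real n + 1) - 3 * (R + ?K / n) / ((real n)\<^sup>2 - 1)\<bar> \<le> 1 / n + 4 * (\<bar>?D\<bar> + 6 * n) / (real n)\<^sup>2"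
  proof -
    have "\<bar>?K / n\<bar> \<le> 1" using K n2 by (simp add: divide_simps)
    then have "\<bar>R + ?K / n\<bar> \<le> \<bar>?D\<bar> + 6 * n" using R n2 by linarith
    then have "3 * \<bar>R + ?K / n\<bar> / ((real n)\<^sup>2 - 1) \<le> 3 * (\<bar>?D\<bar> + 6 * n) / (3 / 4 * (real n)\<^sup>2)"
      using sq pos n2 by (intro frac_le mult_left_mono) auto
    moreover have "\<bar>3 * (R + ?K / n) / ((real n)\<^sup>2 - 1)\<bar> = 3 * \<bar>R + ?K / n\<bar> / ((real n)\<^sup>2 - 1)"
      using pos unfolding abs_divide abs_mult by simp
    moreover have "3 * (\<bar>?D\<bar> + 6 * n) / (3 / 4 * (real n)\<^sup>2) = 4 * (\<bar>?D\<bar> + 6 * n) / (real n)\<^sup>2"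
    proof -
      have "3 * x / (3 / 4 * y) = 4 * x / y" for x y :: real by (simp add: field_simps)
      then show ?thesis .
    qed
    moreover have "\<bar>1 / (real n + 1)\<bar> \<le> 1 / real n" using n2 by (simp add: divide_simps)
    ultimately show ?thesis
      by (intro order_trans[OF abs_triangle_ineq4 add_mono]) auto
  qed
  \<comment> \<open>The 25 is 1 from the centring plus 4 * 6 from the linear part of the remainder.
    Squaring with (a + b)^2 \<le> 2 a^2 + 2 b^2 then gives 1250 = 2 * 25^2 and 32 = 2 * 4^2.\<close>
  also have "\<dots> = (25 * n + 4 * \<bar>?D\<bar>) / (real n)\<^sup>2"
    using n2 by (simp add: field_simps power2_eq_square)
  finally have "(1 / (real n + 1) - 3 * (R + ?K / n) / ((real n)\<^sup>2 - 1))\<^sup>2 \<le> ((25 * n + 4 * \<bar>?D\<bar>) / (real n)\<^sup>2)\<^sup>2"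
    using n2 by (simp add: abs_le_square_iff[symmetric])
  also have "\<dots> \<le> (1250 * (real n)\<^sup>2 + 32 * ?D\<^sup>2) / real n ^ 4"
  proof -
    have "0 \<le> (25 * n - 4 * \<bar>?D\<bar>)\<^sup>2" by simp
    then have "(25 * n + 4 * \<bar>?D\<bar>)\<^sup>2 \<le> 1250 * (real n)\<^sup>2 + 32 * ?D\<^sup>2"
      by (simp add: power2_eq_square algebra_simps)
    moreover have "((25 * n + 4 * \<bar>?D\<bar>) / (real n)\<^sup>2)\<^sup>2 = (25 * n + 4 * \<bar>?D\<bar>)\<^sup>2 / real n ^ 4"
      by (simp add: power_divide flip: power_mult)
    ultimately show ?thesis by (simp add: divide_right_mono)
  qed
  finally show ?thesis
    unfolding eq using n2 mult_left_mono[of _ "(1250 * (real n)\<^sup>2 + 32 * ?D\<^sup>2) / real n ^ 4" "real n"]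
    by (simp add: eval_nat_numeral)
qed

section \<open>Level of the tilted rank test\<close>

lemma measurable_crossing:
  assumes [measurable]: "f \<in> borel_measurable M" "g \<in> borel_measurable M" "h \<in> borel_measurable M"
  shows "(\<lambda>x. crossing (f x) (g x) (h x)) \<in> borel_measurable M"
  unfolding crossing_def by measurable

lemma bounded_measurable_rank_stat: "bounded_measurable (unif_sample n) (rank_stat n)"
proof -
  have "bounded_measurable (unif_sample n)
      (\<lambda>w. 1 - 3 * (\<Sum>i<n - 1. \<Sum>j<n. crossing (w i) (w (Suc i)) (w j)) / ((real n)\<^sup>2 - 1))"
  proof (intro bounded_measurable_intros)
    fix i j assume "i \<in> {..<n - 1}" "j \<in> {..<n}"
    then show "bounded_measurable (unif_sample n) (\<lambda>w. crossing (w i) (w (Suc i)) (w j))"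
      by (intro bounded_measurableI[where C=2] measurable_crossing) (auto simp: crossing_def)
  qed
  then show ?thesis
    unfolding rank_stat_def rank_diff_eq_sum_crossing .
qed

lemma bounded_measurable_kappa_sum: "bounded_measurable (unif_sample n) (kappa_sum n)"
  unfolding kappa_sum_def
  by (intro bounded_measurable_sum bounded_measurable_kappa)
    (auto intro!: space_unif_sampleD[THEN conjunct1] space_unif_sampleD[THEN conjunct2])

lemma bounded_measurable_residual_sum: "bounded_measurable (unif_sample n) (residual_sum n)"
  unfolding residual_sum_def case_prod_unfold
  by (intro bounded_measurable_sum bounded_measurable_crossing_residual_coord)
    (auto simp: off_diagonal_def)

text \<open>The constant is 1250 + 32 * 28, with 28 from the second moment of the residual
  sum.\<close>

lemma rank_stat_kappa_sum_L2:
  assumes "2 \<le> n"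
  shows "(\<integral>w. (sqrt n * rank_stat n w - (- 3 / sqrt n) * kappa_sum n w)\<^sup>2 \<partial>unif_sample n) \<le> 2146 / n"
proof -
  note bmi = bounded_measurable_intros bounded_measurable_rank_stat bounded_measurable_kappa_sum
    bounded_measurable_residual_sum
  note int = unif_sample.integrable_bounded_measurable
  have "(\<integral>w. (sqrt n * rank_stat n w - (- 3 / sqrt n) * kappa_sum n w)\<^sup>2 \<partial>unif_sample n)
      \<le> (\<integral>w. (1250 * (real n)\<^sup>2 + 32 * (residual_sum n w)\<^sup>2) / real n ^ 3 \<partial>unif_sample n)"
    using assms by (intro integral_mono int bmi rank_stat_approx) (auto dest: space_unif_sampleD)
  also have "\<dots> = (1250 * (real n)\<^sup>2 + 32 * (\<integral>w. (residual_sum n w)\<^sup>2 \<partial>unif_sample n)) / real n ^ 3"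
  proof -
    have "integrable (unif_sample n) (\<lambda>w. 32 * (residual_sum n w)\<^sup>2)" by (intro int bmi)
    then show ?thesis by (simp add: unif_sample.prob_space)
  qed
  also have "\<dots> \<le> (1250 * (real n)\<^sup>2 + 32 * (28 * (real n)\<^sup>2)) / real n ^ 3"
    by (intro divide_right_mono add_left_mono mult_left_mono second_moment_residual_sum) auto
  also have "\<dots> = 2146 / n"
    using assms by (simp add: eval_nat_numeral)
  finally show ?thesis .
qed

section \<open>Tilted samples and their likelihood ratios\<close>

definition tilt :: "nat \<Rightarrow> (nat \<Rightarrow> real \<Rightarrow> real) \<Rightarrow> (nat \<Rightarrow> real) \<Rightarrow> real" where
  "tilt n \<beta> w = (\<Prod>j<n. 1 + \<beta> j (w j))"

definition tilted_sample :: "nat \<Rightarrow> (nat \<Rightarrow> real \<Rightarrow> real) \<Rightarrow> (nat \<Rightarrow> real) measure" where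
  "tilted_sample n \<beta> = density (unif_sample n) (\<lambda>w. ennreal (tilt n \<beta> w))"

locale tilt_family =
  fixes n :: nat and \<beta> :: "nat \<Rightarrow> real \<Rightarrow> real"
  assumes measurable_tilt [measurable]: "\<And>j. \<beta> j \<in> borel_measurable unif01"
    and abs_tilt_le: "\<And>j u. 0 < u \<Longrightarrow> u < 1 \<Longrightarrow> \<bar>\<beta> j u\<bar> \<le> 1"
    and integral_tilt: "\<And>j. (\<integral>u. \<beta> j u \<partial>unif01) = 0"
begin

text \<open>With \<open>s = 0\<close> the phases are 1 and products of \<open>factor\<close> are the
  likelihood itself, so its nonnegativity and its total mass are inherited.\<close>

sublocale tilted_array n \<beta> 0 1
  by standard (use measurable_tilt abs_tilt_le integral_tilt in auto)

lemma bounded_measurable_tilt: "bounded_measurable (unif_sample n) (tilt n \<beta>)"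
  unfolding tilt_def by (intro bounded_measurable_intros bounded_measurable_beta) auto

lemma tilt_nonneg: "w \<in> space (unif_sample n) \<Longrightarrow> 0 \<le> tilt n \<beta> w"
  unfolding tilt_def by (intro prod_nonneg) (auto intro: one_plus_beta_nonneg)

lemma integral_tilted_sample:
  fixes f :: "(nat \<Rightarrow> real) \<Rightarrow> 'b::{banach, second_countable_topology}"
  assumes "f \<in> borel_measurable (unif_sample n)"
  shows "(\<integral>w. f w \<partial>tilted_sample n \<beta>) = (\<integral>w. tilt n \<beta> w *\<^sub>R f w \<partial>unif_sample n)"
  unfolding tilted_sample_def using assms bounded_measurableD[OF bounded_measurable_tilt] tilt_nonneg
  by (intro integral_density) auto

lemma integral_tilt_eq_1: "(\<integral>w. tilt n \<beta> w \<partial>unif_sample n) = 1"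
proof -
  have "(\<integral>w. tilt n \<beta> w \<partial>unif_sample n) = (\<integral>w. cmod (\<Prod>j<n. factor j w) \<partial>unif_sample n)"
    by (intro Bochner_Integration.integral_cong)
      (auto simp: tilt_def norm_factor prod_norm[symmetric] intro!: prod.cong)
  then show ?thesis by (simp add: integral_norm_prod_factor)
qed

lemma prob_space_tilted_sample: "prob_space (tilted_sample n \<beta>)"
proof
  have "emeasure (tilted_sample n \<beta>) (space (tilted_sample n \<beta>)) = (\<integral>\<^sup>+w. ennreal (tilt n \<beta> w) \<partial>unif_sample n)"
    using bounded_measurableD[OF bounded_measurable_tilt]
    by (auto simp: tilted_sample_def emeasure_density intro!: nn_integral_cong)
  also have "\<dots> = ennreal (\<integral>w. tilt n \<beta> w \<partial>unif_sample n)"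
    by (intro nn_integral_eq_integral unif_sample.integrable_bounded_measurable bounded_measurable_tilt)
      (auto simp: tilt_nonneg)
  finally show "emeasure (tilted_sample n \<beta>) (space (tilted_sample n \<beta>)) = 1"
    by (simp add: integral_tilt_eq_1)
qed

text \<open>Each coordinate contributes 1 + E \<beta>^2 \<le> 1 + D^2/n \<le> exp(D^2/n). The bound
  is uniform in \<open>n\<close> and transfers errors that are small in L2 under independence to the
  tilted law.\<close>

lemma integral_tilt_sq_le:
  assumes D: "\<And>j u. 0 < u \<Longrightarrow> u < 1 \<Longrightarrow> \<bar>\<beta> j u\<bar> \<le> D / sqrt n" and n: "0 < n"
  shows "(\<integral>w. (tilt n \<beta> w)\<^sup>2 \<partial>unif_sample n) \<le> exp (D\<^sup>2)"
proof -
  interpret product_sigma_finite "\<lambda>_::nat. unif01" by standard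
  note bm = bounded_measurable_beta1
  have i: "integrable unif01 (\<lambda>u. (1 + \<beta> j u)\<^sup>2)" for j
    by (intro unif01.integrable_bounded_measurable bounded_measurable_intros bm)
  have "(\<integral>w. (tilt n \<beta> w)\<^sup>2 \<partial>unif_sample n) = (\<integral>w. (\<Prod>j<n. (1 + \<beta> j (w j))\<^sup>2) \<partial>unif_sample n)"
    by (simp add: tilt_def prod_power_distrib)
  also have "\<dots> = (\<Prod>j<n. \<integral>u. (1 + \<beta> j u)\<^sup>2 \<partial>unif01)"
    unfolding unif_sample_def by (intro product_integral_prod i) auto
  also have "\<dots> \<le> (\<Prod>j<n. exp (D\<^sup>2 / n))"
  proof (intro prod_mono conjI)
    fix j
    show "0 \<le> (\<integral>u. (1 + \<beta> j u)\<^sup>2 \<partial>unif01)" by simp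
    have i1: "integrable unif01 (\<beta> j)" "integrable unif01 (\<lambda>u. (\<beta> j u)\<^sup>2)"
      by (intro unif01.integrable_bounded_measurable bounded_measurable_intros bm)+
    have "(\<integral>u. (1 + \<beta> j u)\<^sup>2 \<partial>unif01) = (\<integral>u. 1 + 2 * \<beta> j u + (\<beta> j u)\<^sup>2 \<partial>unif01)"
      by (simp add: power2_eq_square algebra_simps)
    also have "\<dots> = 1 + (\<integral>u. (\<beta> j u)\<^sup>2 \<partial>unif01)"
      using i1 integral_beta by simp
    also have "(\<integral>u. (\<beta> j u)\<^sup>2 \<partial>unif01) \<le> (\<integral>u. D\<^sup>2 / n \<partial>unif01)"
    proof (intro integral_mono i1)
      fix u assume "u \<in> space unif01"
      then have "\<bar>\<beta> j u\<bar> \<le> D / sqrt n" using D by auto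
      then have "\<bar>\<beta> j u\<bar>\<^sup>2 \<le> (D / sqrt n)\<^sup>2" by (intro power_mono) auto
      then show "(\<beta> j u)\<^sup>2 \<le> D\<^sup>2 / n" by (simp add: power_divide)
    qed auto
    also have "1 + (\<integral>u. D\<^sup>2 / n \<partial>unif01) \<le> exp (D\<^sup>2 / n)"
      using exp_ge_add_one_self by simp
    finally show "(\<integral>u. (1 + \<beta> j u)\<^sup>2 \<partial>unif01) \<le> exp (D\<^sup>2 / n)" by simp
  qed
  also have "\<dots> = exp (D\<^sup>2)"
    using n by (simp flip: exp_of_nat_mult)
  finally show ?thesis .
qed

end

lemma (in tilted_array) prod_factor_eq:
  "(\<Prod>j<Suc m. factor j w) = tilt (Suc m) \<beta> w * iexp (s * (\<Sum>i<m. kappa (w i) (w (Suc i))))"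
proof (induction m)
  case 0
  then show ?case by (simp add: tilt_def)
next
  case (Suc m)
  have "(\<Prod>j<Suc (Suc m). factor j w) = (\<Prod>j<Suc m. factor j w) * factor (Suc m) w"
    by simp
  also have "\<dots> = tilt (Suc m) \<beta> w * iexp (s * (\<Sum>i<m. kappa (w i) (w (Suc i)))) *
      ((1 + \<beta> (Suc m) (w (Suc m))) * iexp (s * kappa (w m) (w (Suc m))))"
    unfolding Suc by simp
  also have "\<dots> = tilt (Suc (Suc m)) \<beta> w * (iexp (s * (\<Sum>i<m. kappa (w i) (w (Suc i)))) * iexp (s * kappa (w m) (w (Suc m))))"
    by (simp add: tilt_def)
  also have "\<dots> = tilt (Suc (Suc m)) \<beta> w * iexp (s * (\<Sum>i<Suc m. kappa (w i) (w (Suc i))))"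
    by (simp add: exp_add[symmetric] algebra_simps)
  finally show ?case .
qed

section \<open>The normal limit under tilts\<close>

lemma iexp_diff_le: "cmod (iexp x - iexp y) \<le> \<bar>x - y\<bar>"
proof -
  have "iexp x - iexp y = iexp y * (iexp (x - y) - 1)"
    by (simp add: exp_diff algebra_simps)
  then show ?thesis
    using iexp_approx_quadratic(3)[of "x - y"] by (simp add: norm_mult)
qed

text \<open>By Levy continuity it suffices to follow characteristic functions. Two errors occur,
  both O(n^(-1/2)): replacing the statistic by the kernel sum, and replacing the characteristic
  function of that sum by a power of 1 - t^2/(2n). The tilts enter through their size bound alone,
  so they may vary with \<open>n\<close> in any way.\<close>

lemma std_normal_tilted_limit:
  fixes \<beta> :: "nat \<Rightarrow> nat \<Rightarrow> real \<Rightarrow> real"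
  assumes tilt: "\<And>n. tilt_family (\<beta> n)"
    and D: "\<And>n j u. 0 < u \<Longrightarrow> u < 1 \<Longrightarrow> \<bar>\<beta> n j u\<bar> \<le> D / sqrt n"
  shows "weak_conv_m (\<lambda>n. distr (tilted_sample n (\<beta> n)) borel (\<lambda>w. sqrt n * rank_stat n w / (3 * sqrt tau)))
    std_normal_distribution"
proof (rule levy_continuity)
  interpret tilt_family n "\<beta> n" for n by (rule tilt)
  have meas [measurable]: "rank_stat n \<in> borel_measurable (unif_sample n)" for n
    by (rule bounded_measurableD[OF bounded_measurable_rank_stat])
  have meas': "(\<lambda>w. sqrt n * rank_stat n w / (3 * sqrt tau)) \<in> borel_measurable (tilted_sample n (\<beta> n))" for n
    unfolding tilted_sample_def by simp
  show "real_distribution (distr (tilted_sample n (\<beta> n)) borel (\<lambda>w. sqrt n * rank_stat n w / (3 * sqrt tau)))" for n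
    using prob_space.prob_space_distr[OF prob_space_tilted_sample meas']
    by (simp add: real_distribution_def real_distribution_axioms_def)
  show "real_distribution std_normal_distribution" by (rule real_dist_normal_dist)
  fix t :: real
  define a where "a = t / (3 * sqrt tau)"
  have a: "9 * a\<^sup>2 * tau = t\<^sup>2"
    using tau_bounds by (simp add: a_def power_divide power_mult_distrib)
  \<comment> \<open>Chosen so that C / sqrt n dominates both the tilts and the argument -3a / sqrt n
    of the kernel sum.\<close>
  define C where "C = max \<bar>D\<bar> (3 * \<bar>a\<bar>)"
  define \<psi> where "\<psi> n = (\<integral>w. tilt n (\<beta> n) w *\<^sub>R iexp (a * ((- 3 / sqrt n) * kappa_sum n w)) \<partial>unif_sample n)" for n
  note bmi = bounded_measurable_intros bounded_measurable_rank_stat bounded_measurable_kappa_sum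
    bounded_measurable_tilt bounded_measurable_iexp
  note int = unif_sample.integrable_bounded_measurable
  have char_eq: "char (distr (tilted_sample n (\<beta> n)) borel (\<lambda>w. sqrt n * rank_stat n w / (3 * sqrt tau))) t
      = (\<integral>w. tilt n (\<beta> n) w *\<^sub>R iexp (a * (sqrt n * rank_stat n w)) \<partial>unif_sample n)" for n
    unfolding char_def
    by (subst integral_distr[OF meas']) (auto simp: integral_tilted_sample a_def mult_ac)
  have step1: "cmod ((\<integral>w. tilt n (\<beta> n) w *\<^sub>R iexp (a * (sqrt n * rank_stat n w)) \<partial>unif_sample n) - \<psi> n)
      \<le> \<bar>a\<bar> * (exp (D\<^sup>2) + 2146) / sqrt n" if n: "2 \<le> n" for n
  proof -
    let ?W = "\<lambda>w. sqrt n * rank_stat n w - (- 3 / sqrt n) * kappa_sum n w"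
    let ?L = "tilt n (\<beta> n)"
    have bmW: "bounded_measurable (unif_sample n) ?W" by (intro bmi)
    have bm1: "bounded_measurable (unif_sample n) (\<lambda>w. ?L w *\<^sub>R iexp (a * (sqrt n * rank_stat n w)))"
      and bm2: "bounded_measurable (unif_sample n) (\<lambda>w. ?L w *\<^sub>R iexp (a * ((- 3 / sqrt n) * kappa_sum n w)))"
      unfolding scaleR_conv_of_real
      by (intro bmi bounded_measurableD; fail)+
    have "cmod ((\<integral>w. ?L w *\<^sub>R iexp (a * (sqrt n * rank_stat n w)) \<partial>unif_sample n) - \<psi> n)
        = cmod (\<integral>w. ?L w *\<^sub>R iexp (a * (sqrt n * rank_stat n w)) - ?L w *\<^sub>R iexp (a * ((- 3 / sqrt n) * kappa_sum n w)) \<partial>unif_sample n)"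
      unfolding \<psi>_def by (subst Bochner_Integration.integral_diff[OF int[OF bm1] int[OF bm2]]) (rule refl)
    also have "\<dots> \<le> (\<integral>w. \<bar>a\<bar> * ((?L w)\<^sup>2 / sqrt n + sqrt n * (?W w)\<^sup>2) \<partial>unif_sample n)"
    proof (rule order_trans[OF integral_norm_bound integral_mono])
      show "integrable (unif_sample n) (\<lambda>w. cmod (?L w *\<^sub>R iexp (a * (sqrt n * rank_stat n w)) - ?L w *\<^sub>R iexp (a * ((- 3 / sqrt n) * kappa_sum n w))))"
        by (intro int bounded_measurable_norm bounded_measurable_diff bm1 bm2)
      show "integrable (unif_sample n) (\<lambda>w. \<bar>a\<bar> * ((?L w)\<^sup>2 / sqrt n + sqrt n * (?W w)\<^sup>2))"
        by (intro int bmi bmW)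
      fix w assume w: "w \<in> space (unif_sample n)"
      have "cmod (?L w *\<^sub>R iexp (a * (sqrt n * rank_stat n w)) - ?L w *\<^sub>R iexp (a * ((- 3 / sqrt n) * kappa_sum n w)))
          = ?L w * cmod (iexp (a * (sqrt n * rank_stat n w)) - iexp (a * ((- 3 / sqrt n) * kappa_sum n w)))"
        using tilt_nonneg[OF w] by (simp only: scaleR_diff_right[symmetric] norm_scaleR abs_of_nonneg)
      also have "\<dots> \<le> ?L w * \<bar>a * (sqrt n * rank_stat n w) - a * ((- 3 / sqrt n) * kappa_sum n w)\<bar>"
        by (intro mult_left_mono iexp_diff_le tilt_nonneg[OF w])
      also have "\<dots> = \<bar>a\<bar> * (?L w * \<bar>?W w\<bar>)"
        unfolding right_diff_distrib[symmetric] abs_mult by simp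
      also have "\<dots> \<le> \<bar>a\<bar> * ((?L w)\<^sup>2 / sqrt n + sqrt n * (?W w)\<^sup>2)"
      proof (intro mult_left_mono)
        \<comment> \<open>Arithmetic-geometric mean inequality with weight r^2 = sqrt n: the
          likelihood has bounded second moment and \<open>?W\<close> has second moment O(1/n), so
          both summands become O(n^(-1/2)).\<close>
        define r where "r = sqrt (sqrt n)"
        have r: "0 < r" "r\<^sup>2 = sqrt n" using n by (auto simp: r_def)
        have "2 * (?L w / r) * (r * \<bar>?W w\<bar>) \<le> (?L w / r)\<^sup>2 + (r * \<bar>?W w\<bar>)\<^sup>2"
          by (rule sum_squares_bound)
        also have "\<dots> = (?L w)\<^sup>2 / sqrt n + sqrt n * (?W w)\<^sup>2"
          by (simp only: power_divide power_mult_distrib r power2_abs)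
        also have "2 * (?L w / r) * (r * \<bar>?W w\<bar>) = 2 * (?L w * \<bar>?W w\<bar>)"
          using r by simp
        finally have "2 * (?L w * \<bar>?W w\<bar>) \<le> (?L w)\<^sup>2 / sqrt n + sqrt n * (?W w)\<^sup>2" .
        moreover have "0 \<le> ?L w * \<bar>?W w\<bar>" using tilt_nonneg[OF w] by simp
        ultimately show "?L w * \<bar>?W w\<bar> \<le> (?L w)\<^sup>2 / sqrt n + sqrt n * (?W w)\<^sup>2" by linarith
      qed simp
      finally show "cmod (?L w *\<^sub>R iexp (a * (sqrt n * rank_stat n w)) - ?L w *\<^sub>R iexp (a * ((- 3 / sqrt n) * kappa_sum n w)))
        \<le> \<bar>a\<bar> * ((?L w)\<^sup>2 / sqrt n + sqrt n * (?W w)\<^sup>2)" .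
    qed
    also have "\<dots> = \<bar>a\<bar> * ((\<integral>w. (?L w)\<^sup>2 \<partial>unif_sample n) / sqrt n + sqrt n * (\<integral>w. (?W w)\<^sup>2 \<partial>unif_sample n))"
    proof -
      have "integrable (unif_sample n) (\<lambda>w. (?L w)\<^sup>2 / sqrt n)" "integrable (unif_sample n) (\<lambda>w. sqrt n * (?W w)\<^sup>2)"
        by (intro int bmi bmW)+
      then show ?thesis
        by (subst integral_mult_right_zero, subst Bochner_Integration.integral_add) simp_all
    qed
    also have "\<dots> \<le> \<bar>a\<bar> * (exp (D\<^sup>2) / sqrt n + sqrt n * (2146 / n))"
      using n by (intro mult_left_mono add_mono divide_right_mono integral_tilt_sq_le rank_stat_kappa_sum_L2 D) auto
    also have "\<dots> = \<bar>a\<bar> * (exp (D\<^sup>2) + 2146) / sqrt n"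
    proof -
      have "sqrt n * (2146 / n) = 2146 / sqrt n"
        using n by (simp add: field_simps)
      then show ?thesis by (simp add: add_divide_distrib distrib_left)
    qed
    finally show ?thesis .
  qed
  \<comment> \<open>A sample of size \<open>Suc m\<close> has \<open>m\<close> adjacent pairs, hence
    the exponent \<open>m\<close>.\<close>
  have step2: "cmod (\<psi> (Suc m) - of_real ((1 - t\<^sup>2 / 2 / Suc m) ^ m)) \<le> 9 * C ^ 3 / sqrt (Suc m)"
    if large: "C \<le> sqrt (Suc m)" for m
  proof -
    let ?n = "Suc m" and ?s = "- 3 * a / sqrt (Suc m)"
    interpret A: tilted_array ?n "\<beta> ?n" ?s "C / sqrt ?n"
    proof
      show "\<bar>\<beta> ?n j u\<bar> \<le> C / sqrt ?n" if "0 < u" "u < 1" for j u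
        by (rule order_trans[OF D[OF that]]) (auto simp: C_def intro!: divide_right_mono)
      show "\<bar>?s\<bar> \<le> C / sqrt ?n"
        by (simp add: C_def abs_mult divide_right_mono)
      show "C / sqrt ?n \<le> 1" using large by simp
    qed (use integral_tilt measurable_tilt in auto)
    have eq: "\<psi> ?n = A.partial_charfun ?n"
      unfolding \<psi>_def A.partial_charfun_def A.prod_factor_eq scaleR_conv_of_real kappa_sum_def
      by (simp add: mult_ac)
    have "?s\<^sup>2 * tau / 2 = (9 * a\<^sup>2 * tau) / 2 / ?n"
      by (simp add: power_divide power_mult_distrib)
    then have s: "?s\<^sup>2 * tau / 2 = t\<^sup>2 / 2 / ?n" unfolding a .
    have "cmod (\<psi> ?n - of_real ((1 - t\<^sup>2 / 2 / ?n) ^ m)) \<le> m * (9 * (C / sqrt ?n) ^ 3)"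
      using A.partial_charfun_approx[of m] unfolding eq s by simp
    also have "\<dots> \<le> ?n * (9 * (C / sqrt ?n) ^ 3)"
      using A.eta_nonneg by (intro mult_right_mono) auto
    also have "\<dots> = 9 * C ^ 3 / sqrt ?n"
    proof -
      have "?n * (9 * (C / r) ^ 3) = 9 * C ^ 3 / r" if "r * r = ?n" "r > 0" for r :: real
        using that(2) unfolding that(1)[symmetric] by (simp add: field_simps eval_nat_numeral)
      from this[of "sqrt ?n"] show ?thesis by simp
    qed
    finally show ?thesis .
  qed
  have "(\<lambda>m. \<psi> (Suc m) - of_real ((1 - t\<^sup>2 / 2 / Suc m) ^ m)) \<longlonglongrightarrow> 0"
  proof (rule Lim_null_comparison)
    have "filterlim (\<lambda>m. sqrt (Suc m)) at_top sequentially"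
      by (intro filterlim_compose[OF sqrt_at_top] filterlim_compose[OF filterlim_real_sequentially filterlim_Suc])
    then have "\<forall>\<^sub>F m in sequentially. C \<le> sqrt (Suc m)"
      by (simp only: filterlim_at_top)
    then show "\<forall>\<^sub>F m in sequentially. norm (\<psi> (Suc m) - of_real ((1 - t\<^sup>2 / 2 / Suc m) ^ m)) \<le> 9 * C ^ 3 / sqrt (Suc m)"
      by eventually_elim (rule step2)
    show "(\<lambda>m. 9 * C ^ 3 / sqrt (Suc m)) \<longlonglongrightarrow> 0"
      by (rule tendsto_divide_0[OF tendsto_const])
        (intro filterlim_at_top_imp_at_infinity filterlim_compose[OF sqrt_at_top] filterlim_compose[OF filterlim_real_sequentially filterlim_Suc])
  qed
  moreover have "(\<lambda>m. complex_of_real ((1 - t\<^sup>2 / 2 / Suc m) ^ m)) \<longlonglongrightarrow> of_real (exp (- (t\<^sup>2 / 2)))"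
  proof (intro tendsto_of_real)
    let ?x = "- (t\<^sup>2 / 2)"
    have lim0: "(\<lambda>m. 1 + ?x / Suc m) \<longlonglongrightarrow> 1 + 0"
      by (intro tendsto_intros tendsto_divide_0[OF tendsto_const] filterlim_at_top_imp_at_infinity
          filterlim_compose[OF filterlim_real_sequentially filterlim_Suc])
    \<comment> \<open>One factor is divided out, since the exponent is one less than the sample
      size; that factor tends to 1.\<close>
    have "(\<lambda>m. (1 + ?x / Suc m) ^ Suc m / (1 + ?x / Suc m)) \<longlonglongrightarrow> exp ?x / (1 + 0)"
      using lim0 by (intro tendsto_divide LIMSEQ_Suc[OF tendsto_exp_limit_sequentially]) auto
    moreover have "\<forall>\<^sub>F m in sequentially. (1 + ?x / Suc m) ^ Suc m / (1 + ?x / Suc m) = (1 - t\<^sup>2 / 2 / Suc m) ^ m"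
    proof -
      have "\<forall>\<^sub>F m in sequentially. 0 < 1 + ?x / Suc m"
        using lim0 by (intro order_tendstoD) auto
      then show ?thesis by eventually_elim simp
    qed
    ultimately show "(\<lambda>m. (1 - t\<^sup>2 / 2 / Suc m) ^ m) \<longlonglongrightarrow> exp ?x"
      using tendsto_cong by force
  qed
  ultimately have "(\<lambda>m. \<psi> (Suc m)) \<longlonglongrightarrow> of_real (exp (- (t\<^sup>2 / 2)))"
    using tendsto_add by force
  then have psi: "\<psi> \<longlonglongrightarrow> of_real (exp (- (t\<^sup>2 / 2)))"
    by (rule LIMSEQ_imp_Suc)
  have "(\<lambda>n. (\<integral>w. tilt n (\<beta> n) w *\<^sub>R iexp (a * (sqrt n * rank_stat n w)) \<partial>unif_sample n) - \<psi> n) \<longlonglongrightarrow> 0"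
  proof (rule Lim_null_comparison)
    show "\<forall>\<^sub>F n in sequentially. norm ((\<integral>w. tilt n (\<beta> n) w *\<^sub>R iexp (a * (sqrt n * rank_stat n w)) \<partial>unif_sample n) - \<psi> n)
        \<le> \<bar>a\<bar> * (exp (D\<^sup>2) + 2146) / sqrt n"
      using eventually_ge_at_top[of 2] by eventually_elim (rule step1)
    show "(\<lambda>n. \<bar>a\<bar> * (exp (D\<^sup>2) + 2146) / sqrt n) \<longlonglongrightarrow> 0"
      by (rule tendsto_divide_0[OF tendsto_const])
        (intro filterlim_at_top_imp_at_infinity filterlim_compose[OF sqrt_at_top filterlim_real_sequentially])
  qed
  from tendsto_add[OF this psi]
  show "(\<lambda>n. char (distr (tilted_sample n (\<beta> n)) borel (\<lambda>w. sqrt n * rank_stat n w / (3 * sqrt tau))) t)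
      \<longlonglongrightarrow> char std_normal_distribution t"
    unfolding char_eq by (simp add: char_std_normal_distribution)
qed

text \<open>The thresholds need not converge. Because the limit law has no atoms, it has exact
  quantiles at levels slightly below and above 1 - \<alpha>; the level under \<mu> forces the
  thresholds between them, and the distribution functions of \<nu> converge at both.\<close>

lemma upper_tail_limit_transfer:
  fixes \<mu> \<nu> :: "nat \<Rightarrow> real measure" and N :: "real measure"
  assumes mu: "\<And>n. real_distribution (\<mu> n)" and nu: "\<And>n. real_distribution (\<nu> n)"
    and N: "real_distribution N" and cont: "\<And>x. measure N {x} = 0"
    and mu_conv: "weak_conv_m \<mu> N" and nu_conv: "weak_conv_m \<nu> N"
    and level: "(\<lambda>n. measure (\<mu> n) {t n..}) \<longlonglongrightarrow> \<alpha>" and alpha: "0 < \<alpha>" "\<alpha> < 1"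
  shows "(\<lambda>n. measure (\<nu> n) {t n..}) \<longlonglongrightarrow> \<alpha>"
proof -
  interpret mu: real_distribution "\<mu> n" for n by (rule mu)
  interpret nu: real_distribution "\<nu> n" for n by (rule nu)
  interpret N: real_distribution N by (rule N)
  have C: "isCont (cdf N) x" for x using N.isCont_cdf cont by simp
  have mu_cdf: "(\<lambda>n. cdf (\<mu> n) x) \<longlonglongrightarrow> cdf N x" and nu_cdf: "(\<lambda>n. cdf (\<nu> n) x) \<longlonglongrightarrow> cdf N x" for x
    using mu_conv nu_conv C by (auto simp: weak_conv_m_def weak_conv_def)
  have quantile: "\<exists>x. cdf N x = p" if p: "0 < p" "p < 1" for p
  proof -
    have "\<forall>\<^sub>F x in at_bot. cdf N x < p" "\<forall>\<^sub>F x in at_top. p < cdf N x"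
      using p N.cdf_lim_at_bot N.cdf_lim_at_top_prob by (auto intro: order_tendstoD)
    then obtain x y where xy: "cdf N x < p" "p < cdf N y"
      by (metis eventually_at_bot_linorder eventually_at_top_linorder order_refl)
    then have "x \<le> y" using N.cdf_nondecreasing by (metis linorder_le_cases order.asym order_less_le_trans order_le_less_trans)
    then show ?thesis using IVT[of "cdf N" x p y] xy C by (auto intro: less_imp_le)
  qed
  have tail: "prob_space M \<Longrightarrow> sets M = sets borel \<Longrightarrow> measure M {x<..} = 1 - cdf M x" for M :: "real measure" and x
    using prob_space.prob_compl[of M "{..x}"] sets_eq_imp_space_eq[of M borel]
    by (simp add: cdf_def Compl_eq_Diff_UNIV[symmetric] Compl_atMost)
  show ?thesis
  proof (rule tendstoI)
    fix e0 :: real assume "0 < e0"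
    \<comment> \<open>This choice keeps 1 - \<alpha> - e and 1 - \<alpha> + e strictly between 0 and
      1, and makes the final deviation 2e at most \<open>e0\<close>.\<close>
    define e where "e = min (e0 / 2) (min (\<alpha> / 2) ((1 - \<alpha>) / 2))"
    have e: "0 < e" "e < \<alpha>" "e < 1 - \<alpha>" "2 * e \<le> e0"
      using \<open>0 < e0\<close> alpha by (auto simp: e_def min_def)
    obtain a b where a: "cdf N a = 1 - \<alpha> - e" and b: "cdf N b = 1 - \<alpha> + e"
      using quantile[of "1 - \<alpha> - e"] quantile[of "1 - \<alpha> + e"] e by auto
    have "\<forall>\<^sub>F n in sequentially. measure (\<mu> n) {t n..} < \<alpha> + e / 2"
      "\<forall>\<^sub>F n in sequentially. \<alpha> - e / 2 < measure (\<mu> n) {t n..}"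
      using level e by (auto intro: order_tendstoD)
    moreover have "\<forall>\<^sub>F n in sequentially. cdf (\<mu> n) a < 1 - \<alpha> - e / 2"
      "\<forall>\<^sub>F n in sequentially. cdf (\<nu> n) a > 1 - \<alpha> - 2 * e"
      using mu_cdf[of a] nu_cdf[of a] a e by (auto intro: order_tendstoD)
    moreover have "\<forall>\<^sub>F n in sequentially. cdf (\<mu> n) b > 1 - \<alpha> + e / 2"
      "\<forall>\<^sub>F n in sequentially. cdf (\<nu> n) b < 1 - \<alpha> + 2 * e"
      using mu_cdf[of b] nu_cdf[of b] b e by (auto intro: order_tendstoD)
    ultimately show "\<forall>\<^sub>F n in sequentially. dist (measure (\<nu> n) {t n..}) \<alpha> < e0"
    proof eventually_elim
      case (elim n)
      note tails = tail[OF mu.prob_space_axioms mu.events_eq_borel, of n] tail[OF nu.prob_space_axioms nu.events_eq_borel, of n]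
      \<comment> \<open>Otherwise the tail from \<open>t n\<close> would contain the tail beyond
        \<open>a\<close>, whose mass under \<mu> n exceeds \<alpha> + e/2, against the
        level.\<close>
      have "a < t n"
      proof (rule ccontr)
        assume "\<not> a < t n"
        then have "measure (\<mu> n) {a<..} \<le> measure (\<mu> n) {t n..}"
          by (intro mu.finite_measure_mono) auto
        then show False using elim tails by simp
      qed
      moreover have "t n \<le> b"
      proof (rule ccontr)
        assume "\<not> t n \<le> b"
        then have "measure (\<mu> n) {t n..} \<le> measure (\<mu> n) {b<..}"
          by (intro mu.finite_measure_mono) auto
        then show False using elim tails by simp
      qed
      ultimately have "measure (\<nu> n) {t n..} \<le> measure (\<nu> n) {a<..}" "measure (\<nu> n) {b<..} \<le> measure (\<nu> n) {t n..}"
        by (auto intro!: nu.finite_measure_mono)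
      then show ?case using elim tails e by (simp add: dist_real_def abs_less_iff)
    qed
  qed
qed

lemma measure_std_normal_singleton: "measure std_normal_distribution {x} = 0"
proof -
  have "emeasure std_normal_distribution {x} = 0"
    by (subst emeasure_density) (auto intro!: nn_integral_0_iff_AE[THEN iffD2] AE_I'[of "{x}"] split: split_indicator)
  then show ?thesis by (simp add: measure_def)
qed

text \<open>The null sample is the array with zero tilts, so both sequences are tails of laws with
  the same normal limit.\<close>

lemma tilted_rank_test_level:
  fixes \<beta> :: "nat \<Rightarrow> nat \<Rightarrow> real \<Rightarrow> real"
  assumes tilt: "\<And>n. tilt_family (\<beta> n)"
    and D: "\<And>n j u. 0 < u \<Longrightarrow> u < 1 \<Longrightarrow> \<bar>\<beta> n j u\<bar> \<le> D / sqrt n"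
    and level: "(\<lambda>n. measure (unif_sample n) {w \<in> space (unif_sample n). t n \<le> sqrt n * rank_stat n w}) \<longlonglongrightarrow> \<alpha>"
    and alpha: "0 < \<alpha>" "\<alpha> < 1"
  shows "(\<lambda>n. measure (tilted_sample n (\<beta> n)) {w \<in> space (unif_sample n). t n \<le> sqrt n * rank_stat n w}) \<longlonglongrightarrow> \<alpha>"
proof -
  let ?X = "\<lambda>n w. sqrt (real n) * rank_stat n w / (3 * sqrt tau)"
  let ?\<mu> = "\<lambda>\<beta> n. distr (tilted_sample n (\<beta> n)) borel (?X n)"
  have tilt0: "tilt_family (\<lambda>_ _. 0)" by standard auto
  have [measurable]: "rank_stat n \<in> borel_measurable (unif_sample n)" for n
    by (rule bounded_measurableD[OF bounded_measurable_rank_stat])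
  have X: "?X n \<in> borel_measurable (tilted_sample n b)" for n b
    unfolding tilted_sample_def by simp
  have rd: "real_distribution (?\<mu> b n)" if "tilt_family (b n)" for b n
    using prob_space.prob_space_distr[OF tilt_family.prob_space_tilted_sample[OF that] X]
    by (simp add: real_distribution_def real_distribution_axioms_def)
  have sp: "space (tilted_sample n b) = space (unif_sample n)" for n b
    by (simp add: tilted_sample_def)
  have meas: "measure (?\<mu> b n) {t n / (3 * sqrt tau)..} =
      measure (tilted_sample n (b n)) {w \<in> space (unif_sample n). t n \<le> sqrt n * rank_stat n w}" for b n
  proof -
    have "?X n -` {t n / (3 * sqrt tau)..} \<inter> space (tilted_sample n (b n)) = {w \<in> space (unif_sample n). t n \<le> sqrt n * rank_stat n w}"
      using tau_bounds by (auto simp: sp divide_le_cancel)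
    then show ?thesis by (subst measure_distr[OF X]) auto
  qed
  have null: "tilted_sample n (\<lambda>_ _. 0) = unif_sample n" for n
    by (simp add: tilted_sample_def tilt_def density_1)
  have "(\<lambda>n. measure (?\<mu> \<beta> n) {t n / (3 * sqrt tau)..}) \<longlonglongrightarrow> \<alpha>"
  proof (rule upper_tail_limit_transfer[where N=std_normal_distribution and \<mu>="?\<mu> (\<lambda>_ _ _. 0)"])
    show "weak_conv_m (?\<mu> \<beta>) std_normal_distribution"
      by (rule std_normal_tilted_limit[OF tilt D])
    show "weak_conv_m (?\<mu> (\<lambda>_ _ _. 0)) std_normal_distribution"
      by (rule std_normal_tilted_limit[OF tilt0, where D=0]) auto
    show "(\<lambda>n. measure (?\<mu> (\<lambda>_ _ _. 0) n) {t n / (3 * sqrt tau)..}) \<longlonglongrightarrow> \<alpha>"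
    proof -
      have *: "measure (?\<mu> (\<lambda>_ _ _. 0) n) {t n / (3 * sqrt tau)..} =
          measure (unif_sample n) {w \<in> space (unif_sample n). t n \<le> sqrt n * rank_stat n w}" for n
        using meas[of n "\<lambda>_ _ _. 0"] by (simp only: null)
      show ?thesis using level by (simp only: *)
    qed
  qed (use rd tilt tilt0 alpha measure_std_normal_singleton real_dist_normal_dist in auto)
  then show ?thesis unfolding meas .
qed

section \<open>Samples as functions of uniform variables\<close>

lemma prob_densityD:
  assumes "prob_density f"
  shows "f \<in> borel_measurable borel" "0 \<le> f z" "prob_space (density lborel (\<lambda>z. ennreal (f z)))"
  using assms by (auto simp: prob_density_def emeasure_density intro!: prob_spaceI)

text \<open>\<open>Q\<close> is the generalized inverse of the distribution function. A density
  makes that function continuous, hence a left inverse of \<open>Q\<close>. So \<open>Q\<close> is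
  injective and preserves ranks exactly, even if the distribution function has flat parts.\<close>

lemma quantile_function_exists:
  fixes g :: "real \<Rightarrow> real"
  assumes "prob_density g"
  obtains Q where "Q \<in> borel_measurable unif01" "distr unif01 borel Q = density lborel (\<lambda>y. ennreal (g y))"
    "\<And>u v. 0 < u \<Longrightarrow> u < v \<Longrightarrow> v < 1 \<Longrightarrow> Q u < Q v"
proof -
  let ?N = "density lborel (\<lambda>y. ennreal (g y))"
  interpret prob_space ?N by (rule prob_densityD[OF assms])
  interpret cdf_distribution ?N
    by standard auto
  have atomless: "measure ?N {x} = 0" for x
  proof -
    have "emeasure ?N {x} = 0"
      using prob_densityD(1)[OF assms]
      by (subst emeasure_density) (auto intro!: nn_integral_0_iff_AE[THEN iffD2] AE_I'[of "{x}"] split: split_indicator)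
    then show ?thesis by (simp add: measure_def)
  qed
  have inv: "C (I w) = w" if w: "0 < w" "w < 1" for w
  proof (rule antisym)
    show "w \<le> C (I w)" by (rule iffD2[OF pseudoinverse[OF w] order_refl])
    show "C (I w) \<le> w"
    proof (rule ccontr)
      assume "\<not> C (I w) \<le> w"
      then have above: "w < C (I w)" by linarith
      \<comment> \<open>Points left of \<open>I w\<close> have distribution function below
        \<open>w\<close>, and left continuity forbids a jump at \<open>I w\<close>.\<close>
      have "(C \<longlongrightarrow> C (I w)) (at_left (I w))"
      proof -
        have "isCont C (I w)" using isCont_cdf[THEN iffD2, OF atomless] .
        then show ?thesis unfolding isCont_def by (rule tendsto_within_subset) simp
      qed
      then have "\<forall>\<^sub>F x in at_left (I w). w < C x"
        using above by (rule order_tendstoD(1))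
      moreover have "\<forall>\<^sub>F x in at_left (I w). x < I w"
        by (simp only: eventually_at_filter lessThan_iff simp_thms eventually_True)
      ultimately have "\<forall>\<^sub>F x in at_left (I w). False"
      proof eventually_elim
        case (elim x)
        then show False using pseudoinverse[OF w, of x] by linarith
      qed
      then show False by simp
    qed
  qed
  show ?thesis
  proof
    have s: "sets unif01 = sets (restrict_space borel {0<..<1})"
      by (simp add: unif01_def sets_restrict_space)
    show "I \<in> borel_measurable unif01"
      using measurable_CI by (simp only: measurable_cong_sets[OF s refl])
    show "distr unif01 borel I = ?N"
      using distr_I_eq_M by (simp add: unif01_def)
    fix u v :: real assume uv: "0 < u" "u < v" "v < 1"
    then have "I u \<le> I v" using mono_I by (auto simp: mono_on_def)
    moreover have "I u \<noteq> I v" using inv[of u] inv[of v] uv by auto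
    ultimately show "I u < I v" by simp
  qed
qed

section \<open>Measurability of the statistic\<close>

lemma measurable_insort_key:
  fixes f :: "'s \<Rightarrow> 'i::countable \<Rightarrow> real"
  assumes [measurable]: "\<And>i. (\<lambda>s. f s i) \<in> borel_measurable M"
  shows "(\<lambda>s. insort_key (f s) a xs) \<in> M \<rightarrow>\<^sub>M count_space UNIV"
proof (induction xs)
  case (Cons x xs)
  then have [measurable]: "(\<lambda>s. x # insort_key (f s) a xs) \<in> M \<rightarrow>\<^sub>M count_space UNIV"
    by (rule measurable_compose) simp
  show ?case by simp
qed simp

lemma measurable_sort_key:
  fixes f :: "'s \<Rightarrow> 'i::countable \<Rightarrow> real"
  assumes "\<And>i. (\<lambda>s. f s i) \<in> borel_measurable M"
  shows "(\<lambda>s. sort_key (f s) xs) \<in> M \<rightarrow>\<^sub>M count_space UNIV"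
proof (induction xs)
  case (Cons x xs)
  have "(\<lambda>s. insort_key (f s) x (sort_key (f s) xs)) \<in> M \<rightarrow>\<^sub>M count_space UNIV"
    by (rule measurable_compose_countable[OF measurable_insort_key[OF assms] Cons])
  then show ?case by simp
qed simp

text \<open>The sorting order takes values in the countable set of lists. For a fixed list the
  statistic is built from finitely many comparisons of coordinates, and composition over countably
  many values combines these cases.\<close>

lemma measurable_chatterjee:
  assumes M: "sets M = sets (PiM {..<n} (\<lambda>_. borel :: (real \<times> real) measure))"
  shows "chatterjee n \<in> borel_measurable M"
proof -
  have sp: "space M = space (PiM {..<n} (\<lambda>_. borel :: (real \<times> real) measure))"
    by (rule sets_eq_imp_space_eq[OF M])
  have coord: "(\<lambda>s. s i) \<in> M \<rightarrow>\<^sub>M (borel :: (real \<times> real) measure)" for i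
  proof (cases "i < n")
    case True
    then show ?thesis unfolding measurable_cong_sets[OF M refl] by simp
  next
    \<comment> \<open>Outside the index set a coordinate is the constant \<open>undefined\<close>.
      It has to be covered, since the sorting lemma asks for measurability at every index.\<close>
    case False
    then have "s i = undefined" if "s \<in> space M" for s
      using that unfolding sp by (auto simp: space_PiM PiE_def extensional_def)
    then show ?thesis by (subst measurable_cong[where g="\<lambda>_. undefined"]) auto
  qed
  have [measurable]: "(\<lambda>s. fst (s i)) \<in> borel_measurable M" "(\<lambda>s. snd (s i)) \<in> borel_measurable M" for i
    using measurable_compose[OF coord[of i], of fst borel] measurable_compose[OF coord[of i], of snd borel]
    by (auto simp: borel_prod[symmetric])
  have order: "x_order n \<in> M \<rightarrow>\<^sub>M count_space UNIV"
    unfolding x_order_def by (rule measurable_sort_key) simp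
  have card_eq: "real (card {j \<in> {..<n}. snd (s j) \<le> c}) = (\<Sum>j<n. if snd (s j) \<le> c then 1 else 0)"
    for s :: "nat \<Rightarrow> real \<times> real" and c
    unfolding real_of_card by (rule sum.inter_filter) simp
  have "(\<lambda>s. 1 - 3 * (\<Sum>i<n - 1. \<bar>(\<Sum>j<n. if snd (s j) \<le> snd (s (xs ! Suc i)) then 1 else 0) -
      (\<Sum>j<n. if snd (s j) \<le> snd (s (xs ! i)) then 1 else 0)\<bar>) / ((real n)\<^sup>2 - 1)) \<in> borel_measurable M" for xs
    by measurable
  from measurable_compose_countable[OF this order]
  show ?thesis
    unfolding chatterjee_def[abs_def] y_rank_def card_eq .
qed

section \<open>Reduction to ranks of reordered uniform variables\<close>

lemma sort_key_cong_set: "(\<And>x. x \<in> set xs \<Longrightarrow> f x = g x) \<Longrightarrow> sort_key f xs = sort_key g xs"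
proof (induction xs)
  case (Cons a xs)
  have "insort_key f a ys = insort_key g a ys" if "set ys \<subseteq> set (a # xs)" for ys
    using that Cons.prems by (induction ys) auto
  then have "insort_key f a (sort_key g xs) = insort_key g a (sort_key g xs)"
    by (simp add: subset_insertI)
  moreover have "sort_key f xs = sort_key g xs"
    using Cons by simp
  ultimately show ?case by simp
qed simp

text \<open>The permutation that sorts \<open>x\<close>. Stability breaks ties by the index, so it
  is a bijection for every vector.\<close>

definition value_order :: "nat \<Rightarrow> (nat \<Rightarrow> real) \<Rightarrow> nat \<Rightarrow> nat" where
  "value_order n x i = sort_key x [0..<n] ! i"

lemma bij_betw_value_order: "bij_betw (value_order n x) {..<n} {..<n}"
  unfolding value_order_def by (rule bij_betw_nth) auto

text \<open>Strict monotonicity of \<open>Q\<close> preserves every comparison, and counting over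
  sorted positions is counting over all indices. The identity is pointwise and tolerates
  ties.\<close>

lemma chatterjee_eq_rank_stat:
  assumes Q: "\<And>u v. 0 < u \<Longrightarrow> u < v \<Longrightarrow> v < 1 \<Longrightarrow> Q u < Q v"
    and u: "\<And>i. i < n \<Longrightarrow> 0 < u i \<and> u i < 1"
  shows "chatterjee n (\<lambda>i\<in>{..<n}. (x i, Q (u i))) = rank_stat n (\<lambda>i\<in>{..<n}. u (value_order n x i))"
proof -
  let ?s = "\<lambda>i\<in>{..<n}. (x i, Q (u i) :: real)"
  let ?o = "value_order n x"
  have ord: "x_order n ?s ! i = ?o i" for i
    unfolding x_order_def value_order_def by (subst sort_key_cong_set[where g=x]) auto
  have lt: "?o i < n" if "i < n" for i
    using bij_betw_value_order[of n x] that by (auto simp: bij_betw_def)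
  have Q_le: "Q (u i) \<le> Q (u j) \<longleftrightarrow> u i \<le> u j" if "i < n" "j < n" for i j
    using Q[of "u i" "u j"] Q[of "u j" "u i"] u[OF that(1)] u[OF that(2)]
    by (metis linorder_not_less order.asym order_less_irrefl linorder_neqE_linordered_idom)
  have rank: "y_rank n ?s i = card {j \<in> {..<n}. (\<lambda>i\<in>{..<n}. u (?o i)) j \<le> (\<lambda>i\<in>{..<n}. u (?o i)) i}" if i: "i < n" for i
  proof -
    have "y_rank n ?s i = card {j \<in> {..<n}. u j \<le> u (?o i)}"
      unfolding y_rank_def ord using lt[OF i] Q_le by (intro arg_cong[where f=card]) auto
    also have "\<dots> = card (?o ` {j \<in> {..<n}. u (?o j) \<le> u (?o i)})"
    proof (intro arg_cong[where f=card] set_eqI iffI)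
      fix k assume k: "k \<in> {j \<in> {..<n}. u j \<le> u (?o i)}"
      then obtain j where "j < n" "k = ?o j"
        using bij_betw_value_order[of n x] by (auto simp: bij_betw_def)
      then show "k \<in> ?o ` {j \<in> {..<n}. u (?o j) \<le> u (?o i)}" using k by auto
    qed (use lt in auto)
    also have "\<dots> = card {j \<in> {..<n}. u (?o j) \<le> u (?o i)}"
      by (intro card_image inj_on_subset[OF bij_betw_imp_inj_on[OF bij_betw_value_order]]) auto
    also have "\<dots> = card {j \<in> {..<n}. (\<lambda>i\<in>{..<n}. u (?o i)) j \<le> (\<lambda>i\<in>{..<n}. u (?o i)) i}"
      using i by (intro arg_cong[where f=card] Collect_cong) auto
    finally show ?thesis .
  qed
  show ?thesis
    unfolding chatterjee_def rank_stat_def using rank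
    by (intro arg_cong2[where f="(-)"] arg_cong2[where f="(/)"] arg_cong2[where f="(*)"] sum.cong) auto
qed

text \<open>Exchangeability of the uniform sample. It is applied with the X-values fixed, so the
  permutation may depend on them.\<close>

lemma nn_integral_unif_sample_permute:
  assumes \<pi>: "bij_betw \<pi> {..<n} {..<n}" and g: "g \<in> borel_measurable (unif_sample n)"
  shows "(\<integral>\<^sup>+u. g (\<lambda>i\<in>{..<n}. u (\<pi> i)) \<partial>unif_sample n) = (\<integral>\<^sup>+u. g u \<partial>unif_sample n)"
proof -
  have d: "distr (unif_sample n) (unif_sample n) (\<lambda>u. \<lambda>i\<in>{..<n}. u (\<pi> i)) = unif_sample n"
    using distr_PiM_reindex[of "{..<n}" "\<lambda>_. unif01" \<pi> "{..<n}"] \<pi> prob_space_unif01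
    by (auto simp: unif_sample_def bij_betw_def)
  have m: "(\<lambda>u. \<lambda>i\<in>{..<n}. u (\<pi> i)) \<in> unif_sample n \<rightarrow>\<^sub>M unif_sample n"
    using \<pi> unfolding unif_sample_def by (intro measurable_restrict measurable_component_singleton) (auto simp: bij_betw_def)
  show ?thesis
    by (subst (2) d[symmetric], subst nn_integral_distr[OF m]) (use g in auto)
qed

section \<open>Joint densities relative to a product law\<close>

locale independence_model =
  fixes f0 g0 Q :: "real \<Rightarrow> real"
  assumes f0: "prob_density f0" and g0: "prob_density g0"
    and Q_measurable [measurable]: "Q \<in> borel_measurable unif01"
    and distr_Q: "distr unif01 borel Q = density lborel (\<lambda>y. ennreal (g0 y))"
    and Q_mono: "\<And>u v. 0 < u \<Longrightarrow> u < v \<Longrightarrow> v < 1 \<Longrightarrow> Q u < Q v"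
begin

definition X_law :: "real measure" where "X_law = density lborel (\<lambda>x. ennreal (f0 x))"

definition Y_law :: "real measure" where "Y_law = density lborel (\<lambda>y. ennreal (g0 y))"

lemma prob_space_X_law: "prob_space X_law" and prob_space_Y_law: "prob_space Y_law"
  unfolding X_law_def Y_law_def by (rule prob_densityD f0 g0)+

lemma sets_laws [measurable_cong, simp]: "sets X_law = sets borel" "sets Y_law = sets borel"
  by (simp_all add: X_law_def Y_law_def)

lemma space_laws [simp]: "space X_law = UNIV" "space Y_law = UNIV"
  by (simp_all add: X_law_def Y_law_def)

text \<open>Here \<open>w\<close> is a density relative to the null law: the constant 1 is
  independence, and 1 + c is a perturbation of it.\<close>

definition joint :: "(real \<times> real \<Rightarrow> real) \<Rightarrow> real \<times> real \<Rightarrow> real" where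
  "joint w z = f0 (fst z) * g0 (snd z) * w z"

lemma law_joint:
  assumes w [measurable]: "w \<in> borel_measurable borel" and w0: "\<And>z. 0 \<le> w z"
  shows "law (joint w) = density (X_law \<Otimes>\<^sub>M Y_law) (\<lambda>z. ennreal (w z))"
proof -
  note [measurable] = prob_densityD(1)[OF f0] prob_densityD(1)[OF g0]
  have [measurable]: "w \<in> borel_measurable (borel \<Otimes>\<^sub>M borel)" using w by (simp add: borel_prod)
  have "X_law \<Otimes>\<^sub>M Y_law = density (lborel \<Otimes>\<^sub>M lborel) (\<lambda>(x, y). ennreal (f0 x) * ennreal (g0 y))"
    unfolding X_law_def Y_law_def
    by (rule pair_measure_density)
      (auto intro: sigma_finite_lborel prob_space_imp_sigma_finite prob_densityD g0)
  then have "density (X_law \<Otimes>\<^sub>M Y_law) (\<lambda>z. ennreal (w z)) =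
      density (lborel \<Otimes>\<^sub>M lborel) (\<lambda>z. (case z of (x, y) \<Rightarrow> ennreal (f0 x) * ennreal (g0 y)) * ennreal (w z))"
    by (simp only:) (rule density_density_eq; measurable)
  also have "\<dots> = density (lborel \<Otimes>\<^sub>M lborel) (\<lambda>z. ennreal (joint w z))"
    by (intro arg_cong[where f="density _"] ext)
      (auto simp: joint_def ennreal_mult prob_densityD[OF f0] prob_densityD[OF g0] w0)
  finally show ?thesis by (simp add: law_def lborel_prod)
qed

lemma emeasure_law_joint:
  assumes w [measurable]: "w \<in> borel_measurable borel" and w0: "\<And>z. 0 \<le> w z" and A: "A \<in> sets borel"
  shows "emeasure (law (joint w)) A =
    (\<integral>\<^sup>+x. \<integral>\<^sup>+u. ennreal (w (x, Q u)) * indicator A (x, Q u) \<partial>unif01 \<partial>X_law)"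
proof -
  interpret X: prob_space X_law by (rule prob_space_X_law)
  interpret Y: prob_space Y_law by (rule prob_space_Y_law)
  have [measurable]: "w \<in> borel_measurable (borel \<Otimes>\<^sub>M borel)" "A \<in> sets (borel \<Otimes>\<^sub>M borel)"
    using w A unfolding borel_prod by auto
  have "emeasure (law (joint w)) A = (\<integral>\<^sup>+z. ennreal (w z) * indicator A z \<partial>(X_law \<Otimes>\<^sub>M Y_law))"
    unfolding law_joint[OF w w0] by (subst emeasure_density) auto
  also have "\<dots> = (\<integral>\<^sup>+x. \<integral>\<^sup>+y. ennreal (w (x, y)) * indicator A (x, y) \<partial>Y_law \<partial>X_law)"
    by (rule Y.nn_integral_fst[symmetric]) measurable
  also have "\<dots> = (\<integral>\<^sup>+x. \<integral>\<^sup>+u. ennreal (w (x, Q u)) * indicator A (x, Q u) \<partial>unif01 \<partial>X_law)"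
    unfolding Y_law_def distr_Q[symmetric] by (intro nn_integral_cong nn_integral_distr) auto
  finally show ?thesis .
qed

definition zip_sample :: "nat \<Rightarrow> (nat \<Rightarrow> real) \<times> (nat \<Rightarrow> real) \<Rightarrow> nat \<Rightarrow> real \<times> real" where
  "zip_sample n p = (\<lambda>i\<in>{..<n}. (fst p i, Q (snd p i)))"

definition X_sample :: "nat \<Rightarrow> (nat \<Rightarrow> real) measure" where
  "X_sample n = PiM {..<n} (\<lambda>_. X_law)"

lemma prob_space_X_sample: "prob_space (X_sample n)"
  unfolding X_sample_def by (intro prob_space_PiM prob_space_X_law)

lemma measurable_pair_sample_coord [measurable]:
  assumes "i < n"
  shows "(\<lambda>p. fst p i) \<in> borel_measurable (X_sample n \<Otimes>\<^sub>M unif_sample n)"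
    "(\<lambda>p. snd p i) \<in> X_sample n \<Otimes>\<^sub>M unif_sample n \<rightarrow>\<^sub>M unif01"
proof -
  have "(\<lambda>w. w i) \<in> X_sample n \<rightarrow>\<^sub>M X_law"
    unfolding X_sample_def using assms by (intro measurable_component_singleton) auto
  then have "(\<lambda>w. w i) \<in> borel_measurable (X_sample n)"
    by (simp add: measurable_cong_sets[OF refl sets_laws(1)])
  then show "(\<lambda>p. fst p i) \<in> borel_measurable (X_sample n \<Otimes>\<^sub>M unif_sample n)"
    by (rule measurable_compose[OF measurable_fst])
  show "(\<lambda>p. snd p i) \<in> X_sample n \<Otimes>\<^sub>M unif_sample n \<rightarrow>\<^sub>M unif01"
    using assms by (intro measurable_compose[OF measurable_snd measurable_unif_sample_coord])
qed

lemma measurable_zip_coord [measurable]: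
  "i < n \<Longrightarrow> (\<lambda>p. (fst p i, Q (snd p i))) \<in> X_sample n \<Otimes>\<^sub>M unif_sample n \<rightarrow>\<^sub>M (borel :: (real \<times> real) measure)"
  using measurable_pair_sample_coord[of i n] measurable_compose[OF measurable_pair_sample_coord(2) Q_measurable, of i n]
  by (simp add: borel_prod[symmetric])

lemma sets_law [simp]: "sets (law q) = sets borel"
  by (simp add: law_def)

lemma measurable_zip_sample [measurable]:
  "zip_sample n \<in> X_sample n \<Otimes>\<^sub>M unif_sample n \<rightarrow>\<^sub>M PiM {..<n} (\<lambda>_. law q)"
  unfolding zip_sample_def
  by (intro measurable_restrict) (auto simp: measurable_cong_sets[OF refl sets_law])

text \<open>A sample is the image of independent X-values and uniforms, reweighted by the product of
  the relative densities. Equality is tested on boxes, where the integral factorises, over the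
  uniforms first and over the X-values second.\<close>

lemma sample_law_joint:
  assumes w [measurable]: "w \<in> borel_measurable borel" and w0: "\<And>z. 0 \<le> w z"
    and prob: "prob_space (law (joint w))"
  shows "sample_law n (joint w) = distr (density (X_sample n \<Otimes>\<^sub>M unif_sample n)
      (\<lambda>p. \<Prod>i<n. ennreal (w (fst p i, Q (snd p i))))) (PiM {..<n} (\<lambda>_. law (joint w))) (zip_sample n)"
    (is "_ = ?R")
proof -
  interpret L: prob_space "law (joint w)" by (rule prob)
  interpret X: prob_space X_law by (rule prob_space_X_law)
  interpret PL: product_sigma_finite "\<lambda>_::nat. law (joint w)" by standard
  interpret PX: product_sigma_finite "\<lambda>_::nat. X_law" by standard
  interpret PU: product_sigma_finite "\<lambda>_::nat. unif01" by standard
  have W [measurable]: "(\<lambda>p. \<Prod>i<n. ennreal (w (fst p i, Q (snd p i)))) \<in> borel_measurable (X_sample n \<Otimes>\<^sub>M unif_sample n)"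
    by (intro borel_measurable_prod_ennreal measurable_compose[OF measurable_zip_coord]) auto
  have "?R = PiM {..<n} (\<lambda>_. law (joint w))"
  proof (rule PL.PiM_eqI)
    fix A assume "\<And>i. i \<in> {..<n} \<Longrightarrow> A i \<in> sets (law (joint w))"
    then have A: "A i \<in> sets borel" if "i < n" for i using that by simp
    have box: "Pi\<^sub>E {..<n} A \<in> sets (PiM {..<n} (\<lambda>_. law (joint w)))"
      using A by (intro sets_PiM_I_finite) auto
    let ?g = "\<lambda>i x u. ennreal (w (x, Q u)) * indicator (A i) (x, Q u)"
    have gm: "(\<lambda>p. ?g i (fst p) (snd p)) \<in> borel_measurable (borel \<Otimes>\<^sub>M unif01)" if "i < n" for i
    proof -
      have "(\<lambda>p. (fst p, Q (snd p))) \<in> borel \<Otimes>\<^sub>M unif01 \<rightarrow>\<^sub>M (borel :: (real \<times> real) measure)"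
        by (simp add: borel_prod[symmetric])
      moreover have "(\<lambda>z. ennreal (w z) * indicator (A i) z) \<in> borel_measurable borel"
        using A[OF that] by measurable
      ultimately show ?thesis by (rule measurable_compose)
    qed
    have "emeasure ?R (Pi\<^sub>E {..<n} A) = emeasure (density (X_sample n \<Otimes>\<^sub>M unif_sample n)
        (\<lambda>p. \<Prod>i<n. ennreal (w (fst p i, Q (snd p i))))) (zip_sample n -` Pi\<^sub>E {..<n} A \<inter> space (X_sample n \<Otimes>\<^sub>M unif_sample n))"
      using box measurable_zip_sample by (subst emeasure_distr) (auto simp: space_density)
    also have "\<dots> = (\<integral>\<^sup>+p. (\<Prod>i<n. ennreal (w (fst p i, Q (snd p i)))) *
        indicator (zip_sample n -` Pi\<^sub>E {..<n} A \<inter> space (X_sample n \<Otimes>\<^sub>M unif_sample n)) p \<partial>(X_sample n \<Otimes>\<^sub>M unif_sample n))"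
      using box by (intro emeasure_density W measurable_sets[OF measurable_zip_sample])
    also have "\<dots> = (\<integral>\<^sup>+p. (\<Prod>i<n. ?g i (fst p i) (snd p i)) \<partial>(X_sample n \<Otimes>\<^sub>M unif_sample n))"
    proof (intro nn_integral_cong)
      fix p assume p: "p \<in> space (X_sample n \<Otimes>\<^sub>M unif_sample n)"
      have "(\<Prod>i<n. indicator (A i) (fst p i, Q (snd p i))) =
         (indicator (zip_sample n -` Pi\<^sub>E {..<n} A \<inter> space (X_sample n \<Otimes>\<^sub>M unif_sample n)) p :: ennreal)"
        using p by (auto simp: indicator_def zip_sample_def PiE_iff prod_zero_iff)
      then show "(\<Prod>i<n. ennreal (w (fst p i, Q (snd p i)))) *
        indicator (zip_sample n -` Pi\<^sub>E {..<n} A \<inter> space (X_sample n \<Otimes>\<^sub>M unif_sample n)) p = (\<Prod>i<n. ?g i (fst p i) (snd p i))"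
        by (simp add: prod.distrib)
    qed
    also have "\<dots> = (\<integral>\<^sup>+x. \<integral>\<^sup>+u. (\<Prod>i<n. ?g i (x i) (u i)) \<partial>unif_sample n \<partial>X_sample n)"
    proof (subst unif_sample.nn_integral_fst[symmetric])
      show "(\<lambda>p. \<Prod>i<n. ?g i (fst p i) (snd p i)) \<in> borel_measurable (X_sample n \<Otimes>\<^sub>M unif_sample n)"
      proof (intro borel_measurable_prod_ennreal)
        fix i assume "i \<in> {..<n}"
        then have i: "i < n" by simp
        have "(\<lambda>p. (fst p i, snd p i)) \<in> X_sample n \<Otimes>\<^sub>M unif_sample n \<rightarrow>\<^sub>M borel \<Otimes>\<^sub>M unif01"
          using i by (intro measurable_Pair measurable_pair_sample_coord)
        from measurable_compose[OF this gm[OF i]]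
        show "(\<lambda>p. ?g i (fst p i) (snd p i)) \<in> borel_measurable (X_sample n \<Otimes>\<^sub>M unif_sample n)" by simp
      qed
    qed simp
    also have "\<dots> = (\<integral>\<^sup>+x. (\<Prod>i<n. \<integral>\<^sup>+u. ?g i (x i) u \<partial>unif01) \<partial>X_sample n)"
    proof (intro nn_integral_cong)
      fix x
      have "(\<lambda>u. ?g i a u) \<in> borel_measurable unif01" if "i < n" for i a
        using measurable_compose[OF measurable_Pair1'[of a borel unif01] gm[OF that]] by simp
      then show "(\<integral>\<^sup>+u. (\<Prod>i<n. ?g i (x i) (u i)) \<partial>unif_sample n) = (\<Prod>i<n. \<integral>\<^sup>+u. ?g i (x i) u \<partial>unif01)"
        unfolding unif_sample_def by (intro PU.product_nn_integral_prod) auto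
    qed
    also have "\<dots> = (\<Prod>i<n. \<integral>\<^sup>+x. \<integral>\<^sup>+u. ?g i x u \<partial>unif01 \<partial>X_law)"
      unfolding X_sample_def
    proof (intro PX.product_nn_integral_prod)
      fix i assume "i \<in> {..<n}"
      then have i: "i < n" by simp
      have "(\<lambda>x. \<integral>\<^sup>+u. ?g i x u \<partial>unif01) \<in> borel_measurable borel"
        using unif01.borel_measurable_nn_integral_fst[OF gm[OF i]] by simp
      then show "(\<lambda>x. \<integral>\<^sup>+u. ?g i x u \<partial>unif01) \<in> borel_measurable X_law"
        by (subst measurable_cong_sets[OF sets_laws(1) refl])
    qed simp
    also have "\<dots> = (\<Prod>i<n. emeasure (law (joint w)) (A i))"
      using A by (intro prod.cong) (auto simp: emeasure_law_joint[OF w w0])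
    finally show "emeasure ?R (Pi\<^sub>E {..<n} A) = (\<Prod>i<n. emeasure (law (joint w)) (A i))" .
  qed auto
  then show ?thesis by (simp add: sample_law_def)
qed

end

section \<open>Perturbed product densities and Hellinger distance\<close>

text \<open>\<open>c\<close> will be \<theta> times a bounded approximation of the score. Centring
  is demanded for every \<open>x\<close>, not just almost every one: each X-vector has to produce an
  admissible array of tilts.\<close>

locale centred_perturbation = independence_model +
  fixes c :: "real \<times> real \<Rightarrow> real"
  assumes measurable_c [measurable]: "c \<in> borel_measurable borel"
    and abs_c_le_1: "\<And>z. \<bar>c z\<bar> \<le> 1"
    and integral_c: "\<And>x. (\<integral>u. c (x, Q u) \<partial>unif01) = 0"
begin

definition slices :: "nat \<Rightarrow> (nat \<Rightarrow> real) \<Rightarrow> nat \<Rightarrow> real \<Rightarrow> real" where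
  "slices n x j u = c (x (value_order n x j), Q u)"

lemma measurable_slice: "(\<lambda>u. c (a, Q u)) \<in> borel_measurable unif01"
proof -
  have "(\<lambda>u. (a, Q u)) \<in> unif01 \<rightarrow>\<^sub>M (borel :: (real \<times> real) measure)"
    by (simp add: borel_prod[symmetric])
  from measurable_compose[OF this measurable_c] show ?thesis .
qed

lemma tilt_family_slices: "tilt_family (slices n x)"
  by standard (auto simp: slices_def[abs_def] measurable_slice abs_c_le_1 integral_c)

lemma prob_space_law_perturbed: "prob_space (law (joint (\<lambda>z. 1 + c z)))"
proof
  have nn: "0 \<le> 1 + c z" for z using abs_c_le_1[of z] by linarith
  have inner: "(\<integral>\<^sup>+u. ennreal (1 + c (x, Q u)) \<partial>unif01) = 1" for x
  proof -
    have i: "integrable unif01 (\<lambda>u. c (x, Q u))"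
      using abs_c_le_1 by (intro unif01.integrable_bounded_measurable bounded_measurableI[where C=1] measurable_slice) auto
    have "(\<integral>\<^sup>+u. ennreal (1 + c (x, Q u)) \<partial>unif01) = ennreal (\<integral>u. 1 + c (x, Q u) \<partial>unif01)"
      using i nn by (intro nn_integral_eq_integral) auto
    also have "(\<integral>u. 1 + c (x, Q u) \<partial>unif01) = 1"
      using i integral_c by simp
    finally show ?thesis by simp
  qed
  have "emeasure (law (joint (\<lambda>z. 1 + c z))) UNIV = (\<integral>\<^sup>+x. 1 \<partial>X_law)"
    using nn by (subst emeasure_law_joint) (auto simp: inner)
  also have "\<dots> = 1"
    using prob_space.emeasure_space_1[OF prob_space_X_law] by simp
  finally show "emeasure (law (joint (\<lambda>z. 1 + c z))) (space (law (joint (\<lambda>z. 1 + c z)))) = 1"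
    by (simp add: law_def)
qed

text \<open>Given the X-values, permuting the uniforms by the sorting permutation preserves their
  law, turns the weights into the tilt by \<open>slices\<close> and the statistic into
  \<open>rank_stat\<close>. The tail probability is thus a mixture of tilted ones over the
  X-sample.\<close>

lemma emeasure_upper_tail:
  "emeasure (sample_law n (joint (\<lambda>z. 1 + c z)))
      {s \<in> space (sample_law n (joint (\<lambda>z. 1 + c z))). t \<le> sqrt (real n) * chatterjee n s} =
   (\<integral>\<^sup>+x. emeasure (tilted_sample n (slices n x)) {v \<in> space (unif_sample n). t \<le> sqrt n * rank_stat n v} \<partial>X_sample n)"
proof -
  let ?w = "\<lambda>z. 1 + c z" and ?XU = "X_sample n \<Otimes>\<^sub>M unif_sample n"
  let ?P = "PiM {..<n} (\<lambda>_. law (joint ?w))"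
  let ?W = "\<lambda>p. \<Prod>i<n. ennreal (?w (fst p i, Q (snd p i)))"
  let ?E = "{s \<in> space ?P. t \<le> sqrt (real n) * chatterjee n s}"
  have w0: "0 \<le> ?w z" for z using abs_c_le_1[of z] by linarith
  have W [measurable]: "?W \<in> borel_measurable ?XU"
    by (intro borel_measurable_prod_ennreal measurable_compose[OF measurable_zip_coord]) auto
  have "sets ?P = sets (PiM {..<n} (\<lambda>_. borel :: (real \<times> real) measure))"
    by (intro sets_PiM_cong) auto
  from measurable_chatterjee[OF this] have E: "?E \<in> sets ?P" by measurable
  note zip = measurable_zip_sample[of n "joint ?w"]
  have sl: "sample_law n (joint ?w) = distr (density ?XU ?W) ?P (zip_sample n)"
    by (rule sample_law_joint) (use w0 prob_space_law_perturbed in auto)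
  have "space (sample_law n (joint ?w)) = space ?P" by (simp add: sample_law_def)
  then have "emeasure (sample_law n (joint ?w)) {s \<in> space (sample_law n (joint ?w)). t \<le> sqrt (real n) * chatterjee n s}
      = emeasure (distr (density ?XU ?W) ?P (zip_sample n)) ?E"
    using sl by simp
  also have "\<dots> = emeasure (density ?XU ?W) (zip_sample n -` ?E \<inter> space ?XU)"
    using E zip by (subst emeasure_distr) auto
  also have "\<dots> = (\<integral>\<^sup>+p. ?W p * indicator (zip_sample n -` ?E \<inter> space ?XU) p \<partial>?XU)"
    by (intro emeasure_density W measurable_sets[OF zip] E)
  also have "\<dots> = (\<integral>\<^sup>+x. \<integral>\<^sup>+u. ?W (x, u) * indicator (zip_sample n -` ?E \<inter> space ?XU) (x, u) \<partial>unif_sample n \<partial>X_sample n)"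
    by (intro unif_sample.nn_integral_fst[symmetric] borel_measurable_times_ennreal W
        borel_measurable_indicator measurable_sets[OF zip] E)
  also have "\<dots> = (\<integral>\<^sup>+x. emeasure (tilted_sample n (slices n x)) {v \<in> space (unif_sample n). t \<le> sqrt n * rank_stat n v} \<partial>X_sample n)"
  proof (intro nn_integral_cong)
    fix x assume x: "x \<in> space (X_sample n)"
    let ?o = "value_order n x"
    let ?F = "{v \<in> space (unif_sample n). t \<le> sqrt n * rank_stat n v}"
    interpret T: tilt_family n "slices n x" by (rule tilt_family_slices)
    define g where "g v = ennreal (tilt n (slices n x) v) * indicator ?F v" for v
    have [measurable]: "rank_stat n \<in> borel_measurable (unif_sample n)"
      by (rule bounded_measurableD[OF bounded_measurable_rank_stat])
    have [measurable]: "tilt n (slices n x) \<in> borel_measurable (unif_sample n)"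
      by (rule bounded_measurableD[OF T.bounded_measurable_tilt])
    have F: "?F \<in> sets (unif_sample n)" by measurable
    have g: "g \<in> borel_measurable (unif_sample n)" unfolding g_def using F by measurable
    have "(\<integral>\<^sup>+u. ?W (x, u) * indicator (zip_sample n -` ?E \<inter> space ?XU) (x, u) \<partial>unif_sample n)
        = (\<integral>\<^sup>+u. g (\<lambda>i\<in>{..<n}. u (?o i)) \<partial>unif_sample n)"
    proof (intro nn_integral_cong)
      fix u assume u: "u \<in> space (unif_sample n)"
      let ?v = "\<lambda>i\<in>{..<n}. u (?o i)"
      have v: "?v \<in> space (unif_sample n)"
        using u bij_betw_value_order[of n x] by (fastforce simp: unif_sample_def space_PiM bij_betw_def)
      \<comment> \<open>The weight is a product over all observations, so it may be evaluated in
        sorted order.\<close>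
      have "?W (x, u) = (\<Prod>i<n. ennreal (?w (x (?o i), Q (u (?o i)))))"
        by (simp add: prod.reindex_bij_betw[OF bij_betw_value_order, of "\<lambda>i. ennreal (1 + c (x i, Q (u i)))"])
      also have "\<dots> = ennreal (tilt n (slices n x) ?v)"
        using w0 by (simp add: tilt_def slices_def prod_ennreal)
      finally have Wt: "?W (x, u) = ennreal (tilt n (slices n x) ?v)" .
      have ch: "chatterjee n (zip_sample n (x, u)) = rank_stat n ?v"
        unfolding zip_sample_def fst_conv snd_conv
        by (rule chatterjee_eq_rank_stat[OF Q_mono]) (use space_unif_sampleD[OF u] in auto)
      have "zip_sample n (x, u) \<in> space ?P"
        using measurable_space[OF zip, of "(x, u)"] x u by (simp add: space_pair_measure)
      then have "indicator (zip_sample n -` ?E \<inter> space ?XU) (x, u) = (indicator ?F ?v :: ennreal)"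
        using x u v ch by (simp add: indicator_def space_pair_measure)
      then show "?W (x, u) * indicator (zip_sample n -` ?E \<inter> space ?XU) (x, u) = g ?v"
        using Wt by (simp add: g_def)
    qed
    also have "\<dots> = (\<integral>\<^sup>+v. g v \<partial>unif_sample n)"
      by (rule nn_integral_unif_sample_permute[OF bij_betw_value_order g])
    also have "\<dots> = emeasure (tilted_sample n (slices n x)) ?F"
      unfolding tilted_sample_def g_def using F by (subst emeasure_density) auto
    finally show "(\<integral>\<^sup>+u. ?W (x, u) * indicator (zip_sample n -` ?E \<inter> space ?XU) (x, u) \<partial>unif_sample n)
        = emeasure (tilted_sample n (slices n x)) ?F" .
  qed
  finally show ?thesis .
qed

lemma prob_space_sample_law_perturbed: "prob_space (sample_law n (joint (\<lambda>z. 1 + c z)))"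
  unfolding sample_law_def by (intro prob_space_PiM prob_space_law_perturbed)

text \<open>A bound uniform in the X-vector survives averaging. Comparing the mixture with constants
  by monotonicity avoids a separate proof that the conditional probability is measurable in
  \<open>x\<close>.\<close>

lemma upper_tail_prob_deviation:
  assumes e: "\<And>x. x \<in> space (X_sample n) \<Longrightarrow>
    \<bar>measure (tilted_sample n (slices n x)) {v \<in> space (unif_sample n). t \<le> sqrt n * rank_stat n v} - \<alpha>\<bar> \<le> e"
  shows "\<bar>upper_tail_prob n (joint (\<lambda>z. 1 + c z)) t - \<alpha>\<bar> \<le> e"
proof -
  let ?S = "sample_law n (joint (\<lambda>z. 1 + c z))"
  interpret S: prob_space ?S by (rule prob_space_sample_law_perturbed)
  interpret X: prob_space "X_sample n" by (rule prob_space_X_sample)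
  let ?F = "{v \<in> space (unif_sample n). t \<le> sqrt n * rank_stat n v}"
  let ?T = "\<lambda>x. measure (tilted_sample n (slices n x)) ?F"
  have T: "emeasure (tilted_sample n (slices n x)) ?F = ennreal (?T x)" for x
  proof -
    interpret prob_space "tilted_sample n (slices n x)"
      by (rule tilt_family.prob_space_tilted_sample[OF tilt_family_slices])
    show ?thesis by (rule emeasure_eq_measure)
  qed
  have eq: "ennreal (upper_tail_prob n (joint (\<lambda>z. 1 + c z)) t) = (\<integral>\<^sup>+x. ennreal (?T x) \<partial>X_sample n)"
    unfolding upper_tail_prob_def S.emeasure_eq_measure[symmetric] emeasure_upper_tail T ..
  have up0: "0 \<le> upper_tail_prob n (joint (\<lambda>z. 1 + c z)) t"
    by (simp add: upper_tail_prob_def)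
  obtain x0 where x0: "x0 \<in> space (X_sample n)" using X.not_empty by auto
  have a0: "0 \<le> \<alpha> + e" using e[OF x0] measure_nonneg[of "tilted_sample n (slices n x0)" ?F] by linarith
  have "ennreal (upper_tail_prob n (joint (\<lambda>z. 1 + c z)) t) \<le> (\<integral>\<^sup>+x. ennreal (\<alpha> + e) \<partial>X_sample n)"
    unfolding eq using e by (intro nn_integral_mono ennreal_leI) (force simp: abs_le_iff)
  then have "upper_tail_prob n (joint (\<lambda>z. 1 + c z)) t \<le> \<alpha> + e"
    using a0 by (simp add: X.emeasure_space_1)
  moreover have "(\<integral>\<^sup>+x. ennreal (\<alpha> - e) \<partial>X_sample n) \<le> ennreal (upper_tail_prob n (joint (\<lambda>z. 1 + c z)) t)"
    unfolding eq using e by (intro nn_integral_mono ennreal_leI) (force simp: abs_le_iff)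
  then have "\<alpha> - e \<le> upper_tail_prob n (joint (\<lambda>z. 1 + c z)) t"
    using up0 by (simp add: X.emeasure_space_1)
  ultimately show ?thesis by linarith
qed

end

context independence_model
begin

text \<open>The zero perturbation leaves every slice untilted, so the deviation bound applies with
  error 0: under independence the law of the statistic does not depend on the marginals.\<close>

lemma null_upper_tail_prob:
  "upper_tail_prob n (joint (\<lambda>_. 1)) t =
    measure (unif_sample n) {v \<in> space (unif_sample n). t \<le> sqrt n * rank_stat n v}"
proof -
  interpret Z: centred_perturbation f0 g0 Q "\<lambda>_. 0" by standard auto
  have "tilted_sample n (Z.slices n x) = unif_sample n" for x
    by (simp add: tilted_sample_def tilt_def Z.slices_def density_1)
  then have "\<bar>upper_tail_prob n (joint (\<lambda>z. 1 + (\<lambda>_. 0) z)) t -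
      measure (unif_sample n) {v \<in> space (unif_sample n). t \<le> sqrt n * rank_stat n v}\<bar> \<le> 0"
    by (intro Z.upper_tail_prob_deviation) simp
  then show ?thesis by simp
qed

text \<open>Conditionally on the X-values the Y-values are independent with tilted densities, so it is
  enough to follow, for each \<open>n\<close>, a worst vector of X-values.\<close>

lemma perturbed_level:
  fixes c :: "nat \<Rightarrow> real \<times> real \<Rightarrow> real"
  assumes c: "\<And>n. centred_perturbation f0 g0 Q (c n)"
    and D: "\<And>n z. \<bar>c n z\<bar> \<le> D / sqrt n"
    and level: "(\<lambda>n. upper_tail_prob n (joint (\<lambda>_. 1)) (t n)) \<longlonglongrightarrow> \<alpha>"
    and alpha: "0 < \<alpha>" "\<alpha> < 1"
  shows "(\<lambda>n. upper_tail_prob n (joint (\<lambda>z. 1 + c n z)) (t n)) \<longlonglongrightarrow> \<alpha>"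
proof (rule tendstoI)
  fix e :: real assume e: "0 < e"
  interpret C: centred_perturbation f0 g0 Q "c n" for n by (rule c)
  let ?T = "\<lambda>n x. measure (tilted_sample n (C.slices n n x)) {v \<in> space (unif_sample n). t n \<le> sqrt n * rank_stat n v}"
  define bad where "bad n x \<longleftrightarrow> x \<in> space (X_sample n) \<and> \<not> \<bar>?T n x - \<alpha>\<bar> \<le> e / 2" for n x
  \<comment> \<open>If any vector is bad, the chosen one is. If none is, the choice is arbitrary,
    yet its slices are still admissible tilts because the centring holds for every real
    number.\<close>
  define x where "x n = (SOME x. bad n x)" for n
  have "(\<lambda>n. ?T n (x n)) \<longlonglongrightarrow> \<alpha>"
  proof (rule tilted_rank_test_level)
    show "tilt_family (C.slices n n (x n))" for n by (rule C.tilt_family_slices)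
    show "\<bar>C.slices n n (x n) j u\<bar> \<le> D / sqrt n" for n j u by (simp add: C.slices_def D)
    show "(\<lambda>n. measure (unif_sample n) {w \<in> space (unif_sample n). t n \<le> sqrt n * rank_stat n w}) \<longlonglongrightarrow> \<alpha>"
      using level by (simp add: null_upper_tail_prob)
  qed (use alpha in auto)
  then have "\<forall>\<^sub>F n in sequentially. dist (?T n (x n)) \<alpha> < e / 2"
    using e by (intro tendstoD) auto
  then show "\<forall>\<^sub>F n in sequentially. dist (upper_tail_prob n (joint (\<lambda>z. 1 + c n z)) (t n)) \<alpha> < e"
  proof eventually_elim
    case (elim n)
    have "\<not> bad n (x n)" using elim by (auto simp: bad_def dist_real_def)
    then have "\<not> bad n y" for y
      unfolding x_def using someI[of "bad n" y] by auto
    then have "\<bar>upper_tail_prob n (joint (\<lambda>z. 1 + c n z)) (t n) - \<alpha>\<bar> \<le> e / 2"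
      by (intro C.upper_tail_prob_deviation) (auto simp: bad_def)
    then show ?case using e by (simp add: dist_real_def)
  qed
qed

end

section \<open>Total variation of sample laws through the Hellinger distance\<close>

lemma sample_law_density:
  assumes f: "prob_density f"
  shows "sample_law n f = density (PiM {..<n} (\<lambda>_. lborel)) (\<lambda>z. ennreal (\<Prod>i<n. f (z i)))"
proof -
  note fm [measurable] = prob_densityD(1)[OF f] and f0 = prob_densityD(2)[OF f]
  interpret L: prob_space "law f" unfolding law_def by (rule prob_densityD(3)[OF f])
  interpret PL: product_sigma_finite "\<lambda>_::nat. law f" by standard
  interpret PB: product_sigma_finite "\<lambda>_::nat. lborel :: (real \<times> real) measure" by standard
  have sets: "sets (law f) = sets borel" by (simp add: law_def)
  have prod_eq: "ennreal (\<Prod>i<n. f (z i)) = (\<Prod>i<n. ennreal (f (z i)))" for z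
    using f0 by (simp add: prod_ennreal)
  have m: "(\<lambda>z. \<Prod>i<n. ennreal (f (z i))) \<in> borel_measurable (PiM {..<n} (\<lambda>_. lborel))"
    by (intro borel_measurable_prod_ennreal measurable_compose[OF measurable_component_singleton]) auto
  have "density (PiM {..<n} (\<lambda>_. lborel)) (\<lambda>z. \<Prod>i<n. ennreal (f (z i))) = PiM {..<n} (\<lambda>_. law f)"
  proof (rule PL.PiM_eqI)
    show "sets (density (PiM {..<n} (\<lambda>_. lborel)) (\<lambda>z. \<Prod>i<n. ennreal (f (z i)))) = sets (PiM {..<n} (\<lambda>_. law f))"
      unfolding sets_density by (intro sets_PiM_cong) (auto simp: sets)
    fix A assume "\<And>i. i \<in> {..<n} \<Longrightarrow> A i \<in> sets (law f)"
    then have A: "A i \<in> sets borel" if "i < n" for i using that by (simp add: sets)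
    have "emeasure (density (PiM {..<n} (\<lambda>_. lborel)) (\<lambda>z. \<Prod>i<n. ennreal (f (z i)))) (Pi\<^sub>E {..<n} A)
        = (\<integral>\<^sup>+z. (\<Prod>i<n. ennreal (f (z i))) * indicator (Pi\<^sub>E {..<n} A) z \<partial>PiM {..<n} (\<lambda>_. lborel))"
      using A by (intro emeasure_density m sets_PiM_I_finite) auto
    also have "\<dots> = (\<integral>\<^sup>+z. (\<Prod>i<n. ennreal (f (z i)) * indicator (A i) (z i)) \<partial>PiM {..<n} (\<lambda>_. lborel))"
    proof (intro nn_integral_cong)
      fix z assume "z \<in> space (PiM {..<n} (\<lambda>_. lborel :: (real \<times> real) measure))"
      then have "(indicator (Pi\<^sub>E {..<n} A) z :: ennreal) = (\<Prod>i<n. indicator (A i) (z i))"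
        by (auto simp: indicator_def PiE_iff space_PiM prod_zero_iff)
      then show "(\<Prod>i<n. ennreal (f (z i))) * indicator (Pi\<^sub>E {..<n} A) z = (\<Prod>i<n. ennreal (f (z i)) * indicator (A i) (z i))"
        by (simp add: prod.distrib)
    qed
    also have "\<dots> = (\<Prod>i<n. \<integral>\<^sup>+z. ennreal (f z) * indicator (A i) z \<partial>lborel)"
      using A by (intro PB.product_nn_integral_prod) auto
    also have "\<dots> = (\<Prod>i<n. emeasure (law f) (A i))"
      using A by (intro prod.cong) (auto simp: law_def emeasure_density)
    finally show "emeasure (density (PiM {..<n} (\<lambda>_. lborel)) (\<lambda>z. \<Prod>i<n. ennreal (f (z i)))) (Pi\<^sub>E {..<n} A)
        = (\<Prod>i<n. emeasure (law f) (A i))" .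
  qed simp
  then show ?thesis unfolding prod_eq sample_law_def by simp
qed

text \<open>For the sample densities, |P - R| = |sqrt P - sqrt R| (sqrt P + sqrt R). An
  arithmetic-geometric mean inequality with weight \<delta> takes the place of Cauchy-Schwarz: the
  second part integrates to at most 2 \<delta>, and the first involves the squared Hellinger
  distance of the samples, at most n times that of one observation.\<close>

lemma sample_law_diff_le_hellinger:
  assumes p: "prob_density p" and q: "prob_density q"
    and A: "A \<in> sets (PiM {..<n} (\<lambda>_. lborel))" and \<delta>: "0 < \<delta>"
  shows "\<bar>measure (sample_law n p) A - measure (sample_law n q) A\<bar> \<le>
    n * (\<integral>z. (sqrt (p z) - sqrt (q z))\<^sup>2 \<partial>lborel) / (2 * \<delta>) + 2 * \<delta>"
proof -
  interpret PB: product_sigma_finite "\<lambda>_::nat. lborel :: (real \<times> real) measure" by standard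
  let ?L = "PiM {..<n} (\<lambda>_. lborel :: (real \<times> real) measure)"
  note [measurable] = prob_densityD(1)[OF p] prob_densityD(1)[OF q]
  have p0: "0 \<le> p z" and q0: "0 \<le> q z" for z
    using prob_densityD(2) p q by auto
  have dens: "integrable lborel f" "(\<integral>z. f z \<partial>lborel) = 1" if "prob_density f" for f :: "real \<times> real \<Rightarrow> real"
  proof -
    have "(\<integral>\<^sup>+z. ennreal (f z) \<partial>lborel) = ennreal 1" using that by (simp add: prob_density_def)
    moreover have "AE z in lborel. 0 \<le> f z"
      by (intro AE_I2 prob_densityD(2)[OF that])
    moreover have "f \<in> borel_measurable lborel"
      using prob_densityD(1)[OF that] by simp
    ultimately show "integrable lborel f" "(\<integral>z. f z \<partial>lborel) = 1"
      using nn_integral_eq_integrable[of f lborel 1] by simp_all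
  qed
  have power_int: "integrable ?L (\<lambda>z. \<Prod>i<n. f (z i))" "(\<integral>z. (\<Prod>i<n. f (z i)) \<partial>?L) = (\<integral>z. f z \<partial>lborel) ^ n"
    if "integrable lborel f" for f :: "real \<times> real \<Rightarrow> real"
    using that PB.product_integrable_prod[of "{..<n}" "\<lambda>_. f"] PB.product_integral_prod[of "{..<n}" "\<lambda>_. f"]
    by simp_all
  have ib: "integrable lborel (\<lambda>z. sqrt (p z) * sqrt (q z))"
  proof (rule Bochner_Integration.integrable_bound[of _ "\<lambda>z. p z + q z"])
    show "integrable lborel (\<lambda>z. p z + q z)" using dens p q by auto
    show "AE z in lborel. norm (sqrt (p z) * sqrt (q z)) \<le> norm (p z + q z)"
    proof (intro AE_I2)
      fix z
      have "2 * sqrt (p z) * sqrt (q z) \<le> (sqrt (p z))\<^sup>2 + (sqrt (q z))\<^sup>2" by (rule sum_squares_bound)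
      then show "norm (sqrt (p z) * sqrt (q z)) \<le> norm (p z + q z)"
        using p0[of z] q0[of z] by simp
    qed
  qed measurable
  let ?b = "\<integral>z. sqrt (p z) * sqrt (q z) \<partial>lborel"
  let ?H = "\<integral>z. (sqrt (p z) - sqrt (q z))\<^sup>2 \<partial>lborel"
  have H: "?H = 2 - 2 * ?b"
  proof -
    have "(sqrt (p z) - sqrt (q z))\<^sup>2 = p z + q z - 2 * (sqrt (p z) * sqrt (q z))" for z
      using p0[of z] q0[of z] by (simp add: power2_diff)
    then show ?thesis using dens p q ib by simp
  qed
  have b0: "0 \<le> ?b" using p0 q0 by (intro integral_nonneg_AE) auto
  define P where "P z = (\<Prod>i<n. p (z i))" for z :: "nat \<Rightarrow> real \<times> real"
  define R where "R z = (\<Prod>i<n. q (z i))" for z :: "nat \<Rightarrow> real \<times> real"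
  have P0: "0 \<le> P z" and R0: "0 \<le> R z" for z
    unfolding P_def R_def by (intro prod_nonneg p0 q0)+
  have iP: "integrable ?L P" "(\<integral>z. P z \<partial>?L) = 1" and iR: "integrable ?L R" "(\<integral>z. R z \<partial>?L) = 1"
    unfolding P_def R_def using power_int[OF dens(1)[OF p]] power_int[OF dens(1)[OF q]] dens(2) p q
    by simp_all
  have B: "sqrt (P z) * sqrt (R z) = (\<Prod>i<n. sqrt (p (z i)) * sqrt (q (z i)))" for z
  proof -
    have "sqrt (\<Prod>i<n. f i) = (\<Prod>i<n. sqrt (f i))" for f :: "nat \<Rightarrow> real"
      by (induction n) (simp_all add: real_sqrt_mult)
    then show ?thesis unfolding P_def R_def by (simp add: prod.distrib)
  qed
  have iB: "integrable ?L (\<lambda>z. sqrt (P z) * sqrt (R z))" "(\<integral>z. sqrt (P z) * sqrt (R z) \<partial>?L) = ?b ^ n"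
    unfolding B by (rule power_int[OF ib])+
  have minus: "(sqrt (P z) - sqrt (R z))\<^sup>2 = P z + R z - 2 * (sqrt (P z) * sqrt (R z))"
    and plus: "(sqrt (P z) + sqrt (R z))\<^sup>2 = P z + R z + 2 * (sqrt (P z) * sqrt (R z))" for z
    using P0[of z] R0[of z] by (simp_all add: power2_diff power2_sum)
  \<comment> \<open>The affinity \<open>?b\<close> is multiplicative over observations; Bernoulli's
    inequality compares its power with n times the distance for one observation.\<close>
  have bern: "1 - n * (?H / 2) \<le> ?b ^ n"
  proof -
    have "n * (?H / 2) = n * (1 - ?b)" unfolding H by simp
    moreover have "1 + n * (?b - 1) \<le> (1 + (?b - 1)) ^ n"
      using b0 by (intro Bernoulli_inequality) simp
    ultimately show ?thesis by (simp add: algebra_simps)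
  qed
  have bn1: "?b ^ n \<le> 1"
  proof -
    have "0 \<le> ?H" by simp
    then have "?b \<le> 1" unfolding H by simp
    then show ?thesis using b0 by (simp add: power_le_one)
  qed
  have meas: "measure (sample_law n f) A = (\<integral>z. (\<Prod>i<n. f (z i)) * indicator A z \<partial>?L)" if f: "prob_density f" for f
  proof -
    have i: "integrable ?L (\<lambda>z. \<Prod>i<n. f (z i))"
      by (rule power_int[OF dens(1)[OF f]])
    then have [measurable]: "(\<lambda>z. \<Prod>i<n. f (z i)) \<in> borel_measurable ?L" by simp
    have f0: "0 \<le> (\<Prod>i<n. f (z i))" for z by (intro prod_nonneg prob_densityD(2)[OF f])
    have "emeasure (sample_law n f) A = (\<integral>\<^sup>+z. ennreal ((\<Prod>i<n. f (z i)) * indicator A z) \<partial>?L)"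
      unfolding sample_law_density[OF f] using A f0
      by (subst emeasure_density) (auto intro!: nn_integral_cong split: split_indicator)
    also have "\<dots> = ennreal (\<integral>z. (\<Prod>i<n. f (z i)) * indicator A z \<partial>?L)"
      using i A f0 by (intro nn_integral_eq_integral integrable_real_mult_indicator) auto
    finally show ?thesis
      using f0 by (simp add: measure_def)
  qed
  have "\<bar>measure (sample_law n p) A - measure (sample_law n q) A\<bar>
      = \<bar>\<integral>z. P z * indicator A z - R z * indicator A z \<partial>?L\<bar>"
    unfolding meas[OF p] meas[OF q] P_def[symmetric] R_def[symmetric]
    using iP iR A by (subst Bochner_Integration.integral_diff) (auto intro!: integrable_real_mult_indicator)
  also have "\<dots> \<le> (\<integral>z. \<bar>P z * indicator A z - R z * indicator A z\<bar> \<partial>?L)"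
    by (rule integral_abs_bound)
  also have "\<dots> \<le> (\<integral>z. (P z + R z - 2 * (sqrt (P z) * sqrt (R z))) / (2 * \<delta>) +
      \<delta> / 2 * (P z + R z + 2 * (sqrt (P z) * sqrt (R z))) \<partial>?L)"
  proof (rule integral_mono)
    show "integrable ?L (\<lambda>z. \<bar>P z * indicator A z - R z * indicator A z\<bar>)"
      using iP iR A by (intro integrable_abs Bochner_Integration.integrable_diff integrable_real_mult_indicator) auto
    show "integrable ?L (\<lambda>z. (P z + R z - 2 * (sqrt (P z) * sqrt (R z))) / (2 * \<delta>) +
      \<delta> / 2 * (P z + R z + 2 * (sqrt (P z) * sqrt (R z))))"
      using iP iR iB by simp
    fix z
    define u where "u = sqrt (P z)" define v where "v = sqrt (R z)"
    have uv: "P z = u\<^sup>2" "R z = v\<^sup>2" "0 \<le> u" "0 \<le> v" using P0[of z] R0[of z] by (auto simp: u_def v_def)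
    have "\<bar>P z * indicator A z - R z * indicator A z\<bar> \<le> \<bar>P z - R z\<bar>"
      by (auto split: split_indicator)
    also have "\<dots> = \<bar>u - v\<bar> * (u + v)"
    proof -
      have "P z - R z = (u - v) * (u + v)"
        unfolding uv(1,2) by (simp add: power2_eq_square algebra_simps)
      then show ?thesis using uv(3,4) by (simp add: abs_mult)
    qed
    also have "\<dots> \<le> (u - v)\<^sup>2 / (2 * \<delta>) + \<delta> / 2 * (u + v)\<^sup>2"
    proof -
      have "0 \<le> (\<bar>u - v\<bar> - \<delta> * (u + v))\<^sup>2" by simp
      then have "2 * \<delta> * (\<bar>u - v\<bar> * (u + v)) \<le> (u - v)\<^sup>2 + \<delta>\<^sup>2 * (u + v)\<^sup>2"
        by (simp only: power2_diff power_mult_distrib power2_abs) (simp add: algebra_simps)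
      moreover have "(u - v)\<^sup>2 / (2 * \<delta>) + \<delta> / 2 * (u + v)\<^sup>2 = ((u - v)\<^sup>2 + \<delta>\<^sup>2 * (u + v)\<^sup>2) / (2 * \<delta>)"
        using \<delta> by (simp add: add_divide_distrib power2_eq_square)
      ultimately show ?thesis
        using \<delta> by (simp only:) (simp add: pos_le_divide_eq mult.commute)
    qed
    also have "\<dots> = (P z + R z - 2 * (sqrt (P z) * sqrt (R z))) / (2 * \<delta>) + \<delta> / 2 * (P z + R z + 2 * (sqrt (P z) * sqrt (R z)))"
      unfolding minus[symmetric] plus[symmetric] u_def v_def ..
    finally show "\<bar>P z * indicator A z - R z * indicator A z\<bar> \<le> (P z + R z - 2 * (sqrt (P z) * sqrt (R z))) / (2 * \<delta>) +
      \<delta> / 2 * (P z + R z + 2 * (sqrt (P z) * sqrt (R z)))" .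
  qed
  also have "\<dots> = (2 - 2 * ?b ^ n) / (2 * \<delta>) + \<delta> / 2 * (2 + 2 * ?b ^ n)"
    using iP iR iB by simp
  also have "\<dots> \<le> n * ?H / (2 * \<delta>) + 2 * \<delta>"
  proof (intro add_mono divide_right_mono)
    show "2 - 2 * ?b ^ n \<le> n * ?H" using bern by simp
    show "\<delta> / 2 * (2 + 2 * ?b ^ n) \<le> 2 * \<delta>" using \<delta> mult_left_mono[OF bn1, of \<delta>] by (simp add: algebra_simps)
  qed (use \<delta> in auto)
  finally show ?thesis .
qed

section \<open>Quadratic mean differentiability\<close>

text \<open>With y = sqrt(1 + x) the error is (y - 1)^2 / 2, while x^2 = (y - 1)^2 (y + 1)^2 and y +
  1 \<ge> 1.\<close>

lemma abs_sqrt_one_plus_le: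
  assumes "- 1 \<le> x"
  shows "\<bar>sqrt (1 + x) - 1 - x / 2\<bar> \<le> x\<^sup>2 / 2"
proof -
  define y where "y = sqrt (1 + x)"
  have y: "0 \<le> y" "x = y\<^sup>2 - 1" using assms by (auto simp: y_def)
  have "y - 1 - x / 2 = - ((y - 1)\<^sup>2 / 2)"
    unfolding y(2) by (simp add: power2_eq_square field_simps)
  then have "\<bar>y - 1 - x / 2\<bar> = (y - 1)\<^sup>2 / 2" by simp
  also have "\<dots> \<le> (y - 1)\<^sup>2 * (y + 1)\<^sup>2 / 2"
    using y(1) mult_left_mono[of 1 "(y + 1)\<^sup>2" "(y - 1)\<^sup>2"] by (simp add: power_le_one one_le_power)
  also have "(y - 1)\<^sup>2 * (y + 1)\<^sup>2 = x\<^sup>2"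
    unfolding y(2) power_mult_distrib[symmetric] by (simp add: power2_eq_square algebra_simps)
  finally show ?thesis by (simp add: y_def)
qed

section \<open>Bounded approximation of the score and of the model\<close>

context independence_model
begin

lemma law_joint_1: "law (joint (\<lambda>_. 1)) = X_law \<Otimes>\<^sub>M Y_law"
  by (subst law_joint) (auto simp: density_1)

text \<open>The score is truncated, and the conditional mean \<open>m\<close> of the truncation
  given X is subtracted, which restores centring for every \<open>x\<close>. Since the score has
  conditional mean 0, E m^2 = E m (b0 - l), whence E m^2 \<le> E (l - b0)^2: the correction is no
  larger than the truncation error.\<close>

lemma bounded_centred_approximation:
  fixes l :: "real \<times> real \<Rightarrow> real"
  assumes l [measurable]: "l \<in> borel_measurable borel"
    and l2: "integrable (law (joint (\<lambda>_. 1))) (\<lambda>z. (l z)\<^sup>2)"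
    and cond: "AE z in law (joint (\<lambda>_. 1)). cond_exp_given (law (joint (\<lambda>_. 1))) fst l z = 0"
    and \<kappa>: "0 < \<kappa>"
  obtains K b where "0 \<le> K" "b \<in> borel_measurable borel" "\<And>z. \<bar>b z\<bar> \<le> K"
    "\<And>x. (\<integral>u. b (x, Q u) \<partial>unif01) = 0"
    "integrable (law (joint (\<lambda>_. 1))) (\<lambda>z. (l z - b z)\<^sup>2)"
    "(\<integral>z. (l z - b z)\<^sup>2 \<partial>law (joint (\<lambda>_. 1))) \<le> \<kappa>"
proof -
  define P where "P = law (joint (\<lambda>_. 1))"
  interpret X: prob_space X_law by (rule prob_space_X_law)
  interpret Y: prob_space Y_law by (rule prob_space_Y_law)
  interpret XY: pair_prob_space X_law Y_law ..
  have P: "P = X_law \<Otimes>\<^sub>M Y_law" unfolding P_def by (rule law_joint_1)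
  interpret P: prob_space P unfolding P by (rule XY.P.prob_space_axioms)
  have setsP [measurable_cong, simp]: "sets P = sets borel" by (simp add: P_def law_def)
  have spaceP [simp]: "space P = UNIV" by (simp add: P_def law_def)
  have l2P: "integrable P (\<lambda>z. (l z)\<^sup>2)" using l2 by (simp add: P_def)
  define tr where "tr k z = max (- real k) (min (real k) (l z))" for k z
  have tr_m [measurable]: "tr k \<in> borel_measurable borel" for k unfolding tr_def by measurable
  have tr_le: "\<bar>tr k z\<bar> \<le> k" for k z by (auto simp: tr_def)
  have "(\<lambda>k. \<integral>z. (l z - tr k z)\<^sup>2 \<partial>P) \<longlonglongrightarrow> (\<integral>z. 0 \<partial>P)"
  proof (rule integral_dominated_convergence[where w="\<lambda>z. (l z)\<^sup>2"])
    show "AE z in P. (\<lambda>k. (l z - tr k z)\<^sup>2) \<longlonglongrightarrow> 0"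
    proof (intro AE_I2)
      fix z
      obtain N :: nat where "\<bar>l z\<bar> \<le> N" using real_arch_simple by blast
      then have "\<forall>\<^sub>F k in sequentially. 0 = (l z - tr k z)\<^sup>2"
        by (intro eventually_sequentiallyI[of N]) (auto simp: tr_def)
      then show "(\<lambda>k. (l z - tr k z)\<^sup>2) \<longlonglongrightarrow> 0"
        by (rule Lim_transform_eventually[OF tendsto_const])
    qed
    show "AE z in P. norm ((l z - tr k z)\<^sup>2) \<le> (l z)\<^sup>2" for k
    proof (intro AE_I2)
      fix z
      have "\<bar>l z - tr k z\<bar> \<le> \<bar>l z\<bar>" by (auto simp: tr_def)
      then show "norm ((l z - tr k z)\<^sup>2) \<le> (l z)\<^sup>2" by (simp add: abs_le_square_iff)
    qed
  qed (use l2P in auto)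
  \<comment> \<open>The fraction 1/4 pays for (a + b)^2 \<le> 2 a^2 + 2 b^2, applied to the
    truncation error and the conditional mean.\<close>
  then have "\<forall>\<^sub>F k in sequentially. (\<integral>z. (l z - tr k z)\<^sup>2 \<partial>P) < \<kappa> / 4"
    using \<kappa> by (intro order_tendstoD(2)) auto
  then obtain k where k: "(\<integral>z. (l z - tr k z)\<^sup>2 \<partial>P) < \<kappa> / 4"
    by (auto simp: eventually_sequentially)
  define b0 where "b0 = tr k"
  have b0_m [measurable]: "b0 \<in> borel_measurable borel" and b0_le: "\<bar>b0 z\<bar> \<le> k" for z
    unfolding b0_def by (auto intro: tr_le)
  have b0_slice: "integrable unif01 (\<lambda>u. b0 (x, Q u))" for x
  proof -
    have "(\<lambda>u. (x, Q u)) \<in> unif01 \<rightarrow>\<^sub>M (borel :: (real \<times> real) measure)"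
      by (simp add: borel_prod[symmetric])
    from measurable_compose[OF this b0_m] show ?thesis
      using b0_le by (intro unif01.integrable_bounded_measurable bounded_measurableI) auto
  qed
  define m where "m x = (\<integral>u. b0 (x, Q u) \<partial>unif01)" for x
  have m_m [measurable]: "m \<in> borel_measurable borel"
  proof -
    have "(\<lambda>p. (fst p, Q (snd p))) \<in> borel \<Otimes>\<^sub>M unif01 \<rightarrow>\<^sub>M (borel :: (real \<times> real) measure)"
      by (simp add: borel_prod[symmetric])
    from measurable_compose[OF this b0_m]
    have "(\<lambda>(x, u). b0 (x, Q u)) \<in> borel_measurable (borel \<Otimes>\<^sub>M unif01)"
      by (simp add: case_prod_unfold)
    then show ?thesis
      unfolding m_def by (rule unif01.borel_measurable_lebesgue_integral)
  qed
  have m_le: "\<bar>m x\<bar> \<le> k" for x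
  proof -
    have "\<bar>m x\<bar> \<le> (\<integral>u. \<bar>b0 (x, Q u)\<bar> \<partial>unif01)" unfolding m_def by (rule integral_abs_bound)
    also have "\<dots> \<le> (\<integral>u. real k \<partial>unif01)"
      using b0_slice b0_le by (intro integral_mono integrable_abs) auto
    finally show ?thesis by simp
  qed
  have fst_m [measurable]: "fst \<in> borel_measurable P"
    unfolding P by (simp add: measurable_cong_sets[OF refl sets_laws(1), symmetric])
  have mf_m [measurable]: "(\<lambda>z. m (fst z)) \<in> borel_measurable P"
    by (rule measurable_compose[OF fst_m m_m])
  have b0_P [measurable]: "b0 \<in> borel_measurable P" by simp
  have Y_int: "(\<integral>y. b0 (x, y) \<partial>Y_law) = m x" for x
  proof -
    have "(\<lambda>y. b0 (x, y)) \<in> borel_measurable borel"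
      using measurable_compose[OF measurable_Pair1'[of x borel borel], of b0 borel] b0_m
      by (simp add: borel_prod)
    then show ?thesis
      unfolding Y_law_def distr_Q[symmetric] m_def by (intro integral_distr) auto
  qed
  note intP = P.integrable_bounded_measurable
  have bm_m: "bounded_measurable P (\<lambda>z. m (fst z))" and bm_b0: "bounded_measurable P b0"
    using m_le b0_le by (auto intro!: bounded_measurableI)
  have E1: "(\<integral>z. m (fst z) * b0 z \<partial>P) = (\<integral>z. (m (fst z))\<^sup>2 \<partial>P)"
  proof -
    have i1: "integrable (X_law \<Otimes>\<^sub>M Y_law) (\<lambda>z. m (fst z) * b0 z)"
      and i2: "integrable (X_law \<Otimes>\<^sub>M Y_law) (\<lambda>z. (m (fst z))\<^sup>2)"
      unfolding P[symmetric] by (intro intP bounded_measurable_intros bm_m bm_b0)+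
    have "(\<integral>z. m (fst z) * b0 z \<partial>P) = (\<integral>x. (\<integral>y. m x * b0 (x, y) \<partial>Y_law) \<partial>X_law)"
      unfolding P using XY.integral_fst'[OF i1] by simp
    also have "\<dots> = (\<integral>x. (\<integral>y. (m x)\<^sup>2 \<partial>Y_law) \<partial>X_law)"
      by (simp add: Y_int power2_eq_square Y.prob_space[simplified])
    also have "\<dots> = (\<integral>z. (m (fst z))\<^sup>2 \<partial>P)"
      unfolding P using XY.integral_fst'[OF i2] by simp
    finally show ?thesis .
  qed
  have il: "integrable P l"
  proof (rule Bochner_Integration.integrable_bound[of _ "\<lambda>z. 1 + (l z)\<^sup>2"])
    show "integrable P (\<lambda>z. 1 + (l z)\<^sup>2)" using l2P by simp
    show "AE z in P. norm (l z) \<le> norm (1 + (l z)\<^sup>2)"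
    proof (intro AE_I2)
      fix z
      have "2 * 1 * \<bar>l z\<bar> \<le> 1\<^sup>2 + \<bar>l z\<bar>\<^sup>2" by (rule sum_squares_bound)
      then show "norm (l z) \<le> norm (1 + (l z)\<^sup>2)" by simp
    qed
  qed simp
  have iml: "integrable P (\<lambda>z. m (fst z) * l z)"
  proof (rule Bochner_Integration.integrable_bound[of _ "\<lambda>z. real k * \<bar>l z\<bar>"])
    show "integrable P (\<lambda>z. real k * \<bar>l z\<bar>)" using il by simp
    show "AE z in P. norm (m (fst z) * l z) \<le> norm (real k * \<bar>l z\<bar>)"
      using m_le by (intro AE_I2) (auto simp: abs_mult intro!: mult_right_mono)
  qed simp
  let ?F = "vimage_algebra (space P) fst (borel :: real measure)"
  have sub: "finite_measure_subalgebra P ?F"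
  proof
    show "subalgebra P ?F"
      unfolding subalgebra_def using sets_image_in_sets[OF refl fst_m] by auto
  qed
  interpret S: finite_measure_subalgebra P ?F by (rule sub)
  have mF: "(\<lambda>z. m (fst z)) \<in> borel_measurable ?F"
    by (rule measurable_compose[OF measurable_vimage_algebra1 m_m]) simp
  \<comment> \<open>Tested against the bounded X-measurable function \<open>m\<close>, the vanishing
    conditional expectation makes the score orthogonal to it.\<close>
  have E2: "(\<integral>z. m (fst z) * l z \<partial>P) = 0"
  proof -
    have "(\<integral>z. m (fst z) * l z \<partial>P) = (\<integral>z. m (fst z) * real_cond_exp P ?F l z \<partial>P)"
      using S.real_cond_exp_intg(2)[OF iml mF] by simp
    also have "\<dots> = 0"
      using cond unfolding cond_exp_given_def P_def[symmetric]
      by (intro integral_eq_zero_AE) auto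
    finally show ?thesis .
  qed
  have id: "integrable P (\<lambda>z. (l z - b0 z)\<^sup>2)"
  proof -
    have "(\<lambda>z. (l z - b0 z)\<^sup>2) = (\<lambda>z. (l z)\<^sup>2 - 2 * (b0 z * l z) + (b0 z)\<^sup>2)"
      by (simp add: fun_eq_iff power2_diff algebra_simps)
    moreover have "integrable P (\<lambda>z. b0 z * l z)"
    proof (rule Bochner_Integration.integrable_bound[of _ "\<lambda>z. real k * \<bar>l z\<bar>"])
      show "integrable P (\<lambda>z. real k * \<bar>l z\<bar>)" using il by simp
      show "AE z in P. norm (b0 z * l z) \<le> norm (real k * \<bar>l z\<bar>)"
        using b0_le by (intro AE_I2) (auto simp: abs_mult intro!: mult_right_mono)
    qed simp
    moreover have "integrable P (\<lambda>z. (b0 z)\<^sup>2)" by (intro intP bounded_measurable_intros bm_b0)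
    ultimately show ?thesis using l2P by simp
  qed
  have im2: "integrable P (\<lambda>z. (m (fst z))\<^sup>2)" by (intro intP bounded_measurable_intros bm_m)
  have imb: "integrable P (\<lambda>z. m (fst z) * b0 z)" by (intro intP bounded_measurable_intros bm_m bm_b0)
  have "(\<integral>z. (m (fst z))\<^sup>2 \<partial>P) = (\<integral>z. m (fst z) * b0 z - m (fst z) * l z \<partial>P)"
    using E1 E2 imb iml by simp
  also have "\<dots> \<le> (\<integral>z. ((m (fst z))\<^sup>2 + (l z - b0 z)\<^sup>2) / 2 \<partial>P)"
  proof (rule integral_mono)
    fix z
    have "2 * m (fst z) * (b0 z - l z) \<le> (m (fst z))\<^sup>2 + (b0 z - l z)\<^sup>2" by (rule sum_squares_bound)
    then show "m (fst z) * b0 z - m (fst z) * l z \<le> ((m (fst z))\<^sup>2 + (l z - b0 z)\<^sup>2) / 2"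
      by (simp add: algebra_simps power2_commute)
  qed (use imb iml im2 id in auto)
  also have "\<dots> = ((\<integral>z. (m (fst z))\<^sup>2 \<partial>P) + (\<integral>z. (l z - b0 z)\<^sup>2 \<partial>P)) / 2"
    using im2 id by simp
  finally have m2: "(\<integral>z. (m (fst z))\<^sup>2 \<partial>P) \<le> \<kappa> / 4"
    using k by (simp add: b0_def)
  define b where "b z = b0 z - m (fst z)" for z
  have dom: "(l z - b z)\<^sup>2 \<le> 2 * (l z - b0 z)\<^sup>2 + 2 * (m (fst z))\<^sup>2" for z
  proof -
    have "l z - b z = (l z - b0 z) + m (fst z)" by (simp add: b_def)
    then show ?thesis
      using sum_squares_bound[of "l z - b0 z" "m (fst z)"] by (simp only: power2_sum)
  qed
  have b_m: "b \<in> borel_measurable borel"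
  proof -
    have "b \<in> borel_measurable P" unfolding b_def by measurable
    then show ?thesis by simp
  qed
  show ?thesis
  proof (rule that[of "2 * real k" b])
    show "\<bar>b z\<bar> \<le> 2 * real k" for z
      using b0_le[of z] m_le[of "fst z"] by (simp add: b_def)
    show "(\<integral>u. b (x, Q u) \<partial>unif01) = 0" for x
      using b0_slice[of x] by (simp add: b_def m_def)
    show i: "integrable (law (joint (\<lambda>_. 1))) (\<lambda>z. (l z - b z)\<^sup>2)"
      unfolding P_def[symmetric]
    proof (rule Bochner_Integration.integrable_bound[of _ "\<lambda>z. 2 * (l z - b0 z)\<^sup>2 + 2 * (m (fst z))\<^sup>2"])
      show "integrable P (\<lambda>z. 2 * (l z - b0 z)\<^sup>2 + 2 * (m (fst z))\<^sup>2)" using id im2 by simp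
      show "AE z in P. norm ((l z - b z)\<^sup>2) \<le> norm (2 * (l z - b0 z)\<^sup>2 + 2 * (m (fst z))\<^sup>2)"
        using dom by (intro AE_I2) auto
    qed (use b_m in simp)
    have "(\<integral>z. (l z - b z)\<^sup>2 \<partial>P) \<le> (\<integral>z. 2 * (l z - b0 z)\<^sup>2 + 2 * (m (fst z))\<^sup>2 \<partial>P)"
      using i id im2 dom by (intro integral_mono) (auto simp: P_def)
    also have "\<dots> = 2 * (\<integral>z. (l z - b0 z)\<^sup>2 \<partial>P) + 2 * (\<integral>z. (m (fst z))\<^sup>2 \<partial>P)"
      using id im2 by simp
    also have "\<dots> \<le> \<kappa>" using k m2 by (simp add: b0_def)
    finally show "(\<integral>z. (l z - b z)\<^sup>2 \<partial>law (joint (\<lambda>_. 1))) \<le> \<kappa>" by (simp add: P_def)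
  qed (use b_m in auto)
qed

text \<open>The difference of square roots splits into the remainder of quadratic mean
  differentiability, the error of replacing the score by \<open>b\<close>, and the Taylor error of
  sqrt(1 + \<theta> b). The factor 3 comes from squaring a sum of three terms.\<close>

lemma hellinger_perturbation_le:
  fixes l b p :: "real \<times> real \<Rightarrow> real"
  assumes b: "b \<in> borel_measurable borel" "\<And>z. \<bar>b z\<bar> \<le> K" and \<theta>: "\<bar>\<theta>\<bar> * K \<le> 1"
    and l: "l \<in> borel_measurable borel"
    and close: "integrable (law (joint (\<lambda>_. 1))) (\<lambda>z. (l z - b z)\<^sup>2)"
      "(\<integral>z. (l z - b z)\<^sup>2 \<partial>law (joint (\<lambda>_. 1))) \<le> \<kappa>"
    and R: "integrable lborel (\<lambda>z. (sqrt (p z) - sqrt (joint (\<lambda>_. 1) z) - 1 / 2 * \<theta> * l z * sqrt (joint (\<lambda>_. 1) z))\<^sup>2)"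
  shows "(\<integral>z. (sqrt (p z) - sqrt (joint (\<lambda>z. 1 + \<theta> * b z) z))\<^sup>2 \<partial>lborel) \<le>
    3 * ((\<integral>z. (sqrt (p z) - sqrt (joint (\<lambda>_. 1) z) - 1 / 2 * \<theta> * l z * sqrt (joint (\<lambda>_. 1) z))\<^sup>2 \<partial>lborel)
      + \<theta>\<^sup>2 / 4 * \<kappa> + (\<theta> * K) ^ 4 / 4)"
proof -
  let ?h = "joint (\<lambda>_. 1)"
  let ?R = "\<lambda>z. sqrt (p z) - sqrt (?h z) - 1 / 2 * \<theta> * l z * sqrt (?h z)"
  note [measurable] = prob_densityD(1)[OF f0] prob_densityD(1)[OF g0] b(1) l
  have hm [measurable]: "?h \<in> borel_measurable borel"
    unfolding joint_def by (simp add: borel_prod[symmetric])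
  have h0: "0 \<le> ?h z" for z by (simp add: joint_def prob_densityD(2)[OF f0] prob_densityD(2)[OF g0])
  have prob: "prob_space (law ?h)"
  proof -
    interpret Z: centred_perturbation f0 g0 Q "\<lambda>_. 0" by standard auto
    show ?thesis using Z.prob_space_law_perturbed by simp
  qed
  interpret L: prob_space "law ?h" by (rule prob)
  have int_h: "integrable lborel (\<lambda>z. ?h z * f z)" "(\<integral>z. ?h z * f z \<partial>lborel) = (\<integral>z. f z \<partial>law ?h)"
    if "integrable (law ?h) f" for f :: "real \<times> real \<Rightarrow> real"
  proof -
    have [measurable]: "f \<in> borel_measurable borel"
      using borel_measurable_integrable[OF that] by (simp add: measurable_cong_sets[OF sets_law refl])
    show "integrable lborel (\<lambda>z. ?h z * f z)" "(\<integral>z. ?h z * f z \<partial>lborel) = (\<integral>z. f z \<partial>law ?h)"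
      using that h0 unfolding law_def by (simp_all add: integrable_density integral_density)
  qed
  have i1: "integrable lborel (\<lambda>z. ?h z * (l z - b z)\<^sup>2)" by (rule int_h[OF close(1)])
  have i2: "integrable lborel ?h" "(\<integral>z. ?h z \<partial>lborel) = 1"
    using int_h[of "\<lambda>_. 1"] L.prob_space by simp_all
  let ?B = "\<lambda>z. 3 * ((?R z)\<^sup>2 + \<theta>\<^sup>2 / 4 * (?h z * (l z - b z)\<^sup>2) + (\<theta> * K) ^ 4 / 4 * ?h z)"
  have "(\<integral>z. (sqrt (p z) - sqrt (joint (\<lambda>z. 1 + \<theta> * b z) z))\<^sup>2 \<partial>lborel) \<le> (\<integral>z. ?B z \<partial>lborel)"
  \<comment> \<open>Nothing is assumed on \<open>p\<close> itself, so the left integrand need not be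
    integrable. In that case its integral is 0, which is why nonnegativity of the bound is
    checked.\<close>
  proof (rule integral_mono')
    show "integrable lborel ?B" using R i1 i2 by simp
    show "0 \<le> ?B z" for z using h0[of z] by simp
    fix z
    let ?s = "sqrt (?h z)" and ?x = "\<theta> * b z"
    have x: "\<bar>?x\<bar> \<le> \<bar>\<theta>\<bar> * K" unfolding abs_mult by (rule mult_left_mono[OF b(2) abs_ge_zero])
    have x1: "\<bar>?x\<bar> \<le> 1" by (rule order_trans[OF x \<theta>])
    have "0 \<le> K" using b(2)[of z] by linarith
    then have xK: "\<bar>?x\<bar> \<le> \<bar>\<theta> * K\<bar>" using x by (simp add: abs_mult)
    have q: "sqrt (joint (\<lambda>z. 1 + \<theta> * b z) z) = ?s * sqrt (1 + ?x)"
      by (simp add: joint_def real_sqrt_mult)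
    let ?w = "sqrt (1 + ?x) - 1 - ?x / 2"
    have eq: "sqrt (p z) - sqrt (joint (\<lambda>z. 1 + \<theta> * b z) z) = ?R z + (1 / 2 * \<theta> * (l z - b z) * ?s) + - (?s * ?w)"
    proof -
      have "P - s * S = (P - s - 1 / 2 * \<theta> * L * s) + 1 / 2 * \<theta> * (L - B) * s + - (s * (S - 1 - \<theta> * B / 2))"
        for P s S L B :: real
        by (simp add: field_simps)
      then show ?thesis unfolding q by this
    qed
    have three: "(a1 + a2 + a3)\<^sup>2 \<le> 3 * (a1\<^sup>2 + a2\<^sup>2 + a3\<^sup>2)" for a1 a2 a3 :: real
      using sum_squares_bound[of a1 a2] sum_squares_bound[of a1 a3] sum_squares_bound[of a2 a3]
      by (simp add: power2_eq_square algebra_simps)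
    have "?w\<^sup>2 \<le> (\<theta> * K) ^ 4 / 4"
    proof -
      have "\<bar>?w\<bar> \<le> ?x\<^sup>2 / 2" using x1 by (intro abs_sqrt_one_plus_le) linarith
      also have "?x\<^sup>2 / 2 \<le> (\<theta> * K)\<^sup>2 / 2" using xK by (simp add: abs_le_square_iff)
      finally have "\<bar>?w\<bar>\<^sup>2 \<le> ((\<theta> * K)\<^sup>2 / 2)\<^sup>2" by (intro power_mono) auto
      then show ?thesis by (simp add: power_divide flip: power_mult)
    qed
    then have sq3: "(- (?s * ?w))\<^sup>2 \<le> (\<theta> * K) ^ 4 / 4 * ?h z"
      using h0[of z] mult_right_mono[of "?w\<^sup>2" "(\<theta> * K) ^ 4 / 4" "?h z"]
      by (simp add: power_mult_distrib mult.commute)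
    have sq2: "(1 / 2 * \<theta> * (l z - b z) * ?s)\<^sup>2 = \<theta>\<^sup>2 / 4 * (?h z * (l z - b z)\<^sup>2)"
      using h0[of z] by (simp add: power_mult_distrib power_divide)
    show "(sqrt (p z) - sqrt (joint (\<lambda>z. 1 + \<theta> * b z) z))\<^sup>2 \<le> ?B z"
      unfolding eq by (rule order_trans[OF three]) (intro mult_left_mono add_mono order_refl eq_refl[OF sq2] sq3; simp)
  qed
  also have "\<dots> = 3 * ((\<integral>z. (?R z)\<^sup>2 \<partial>lborel) + \<theta>\<^sup>2 / 4 * (\<integral>z. (l z - b z)\<^sup>2 \<partial>law ?h) + (\<theta> * K) ^ 4 / 4)"
    using R i1 i2 int_h(2)[OF close(1)] by simp
  also have "\<dots> \<le> 3 * ((\<integral>z. (?R z)\<^sup>2 \<partial>lborel) + \<theta>\<^sup>2 / 4 * \<kappa> + (\<theta> * K) ^ 4 / 4)"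
    using close(2) by (intro mult_left_mono add_mono) auto
  finally show ?thesis .
qed

end

section \<open>The limiting level along local alternatives\<close>

theorem proposition2p3:
  fixes h :: "real \<Rightarrow> real \<times> real \<Rightarrow> real"
    and f0 g0 :: "real \<Rightarrow> real"
    and l :: "real \<times> real \<Rightarrow> real"
    and \<alpha> \<epsilon> M :: real
    and t \<theta> :: "nat \<Rightarrow> real"
  assumes model: "model_assumptions h f0 g0 l"
    and cond_X: "AE z in law (h 0). cond_exp_given (law (h 0)) fst l z = 0"
    and cond_Y: "AE z in law (h 0). cond_exp_given (law (h 0)) snd l z = 0"
    and alpha: "0 < \<alpha>" "\<alpha> < 1"
    and level: "(\<lambda>n. upper_tail_prob n (h 0) (t n)) \<longlonglongrightarrow> \<alpha>"
    and eps: "0 < \<epsilon>" "\<epsilon> \<le> M"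
    and theta: "\<forall>\<^sub>F n in sequentially.
      \<epsilon> / sqrt (real n) \<le> \<bar>\<theta> n\<bar> \<and> \<bar>\<theta> n\<bar> \<le> M / sqrt (real n) \<and> \<bar>\<theta> n\<bar> < 1"
  shows "liminf (\<lambda>n. ereal (upper_tail_prob n (h (\<theta> n)) (t n))) = ereal \<alpha>"
proof -
  have dens: "\<And>\<theta>. \<bar>\<theta>\<bar> < 1 \<Longrightarrow> prob_density (h \<theta>)" and f0: "prob_density f0" and g0: "prob_density g0"
    and h0_eq: "\<And>x y. h 0 (x, y) = f0 x * g0 y" and score: "is_score h l" and qmd: "qmd_at_0 h l"
    and info: "0 < (\<integral>z. (l z)\<^sup>2 \<partial>law (h 0))"
    using model by (auto simp: model_assumptions_def)
  obtain Q where Q: "Q \<in> borel_measurable unif01" "distr unif01 borel Q = density lborel (\<lambda>y. ennreal (g0 y))"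
      "\<And>u v. 0 < u \<Longrightarrow> u < v \<Longrightarrow> v < 1 \<Longrightarrow> Q u < Q v"
    using quantile_function_exists[OF g0] by metis
  interpret independence_model f0 g0 Q
    by standard (use f0 g0 Q in auto)
  have h0: "h 0 = joint (\<lambda>_. 1)"
    by (auto simp: fun_eq_iff joint_def h0_eq)
  have l: "l \<in> borel_measurable borel" using score by (simp add: is_score_def)
  \<comment> \<open>A non-integrable function has Bochner integral 0, so positive information
    already yields integrability.\<close>
  have l2: "integrable (law (h 0)) (\<lambda>z. (l z)\<^sup>2)"
    using info not_integrable_integral_eq by fastforce
  have M: "0 < M" using eps by linarith
  let ?R = "\<lambda>\<theta> z. (sqrt (h \<theta> z) - sqrt (h 0 z) - 1 / 2 * \<theta> * l z * sqrt (h 0 z))\<^sup>2"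
  have R_int: "\<forall>\<^sub>F \<theta> in at 0. integrable lborel (?R \<theta>)"
    and R_o: "(\<lambda>\<theta>. \<integral>z. ?R \<theta> z \<partial>lborel) \<in> o[at 0](\<lambda>\<theta>. \<theta>\<^sup>2)"
    using qmd by (simp_all add: qmd_at_0_def)
  have root: "filterlim (\<lambda>n. sqrt (real n)) at_top sequentially"
    by (rule filterlim_compose[OF sqrt_at_top filterlim_real_sequentially])
  have th0: "\<theta> \<longlonglongrightarrow> 0"
  proof (rule Lim_null_comparison)
    show "\<forall>\<^sub>F n in sequentially. norm (\<theta> n) \<le> M / sqrt (real n)"
      using theta by eventually_elim simp
    show "(\<lambda>n. M / sqrt (real n)) \<longlonglongrightarrow> 0"
      by (rule tendsto_divide_0[OF tendsto_const filterlim_at_top_imp_at_infinity[OF root]])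
  qed
  \<comment> \<open>The little-o estimate lives on the punctured filter at 0; the lower bound
    \<epsilon> / sqrt n keeps \<theta> n away from 0.\<close>
  have th_at: "filterlim \<theta> (at 0) sequentially"
  proof (rule filterlim_atI[OF th0])
    show "\<forall>\<^sub>F n in sequentially. \<theta> n \<noteq> 0"
      using theta eventually_gt_at_top[of 0]
    proof eventually_elim
      case (elim n)
      then have "0 < \<epsilon> / sqrt (real n)" using eps by simp
      then show ?case using elim by auto
    qed
  qed
  have "(\<lambda>n. upper_tail_prob n (h (\<theta> n)) (t n)) \<longlonglongrightarrow> \<alpha>"
  proof (rule tendstoI)
    fix e :: real assume e: "0 < e"
    \<comment> \<open>The constants fit the closing estimate: 15/4 * \<kappa> * M^2 = 5/12 * \<rho>,
      a term below \<rho> / 3 is added, and weight \<delta> = e/4 then bounds the distance of the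
      sample laws by e/8 + e/2.\<close>
    define \<rho> where "\<rho> = e\<^sup>2 / 16"
    define \<kappa> where "\<kappa> = \<rho> / (9 * M\<^sup>2)"
    have \<rho>: "0 < \<rho>" and \<kappa>: "0 < \<kappa>" using e M by (auto simp: \<rho>_def \<kappa>_def)
    obtain K b where K: "0 \<le> K" and b: "b \<in> borel_measurable borel" "\<And>z. \<bar>b z\<bar> \<le> K"
      "\<And>x. (\<integral>u. b (x, Q u) \<partial>unif01) = 0"
      and close: "integrable (law (joint (\<lambda>_. 1))) (\<lambda>z. (l z - b z)\<^sup>2)"
      "(\<integral>z. (l z - b z)\<^sup>2 \<partial>law (joint (\<lambda>_. 1))) \<le> \<kappa>"
    proof (rule bounded_centred_approximation[OF l l2[unfolded h0] cond_X[unfolded h0] \<kappa>], goal_cases)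
      case (1 K b)
      show ?case by (rule 1(1)[OF 1(2-)])
    qed
    \<comment> \<open>Where \<open>n\<close> is not good the perturbation is set to 0, so its bounds
      hold for every \<open>n\<close>. At \<open>n = 0\<close> division by zero makes M / sqrt n
      equal to 0, and either \<theta> 0 = 0 or the perturbation is 0.\<close>
    define good where "good n \<longleftrightarrow> \<bar>\<theta> n\<bar> \<le> M / sqrt (real n) \<and> \<bar>\<theta> n\<bar> * K \<le> 1" for n
    define c where "c n z = (if good n then \<theta> n * b z else 0)" for n z
    have pert: "centred_perturbation f0 g0 Q (c n)" for n
    proof
      show "c n \<in> borel_measurable borel" unfolding c_def using b(1) by simp
      show "\<bar>c n z\<bar> \<le> 1" for z
      proof (cases "good n")
        case True
        then have "\<bar>\<theta> n\<bar> * \<bar>b z\<bar> \<le> \<bar>\<theta> n\<bar> * K" using b(2) by (intro mult_left_mono) auto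
        then show ?thesis using True by (auto simp: c_def good_def abs_mult)
      qed (simp add: c_def)
      show "(\<integral>u. c n (x, Q u) \<partial>unif01) = 0" for x
        using b(3) by (cases "good n") (simp_all add: c_def)
    qed
    have cD: "\<bar>c n z\<bar> \<le> (M * K) / sqrt n" for n z
    proof (cases "good n")
      case True
      then have "\<bar>\<theta> n\<bar> * \<bar>b z\<bar> \<le> M / sqrt n * K" using b(2) M by (intro mult_mono) (auto simp: good_def)
      then show ?thesis using True by (simp add: c_def abs_mult)
    qed (use M K in \<open>simp add: c_def\<close>)
    have Qlim: "(\<lambda>n. upper_tail_prob n (joint (\<lambda>z. 1 + c n z)) (t n)) \<longlonglongrightarrow> \<alpha>"
      using perturbed_level[OF pert cD level[unfolded h0] alpha] .
    have ev_good: "\<forall>\<^sub>F n in sequentially. good n"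
    proof -
      have "(\<lambda>n. \<bar>\<theta> n\<bar> * K) \<longlonglongrightarrow> \<bar>0\<bar> * K" by (intro tendsto_intros th0)
      then have "\<forall>\<^sub>F n in sequentially. \<bar>\<theta> n\<bar> * K < 1" by (intro order_tendstoD) auto
      with theta show ?thesis by eventually_elim (auto simp: good_def)
    qed
    have ev_R: "\<forall>\<^sub>F n in sequentially. integrable lborel (?R (\<theta> n))"
      using filterlim_iff[THEN iffD1, OF th_at] R_int by blast
    have "\<forall>\<^sub>F \<theta> in at 0. norm (\<integral>z. ?R \<theta> z \<partial>lborel) \<le> \<kappa> * norm (\<theta>\<^sup>2)"
      using R_o \<kappa> by (rule landau_o.smallD)
    then have ev_o: "\<forall>\<^sub>F n in sequentially. norm (\<integral>z. ?R (\<theta> n) z \<partial>lborel) \<le> \<kappa> * norm ((\<theta> n)\<^sup>2)"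
      using filterlim_iff[THEN iffD1, OF th_at] by blast
    have ev_n: "\<forall>\<^sub>F n in sequentially. 3 * (M * K) ^ 4 / 4 / real n < \<rho> / 3"
    proof -
      have "(\<lambda>n. 3 * (M * K) ^ 4 / 4 / real n) \<longlonglongrightarrow> 0"
        by (rule tendsto_divide_0[OF tendsto_const filterlim_at_top_imp_at_infinity[OF filterlim_real_sequentially]])
      then show ?thesis using \<rho> by (intro order_tendstoD) auto
    qed
    have "\<forall>\<^sub>F n in sequentially. dist (upper_tail_prob n (joint (\<lambda>z. 1 + c n z)) (t n)) \<alpha> < e / 4"
      using Qlim e by (intro tendstoD) auto
    then show "\<forall>\<^sub>F n in sequentially. dist (upper_tail_prob n (h (\<theta> n)) (t n)) \<alpha> < e"
      using theta ev_good ev_R ev_o ev_n eventually_gt_at_top[of 0]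
    proof eventually_elim
      case (elim n)
      interpret C: centred_perturbation f0 g0 Q "c n" by (rule pert)
      let ?q = "joint (\<lambda>z. 1 + c n z)"
      have n: "0 < real n" using elim by simp
      have c_eq: "c n = (\<lambda>z. \<theta> n * b z)" using elim by (simp add: c_def fun_eq_iff)
      have nt: "real n * (\<theta> n)\<^sup>2 \<le> M\<^sup>2"
      proof -
        have "\<bar>\<theta> n\<bar>\<^sup>2 \<le> (M / sqrt n)\<^sup>2" using elim by (intro power_mono) auto
        then show ?thesis using n by (simp add: power_divide pos_le_divide_eq mult.commute)
      qed
      let ?H = "\<integral>z. (sqrt (h (\<theta> n) z) - sqrt (?q z))\<^sup>2 \<partial>lborel"
      have "?H \<le> 3 * ((\<integral>z. ?R (\<theta> n) z \<partial>lborel) + (\<theta> n)\<^sup>2 / 4 * \<kappa> + (\<theta> n * K) ^ 4 / 4)"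
        unfolding c_eq h0 using elim
        by (intro hellinger_perturbation_le[OF b(1,2) _ l close]) (auto simp: good_def h0)
      also have "\<dots> \<le> 3 * (\<kappa> * (\<theta> n)\<^sup>2 + (\<theta> n)\<^sup>2 / 4 * \<kappa> + (\<theta> n * K) ^ 4 / 4)"
        using elim by (intro mult_left_mono add_mono) auto
      finally have "real n * ?H \<le> real n * (3 * (\<kappa> * (\<theta> n)\<^sup>2 + (\<theta> n)\<^sup>2 / 4 * \<kappa> + (\<theta> n * K) ^ 4 / 4))"
        by (intro mult_left_mono) auto
      \<comment> \<open>Terms of second order appear only through n \<theta>^2, which stays below
        M^2; the term of fourth order keeps a factor 1/n and vanishes.\<close>
      also have "\<dots> = 15 / 4 * \<kappa> * (real n * (\<theta> n)\<^sup>2) + 3 * K ^ 4 / 4 * (real n * (\<theta> n)\<^sup>2)\<^sup>2 / real n"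
        using n by (simp add: field_simps power_mult_distrib eval_nat_numeral)
      also have "\<dots> \<le> 15 / 4 * \<kappa> * M\<^sup>2 + 3 * K ^ 4 / 4 * (M\<^sup>2)\<^sup>2 / real n"
        using nt \<kappa> n K by (intro add_mono mult_left_mono divide_right_mono power_mono) auto
      also have "\<dots> = 5 / 12 * \<rho> + 3 * (M * K) ^ 4 / 4 / real n"
        using M by (simp add: \<kappa>_def power_mult_distrib flip: power_mult)
      also have "\<dots> \<le> \<rho>" using elim \<rho> by simp
      finally have nH: "real n * ?H \<le> \<rho>" .
      have q_meas: "?q \<in> borel_measurable borel"
      proof -
        note [measurable] = prob_densityD(1)[OF f0] prob_densityD(1)[OF g0] C.measurable_c
        have "(\<lambda>z. f0 (fst z) * g0 (snd z)) \<in> borel_measurable (borel :: (real \<times> real) measure)"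
          by (simp add: borel_prod[symmetric])
        then show ?thesis unfolding joint_def by measurable
      qed
      have q: "prob_density ?q"
      proof -
        have "0 \<le> 1 + c n z" for z using C.abs_c_le_1[of z] by linarith
        then have "0 \<le> ?q z" for z
          by (simp add: joint_def prob_densityD(2)[OF f0] prob_densityD(2)[OF g0])
        moreover have "(\<integral>\<^sup>+z. ennreal (?q z) \<partial>lborel) = 1"
          using prob_space.emeasure_space_1[OF C.prob_space_law_perturbed] q_meas
          by (simp add: law_def emeasure_density)
        ultimately show ?thesis using q_meas by (simp add: prob_density_def)
      qed
      have p: "prob_density (h (\<theta> n))" using elim dens by auto
      let ?A = "{s \<in> space (PiM {..<n} (\<lambda>_. lborel :: (real \<times> real) measure)). t n \<le> sqrt (real n) * chatterjee n s}"
      have "sets (PiM {..<n} (\<lambda>_. lborel :: (real \<times> real) measure)) = sets (PiM {..<n} (\<lambda>_. borel))"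
        by (intro sets_PiM_cong) auto
      from measurable_chatterjee[OF this] have A: "?A \<in> sets (PiM {..<n} (\<lambda>_. lborel))" by measurable
      have up: "upper_tail_prob n f (t n) = measure (sample_law n f) ?A" for f
      proof -
        have "space (sample_law n f) = space (PiM {..<n} (\<lambda>_. lborel :: (real \<times> real) measure))"
          unfolding sample_law_def by (intro sets_eq_imp_space_eq sets_PiM_cong) (auto simp: law_def)
        then show ?thesis by (simp add: upper_tail_prob_def)
      qed
      have "\<bar>upper_tail_prob n (h (\<theta> n)) (t n) - upper_tail_prob n ?q (t n)\<bar> \<le> real n * ?H / (2 * (e / 4)) + 2 * (e / 4)"
        unfolding up using e by (intro sample_law_diff_le_hellinger p q A) auto
      also have "\<dots> \<le> \<rho> / (2 * (e / 4)) + 2 * (e / 4)"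
        using nH e by (intro add_mono divide_right_mono) auto
      also have "\<dots> = 5 / 8 * e" using e by (simp add: \<rho>_def power2_eq_square)
      finally show ?case using elim(1) e unfolding dist_real_def by linarith
    qed
  qed
  then have "(\<lambda>n. ereal (upper_tail_prob n (h (\<theta> n)) (t n))) \<longlonglongrightarrow> ereal \<alpha>"
    by (intro tendsto_ereal)
  then show ?thesis
    by (intro lim_imp_Liminf) auto
qed

end
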